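(* For every extended quiver $\widetilde{\mathcal{Q}}$ and every initial quantum super-seed $(M,\widetilde{\mathcal{Q}})$ in $\mathcal{F}$ with cluster $\mathbf{X}=(X_1,\dots,X_l)$, every cluster variable $Y$ obtained from $(M,\widetilde{\mathcal{Q}})$ by any series of allowed mutations belongs to the ring $\mathbb{ZP}[\mathbf{X}^{\pm1}]$.
   Context: **Extended quivers.** Let $\mathcal{Q}$ be a quiver with no loops and no 2-cycles, with (even) vertices $x_1,\dots,x_n$. An extended quiver $\widetilde{\mathcal{Q}}$ with underlying quiver $\mathcal{Q}$ has in addition $m$ odd vertices $\xi_1,\dots,\xi_m$, also written $x_{n+i}=\xi_i$, and, besides the arrows of $\mathcal{Q}$, arrows $\xi_i\to x_k$ for $i\in I_k$ and $x_k\to\xi_j$ for $j\in J_k$, where $I_k\cap J_k=\emptyset$ for every $1\le k\le n$. $\widetilde{\mathcal{Q}}_2$ denotes the set of 2-paths $\xi_i\to x_k\to\xi_j$ (odd-even-odd). Fix $l\le n$; the vertices $x_{l+1},\dots,x_{n+m}$ are frozen, and mutations are performed only at $x_k$ with $1\le k\le l$. **Quiver mutation** $\mu_k$ at $x_k$: (0) the underlying quiver mutates as in the classical (Fomin–Zelevinsky) case; (1) for each 2-path $\xi_i\to x_k\to\xi_j$, add the 2-paths $\xi_i\to x_\ell\to\xi_j$ for all even $x_\ell$ with an arrow $x_k\to x_\ell$; (2) reverse all arrows at $x_k$; (3) remove all odd-even-odd 2-paths with opposite orientations, $\xi_i\to x_\ell\to\xi_j$ and $\xi_i\leftarrow x_\ell\leftarrow\xi_j$,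 created by rule (1). The mutation at $x_k$ is *allowed* if for every even vertex $x_\ell$ with an arrow $x_k\to x_\ell$ at least one of the following holds: (a) $I_k=I_\ell$; (b) $J_k=J_\ell$; (c) $I_k=J_k=\emptyset$; (d) $I_k=J_\ell$ and $J_k=I_\ell$; (e) $I_\ell=J_\ell=\emptyset$. **Compatible pairs.** $B=(b_{ij})$ is the $n\times l$ matrix $b_{ij}=\#\{x_i\to x_j\}-\#\{x_j\to x_i\}$. Let $\Lambda=(\lambda_{ij})$ be a skew-symmetric integer $(n+m)\times(n+m)$ matrix with blocks $\Lambda_{11},\Lambda_{12},\Lambda_{21},\Lambda_{22}$ of sizes $n\times n$, $n\times m$, $m\times n$, $m\times m$. $(\Lambda,\widetilde{\mathcal{Q}})$ is *compatible* if (A) $B^T(\Lambda_{11}\ \Lambda_{12})$ is a rectangular diagonal $l\times(n+m)$ matrix with positive integer diagonal entries $d_1,\dots,d_l$ (its $(j,i)$ entry is $\delta_{ij}d_j$); (B) if two odd vertices $x_p,x_r$ are connected through a 2-path in $\widetilde{\mathcal{Q}}_2$, then $\lambda_{i,p}=-\lambda_{i,r}$ for all $i\ne p,r$. **Quantum supertorus.** $L$ is a $\mathbb{Z}_2$-graded lattice with basis $e_1,\dots,e_{n+m}$, $e_i$ even for $i\le n$ and odd for $i>n$, with a skew-symmetric bilinear form $\Lambda:L\times L\to\mathbb{Z}$. $\mathcal{T}=\mathcal{T}(\Lambda)$ is the $\mathbb{Z}[q^{\pm1/2}]$-superalgebra with basis $\{X^e: e=\sum a_ie_i\in L,\ a_i\in\{0,1\}\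 \forall i>n\}$ and product $X^eX^f=(-1)^{\tau(e,f)}q^{\Lambda(e,f)/2}X^{e+f}$, where $X^{e+f}=0$ if $(e+f)_j\ge2$ for some $j>n$, and $\tau(e,f)=\#\{(j_1,j_2): j_1>j_2>n,\ e_{j_1}\ne0,\ f_{j_2}\ne0\}$. Let $\mathcal{T}_1$ be the span of the $X^e$ with $a_i=0$ for all $i>n$, $\mathcal{T}_2$ the span of the other basis elements, $S=\{t_1+t_2: t_i\in\mathcal{T}_i,\ t_1\ne0\}$, and $\mathcal{F}=S^{-1}\mathcal{T}$. **Supertoric frames.** A supertoric frame in $\mathcal{F}$ is a map $M:\mathbb{Z}^{n|m}\to\mathcal{F}\setminus\{0\}$, $c\mapsto\varphi(X^{\eta(c)})$, where $\varphi$ is an automorphism of the superalgebra $\mathcal{F}$ and $\eta:\mathbb{Z}^{n|m}\to L$ is an isomorphism of super-lattices. (As with $X^e$, $M(c)$ is considered for $c$ with odd coordinates in $\{0,1\}$.) $\Lambda_M$ is the bilinear form on $\mathbb{Z}^{n|m}$ (with standard basis $e_1,\dots,e_{n+m}$) transferred from $\Lambda$ by $\eta$, and the multiplication is $M(c)M(d)=(-1)^{\tau(c,d)}q^{\Lambda_M(c,d)/2}M(c+d)$, with $M(c+d)$ read as $0$ if some odd coordinate of $c+d$ is $\ge2$. A frame $M$ is uniquely determined by the elements $X_i=M(e_i)$, $1\le i\le n+m$. **Quantum super-seeds and mutation.** A quantum super-seed is a pair $(M,\widetilde{\mathcal{Q}})$ with $M$ a supertoric frame in $\mathcal{F}$,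 $\widetilde{\mathcal{Q}}$ an extended quiver with $n$ even and $m$ odd vertices, and $(\Lambda_M,\widetilde{\mathcal{Q}})$ compatible. If the mutation of $\widetilde{\mathcal{Q}}$ at $x_k$ is allowed, $\mu_k(M,\widetilde{\mathcal{Q}})=(M',\mu_k(\widetilde{\mathcal{Q}}))$, where $M'$ is the supertoric frame with $M'(e_i)=M(e_i)$ for $i\ne k$ and $$M'(e_k)=M\Big(-e_k+\sum_{b_{ik}>0}b_{ik}e_i\Big)+M\Big(-e_k-\sum_{b_{ik}<0}b_{ik}e_i\Big)+\sum_{x_p\to x_k\to x_r\in\widetilde{\mathcal{Q}}_2}(-1)^{\tau(e_p,e_r)}M\Big(-e_k+\sum_{b_{ik}>0}b_{ik}e_i+e_p+e_r\Big),$$ the last sum being over 2-paths through $x_k$ with $x_p,x_r$ odd. The result is again a quantum super-seed. **Notation.** $X_i=M(e_i)$. The cluster of $(M,\widetilde{\mathcal{Q}})$ is $\mathbf{X}=(X_1,\dots,X_l)$ (the non-frozen even variables); cluster variables are the elements of the clusters of the seeds obtained from the initial seed by sequences of allowed mutations. The ground ring is $\mathbb{ZP}=\mathbb{Z}[q^{\pm1/2},X_{l+1}^{\pm1},\dots,X_n^{\pm1},X_{n+1},\dots,X_{n+m}]\subset\mathcal{F}$, and $\mathbb{ZP}[\mathbf{X}^{\pm1}]$ is the subring of $\mathcal{F}$ generated by $\mathbb{ZP}$ and $X_1^{\pm1},\dots,X_l^{\pm1}$.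
   Formalization: 2-paths ξ_i→x_k→ξ_j are counted with multiplicity in mutation and in the exchange sum (with plain sets the claim fails), and each mutated pair must again be a quantum super-seed, its 2-path numbers being products of arrow numbers. *)

theory Defs
  imports "HOL-Algebra.Generated_Rings" "HOL-Library.Poly_Mapping"
begin

text \<open>
  Vertices are \<open>1, \<dots>, n + m\<close>; the even ones are \<open>1, \<dots>, n\<close>, the odd ones \<open>n + 1, \<dots>, n + m\<close>, and
  the mutable ones \<open>1, \<dots>, l\<close>. The sets \<open>I\<^sub>k\<close>, \<open>J\<^sub>k\<close> consist of vertex numbers \<open>n + i\<close>.
\<close>

definition odd_vertices :: "nat \<Rightarrow> nat \<Rightarrow> nat set"
  where "odd_vertices n m = {n + 1..n + m}"


section \<open>Extended quivers\<close>

text \<open>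
  \<open>arrows Q i j\<close> is the number of arrows \<open>x\<^sub>i \<rightarrow> x\<^sub>j\<close> between even vertices,
  \<open>odd_in Q k\<close> and \<open>odd_out Q k\<close> are the sets \<open>I\<^sub>k\<close> and \<open>J\<^sub>k\<close>, and \<open>two_paths Q k p r\<close> is the
  number of 2-paths \<open>x\<^sub>p \<rightarrow> x\<^sub>k \<rightarrow> x\<^sub>r\<close> with odd ends. As usual for quivers, arrows and 2-paths
  are counted with multiplicity: even if all multiplicities are initially one, adding 2-paths
  by a mutation can produce multiple ones, and they contribute repeatedly to the exchange relation.
\<close>

record ext_quiver =
  arrows :: "nat \<Rightarrow> nat \<Rightarrow> nat"
  odd_in :: "nat \<Rightarrow> nat set"
  odd_out :: "nat \<Rightarrow> nat set"
  two_paths :: "nat \<Rightarrow> nat \<Rightarrow> nat \<Rightarrow> nat"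

text \<open>
  The functions \<open>\<alpha>\<close> and \<open>\<beta>\<close> below give the numbers of arrows \<open>x\<^sub>p \<rightarrow> x\<^sub>k\<close> and \<open>x\<^sub>k \<rightarrow> x\<^sub>r\<close>; if all
  these arrows are simple, then \<open>two_paths Q k p r\<close> is \<open>1\<close> for \<open>p \<in> I\<^sub>k\<close>, \<open>r \<in> J\<^sub>k\<close> and \<open>0\<close> otherwise.
\<close>

definition extended_quiver :: "nat \<Rightarrow> nat \<Rightarrow> ext_quiver \<Rightarrow> bool"
  where "extended_quiver n m Q \<longleftrightarrow>
    (\<forall>i j. arrows Q i j > 0 \<longrightarrow> i \<in> {1..n} \<and> j \<in> {1..n}) \<and>
    (\<forall>i. arrows Q i i = 0) \<and>
    (\<forall>i j. arrows Q i j = 0 \<or> arrows Q j i = 0) \<and>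
    (\<forall>k\<in>{1..n}.
      odd_in Q k \<subseteq> odd_vertices n m \<and> odd_out Q k \<subseteq> odd_vertices n m \<and>
      odd_in Q k \<inter> odd_out Q k = {} \<and>
      (\<exists>\<alpha> \<beta>. (\<forall>p. \<alpha> p > 0 \<longleftrightarrow> p \<in> odd_in Q k) \<and> (\<forall>r. \<beta> r > 0 \<longleftrightarrow> r \<in> odd_out Q k) \<and>
        (\<forall>p r. two_paths Q k p r = \<alpha> p * \<beta> r)))"

definition exchange_entry :: "ext_quiver \<Rightarrow> nat \<Rightarrow> nat \<Rightarrow> int"
  where "exchange_entry Q i j = int (arrows Q i j) - int (arrows Q j i)"

definition mutation_allowed :: "nat \<Rightarrow> ext_quiver \<Rightarrow> nat \<Rightarrow> bool"
  where "mutation_allowed n Q k \<longleftrightarrow>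
    (\<forall>j\<in>{1..n}. arrows Q k j > 0 \<longrightarrow>
      odd_in Q k = odd_in Q j \<or>
      odd_out Q k = odd_out Q j \<or>
      (odd_in Q k = {} \<and> odd_out Q k = {}) \<or>
      (odd_in Q k = odd_out Q j \<and> odd_out Q k = odd_in Q j) \<or>
      (odd_in Q j = {} \<and> odd_out Q j = {}))"

text \<open>
  Quiver mutation at \<open>x\<^sub>k\<close>. In \<open>a\<close> an arrow \<open>x\<^sub>i \<rightarrow> x\<^sub>j\<close> has been added for every path
  \<open>x\<^sub>i \<rightarrow> x\<^sub>k \<rightarrow> x\<^sub>j\<close>; in \<open>p\<close> a 2-path \<open>x\<^sub>s \<rightarrow> x\<^sub>j \<rightarrow> x\<^sub>r\<close> has been added for every 2-path
  \<open>x\<^sub>s \<rightarrow> x\<^sub>k \<rightarrow> x\<^sub>r\<close> and every arrow \<open>x\<^sub>k \<rightarrow> x\<^sub>j\<close>. The truncated subtractions cancel arrows, resp.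
  2-paths, with opposite orientations. The sets \<open>I\<^sub>j\<close>, \<open>J\<^sub>j\<close> only change when 2-paths through \<open>x\<^sub>j\<close>
  have been added, and are then given by the ends of the 2-paths that remain.
\<close>

definition mutate_quiver :: "nat \<Rightarrow> ext_quiver \<Rightarrow> ext_quiver"
  where "mutate_quiver k Q =
    (let a = (\<lambda>i j. arrows Q i j + arrows Q i k * arrows Q k j);
         p = (\<lambda>j s r. two_paths Q j s r + arrows Q k j * two_paths Q k s r);
         p' = (\<lambda>j s r. p j s r - p j r s);
         added = (\<lambda>j. arrows Q k j > 0 \<and> odd_in Q k \<noteq> {} \<and> odd_out Q k \<noteq> {})
     in \<lparr>arrows = (\<lambda>i j. if i = k \<or> j = k then arrows Q j i else a i j - a j i),
         odd_in = (\<lambda>j. if j = k then odd_out Q k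
                       else if added j then {s. \<exists>r. p' j s r > 0} else odd_in Q j),
         odd_out = (\<lambda>j. if j = k then odd_in Q k
                        else if added j then {r. \<exists>s. p' j s r > 0} else odd_out Q j),
         two_paths = (\<lambda>j s r. if j = k then two_paths Q k r s else p' j s r)\<rparr>)"


section \<open>Compatible pairs\<close>

definition skew_symmetric :: "nat \<Rightarrow> (nat \<Rightarrow> nat \<Rightarrow> int) \<Rightarrow> bool"
  where "skew_symmetric N \<Lambda> \<longleftrightarrow> (\<forall>i\<in>{1..N}. \<forall>j\<in>{1..N}. \<Lambda> i j = - \<Lambda> j i)"

definition compatible_pair ::
    "nat \<Rightarrow> nat \<Rightarrow> nat \<Rightarrow> (nat \<Rightarrow> nat \<Rightarrow> int) \<Rightarrow> ext_quiver \<Rightarrow> bool"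
  where "compatible_pair n m l \<Lambda> Q \<longleftrightarrow>
    skew_symmetric (n + m) \<Lambda> \<and>
    (\<exists>d :: nat \<Rightarrow> int. (\<forall>j\<in>{1..l}. d j > 0) \<and>
      (\<forall>j\<in>{1..l}. \<forall>i\<in>{1..n + m}.
        (\<Sum>s\<in>{1..n}. exchange_entry Q s j * \<Lambda> s i) = (if i = j then d j else 0))) \<and>
    (\<forall>p\<in>odd_vertices n m. \<forall>r\<in>odd_vertices n m.
      (\<exists>k\<in>{1..n}. two_paths Q k p r > 0 \<or> two_paths Q k r p > 0) \<longrightarrow>
      (\<forall>i\<in>{1..n + m} - {p, r}. \<Lambda> i p = - \<Lambda> i r))"


section \<open>The quantum supertorus\<close>

abbreviation keys :: "('k \<Rightarrow>\<^sub>0 'c::zero) \<Rightarrow> 'k set"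
  where "keys \<equiv> Poly_Mapping.keys"

abbreviation lookup :: "('k \<Rightarrow>\<^sub>0 'c::zero) \<Rightarrow> 'k \<Rightarrow> 'c"
  where "lookup \<equiv> Poly_Mapping.lookup"

type_synonym zvec = "nat \<Rightarrow>\<^sub>0 int"

text \<open>Laurent polynomials in \<open>q\<^sup>1\<^sup>/\<^sup>2\<close>: the integer key \<open>a\<close> stands for the power \<open>q\<^sup>a\<^sup>/\<^sup>2\<close>.\<close>

type_synonym qlaurent = "int \<Rightarrow>\<^sub>0 int"

type_synonym torus_elem = "zvec \<Rightarrow>\<^sub>0 qlaurent"

definition superlattice :: "nat \<Rightarrow> nat \<Rightarrow> zvec set"
  where "superlattice n m = {c. keys c \<subseteq> {1..n + m}}"

definition even_sublattice :: "nat \<Rightarrow> nat \<Rightarrow> zvec set"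
  where "even_sublattice n m = {c. keys c \<subseteq> {1..n}}"

definition odd_sublattice :: "nat \<Rightarrow> nat \<Rightarrow> zvec set"
  where "odd_sublattice n m = {c. keys c \<subseteq> odd_vertices n m}"

abbreviation unit_vec :: "nat \<Rightarrow> zvec"
  where "unit_vec i \<equiv> Poly_Mapping.single i 1"

definition exponents :: "nat \<Rightarrow> nat \<Rightarrow> zvec set"
  where "exponents n m = {c \<in> superlattice n m. \<forall>j\<in>odd_vertices n m. lookup c j \<in> {0, 1}}"

definition bilin_form :: "nat \<Rightarrow> (nat \<Rightarrow> nat \<Rightarrow> int) \<Rightarrow> zvec \<Rightarrow> zvec \<Rightarrow> int"
  where "bilin_form N \<Lambda> c d =
    (\<Sum>i\<in>{1..N}. \<Sum>j\<in>{1..N}. lookup c i * \<Lambda> i j * lookup d j)"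

definition tau :: "nat \<Rightarrow> zvec \<Rightarrow> zvec \<Rightarrow> nat"
  where "tau n e f = card {(j1, j2). j1 > j2 \<and> j2 > n \<and> lookup e j1 \<noteq> 0 \<and> lookup f j2 \<noteq> 0}"

definition signed_qpower :: "nat \<Rightarrow> int \<Rightarrow> qlaurent"
  where "signed_qpower t a = Poly_Mapping.single a ((- 1) ^ t)"

definition scalar :: "qlaurent \<Rightarrow> torus_elem"
  where "scalar c = Poly_Mapping.single 0 c"

definition torus_basis :: "zvec \<Rightarrow> torus_elem"
  where "torus_basis e = Poly_Mapping.single e 1"

definition torus_mult ::
    "nat \<Rightarrow> nat \<Rightarrow> (nat \<Rightarrow> nat \<Rightarrow> int) \<Rightarrow> torus_elem \<Rightarrow> torus_elem \<Rightarrow> torus_elem"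
  where "torus_mult n m \<Lambda> x y =
    (\<Sum>e\<in>keys x. \<Sum>f\<in>keys y.
      if e + f \<in> exponents n m
      then Poly_Mapping.single (e + f)
        (lookup x e * lookup y f * signed_qpower (tau n e f) (bilin_form (n + m) \<Lambda> e f))
      else 0)"

definition supertorus :: "nat \<Rightarrow> nat \<Rightarrow> (nat \<Rightarrow> nat \<Rightarrow> int) \<Rightarrow> torus_elem ring"
  where "supertorus n m \<Lambda> =
    \<lparr>carrier = {x. keys x \<subseteq> exponents n m}, mult = torus_mult n m \<Lambda>, one = torus_basis 0,
     zero = 0, add = (+)\<rparr>"

definition torus_even :: "nat \<Rightarrow> nat \<Rightarrow> torus_elem set"
  where "torus_even n m =
    {x. keys x \<subseteq> {e \<in> exponents n m. even (\<Sum>j\<in>odd_vertices n m. lookup e j)}}"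

definition torus_odd :: "nat \<Rightarrow> nat \<Rightarrow> torus_elem set"
  where "torus_odd n m =
    {x. keys x \<subseteq> {e \<in> exponents n m. odd (\<Sum>j\<in>odd_vertices n m. lookup e j)}}"

definition torus_T1 :: "nat \<Rightarrow> nat \<Rightarrow> torus_elem set"
  where "torus_T1 n m =
    {x. keys x \<subseteq> {e \<in> exponents n m. \<forall>j\<in>odd_vertices n m. lookup e j = 0}}"

definition torus_T2 :: "nat \<Rightarrow> nat \<Rightarrow> torus_elem set"
  where "torus_T2 n m =
    {x. keys x \<subseteq> {e \<in> exponents n m. \<exists>j\<in>odd_vertices n m. lookup e j \<noteq> 0}}"

definition denominators :: "nat \<Rightarrow> nat \<Rightarrow> torus_elem set"
  where "denominators n m = {t1 + t2 | t1 t2. t1 \<in> torus_T1 n m \<and> t2 \<in> torus_T2 n m \<and> t1 \<noteq> 0}"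


section \<open>The skew superfield of fractions\<close>

text \<open>\<open>F\<close>, together with \<open>\<iota> : T \<rightarrow> F\<close>, is a left (Ore) ring of fractions \<open>S\<^sup>-\<^sup>1T\<close>. This determines
  the pair up to a unique isomorphism.\<close>

definition left_fraction_ring ::
    "('t, 'c) ring_scheme \<Rightarrow> 't set \<Rightarrow> ('a, 'b) ring_scheme \<Rightarrow> ('t \<Rightarrow> 'a) \<Rightarrow> bool"
  where "left_fraction_ring T S F \<iota> \<longleftrightarrow>
    ring F \<and> \<iota> \<in> ring_hom T F \<and>
    (\<forall>s\<in>S. \<iota> s \<in> Units F) \<and>
    (\<forall>x\<in>carrier F. \<exists>s\<in>S. \<exists>t\<in>carrier T. x = inv\<^bsub>F\<^esub> (\<iota> s) \<otimes>\<^bsub>F\<^esub> \<iota> t) \<and>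
    (\<forall>t\<in>carrier T. \<iota> t = \<zero>\<^bsub>F\<^esub> \<longleftrightarrow> (\<exists>s\<in>S. s \<otimes>\<^bsub>T\<^esub> t = \<zero>\<^bsub>T\<^esub>))"

text \<open>The grading of \<open>F\<close> induced from \<open>T\<close>. Homogeneous denominators suffice: the even component of
  an element of \<open>S\<close> is again in \<open>S\<close>, and the odd component is nilpotent.\<close>

definition frac_even ::
    "nat \<Rightarrow> nat \<Rightarrow> ('a, 'b) ring_scheme \<Rightarrow> (torus_elem \<Rightarrow> 'a) \<Rightarrow> 'a set"
  where "frac_even n m F \<iota> =
    {inv\<^bsub>F\<^esub> (\<iota> s) \<otimes>\<^bsub>F\<^esub> \<iota> t | s t. s \<in> denominators n m \<inter> torus_even n m \<and> t \<in> torus_even n m}"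

definition frac_odd ::
    "nat \<Rightarrow> nat \<Rightarrow> ('a, 'b) ring_scheme \<Rightarrow> (torus_elem \<Rightarrow> 'a) \<Rightarrow> 'a set"
  where "frac_odd n m F \<iota> =
    {inv\<^bsub>F\<^esub> (\<iota> s) \<otimes>\<^bsub>F\<^esub> \<iota> t | s t. s \<in> denominators n m \<inter> torus_even n m \<and> t \<in> torus_odd n m}"

text \<open>For a ring endomorphism, fixing the scalars is the same as being linear over them.\<close>

definition superalgebra_automorphism ::
    "nat \<Rightarrow> nat \<Rightarrow> ('a, 'b) ring_scheme \<Rightarrow> (torus_elem \<Rightarrow> 'a) \<Rightarrow> ('a \<Rightarrow> 'a) \<Rightarrow> bool"
  where "superalgebra_automorphism n m F \<iota> \<phi> \<longleftrightarrow>
    \<phi> \<in> ring_iso F F \<and>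
    (\<forall>c. \<phi> (\<iota> (scalar c)) = \<iota> (scalar c)) \<and>
    \<phi> ` frac_even n m F \<iota> \<subseteq> frac_even n m F \<iota> \<and>
    \<phi> ` frac_odd n m F \<iota> \<subseteq> frac_odd n m F \<iota>"


section \<open>Supertoric frames\<close>

definition superlattice_iso :: "nat \<Rightarrow> nat \<Rightarrow> (zvec \<Rightarrow> zvec) \<Rightarrow> bool"
  where "superlattice_iso n m \<eta> \<longleftrightarrow>
    bij_betw \<eta> (superlattice n m) (superlattice n m) \<and>
    (\<forall>c\<in>superlattice n m. \<forall>d\<in>superlattice n m. \<eta> (c + d) = \<eta> c + \<eta> d) \<and>
    \<eta> ` even_sublattice n m = even_sublattice n m \<and>
    \<eta> ` odd_sublattice n m = odd_sublattice n m"

definition transferred_form ::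
    "nat \<Rightarrow> nat \<Rightarrow> (nat \<Rightarrow> nat \<Rightarrow> int) \<Rightarrow> (zvec \<Rightarrow> zvec) \<Rightarrow> nat \<Rightarrow> nat \<Rightarrow> int"
  where "transferred_form n m \<Lambda> \<eta> i j = bilin_form (n + m) \<Lambda> (\<eta> (unit_vec i)) (\<eta> (unit_vec j))"

text \<open>
  \<open>M\<close> only matters on \<open>exponents n m\<close>. That \<open>\<eta>\<close> maps this set to itself makes \<open>X\<^bsup>\<eta>(c)\<^esup>\<close> meaningful.
  The multiplication rule, with the signs \<open>\<tau>(c, d)\<close> rather than \<open>\<tau>(\<eta>(c), \<eta>(d))\<close>, is part of the
  definition: it would fail if \<open>\<eta>\<close> permuted the odd basis vectors, and without it a frame would
  not be determined by the elements \<open>M(e\<^sub>i)\<close>.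
\<close>

definition supertoric_frame_via ::
    "nat \<Rightarrow> nat \<Rightarrow> (nat \<Rightarrow> nat \<Rightarrow> int) \<Rightarrow> ('a, 'b) ring_scheme \<Rightarrow> (torus_elem \<Rightarrow> 'a) \<Rightarrow>
     ('a \<Rightarrow> 'a) \<Rightarrow> (zvec \<Rightarrow> zvec) \<Rightarrow> (zvec \<Rightarrow> 'a) \<Rightarrow> bool"
  where "supertoric_frame_via n m \<Lambda> F \<iota> \<phi> \<eta> M \<longleftrightarrow>
    superalgebra_automorphism n m F \<iota> \<phi> \<and> superlattice_iso n m \<eta> \<and>
    (\<forall>c\<in>exponents n m. \<eta> c \<in> exponents n m \<and> M c = \<phi> (\<iota> (torus_basis (\<eta> c)))) \<and>
    (\<forall>c\<in>exponents n m. \<forall>d\<in>exponents n m.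
      M c \<otimes>\<^bsub>F\<^esub> M d =
        (if c + d \<in> exponents n m
         then \<iota> (scalar (signed_qpower (tau n c d)
                (bilin_form (n + m) (transferred_form n m \<Lambda> \<eta>) c d))) \<otimes>\<^bsub>F\<^esub> M (c + d)
         else \<zero>\<^bsub>F\<^esub>))"

definition supertoric_frame ::
    "nat \<Rightarrow> nat \<Rightarrow> (nat \<Rightarrow> nat \<Rightarrow> int) \<Rightarrow> ('a, 'b) ring_scheme \<Rightarrow> (torus_elem \<Rightarrow> 'a) \<Rightarrow>
     (zvec \<Rightarrow> 'a) \<Rightarrow> bool"
  where "supertoric_frame n m \<Lambda> F \<iota> M \<longleftrightarrow> (\<exists>\<phi> \<eta>. supertoric_frame_via n m \<Lambda> F \<iota> \<phi> \<eta> M)"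


section \<open>Quantum super-seeds and their mutations\<close>

text \<open>The form \<open>\<Lambda>\<^sub>M\<close> is \<open>transferred_form n m \<Lambda> \<eta>\<close>; by the multiplication rule it depends only
  on \<open>M\<close>, not on the choice of \<open>\<phi>\<close> and \<open>\<eta>\<close>.\<close>

definition quantum_super_seed ::
    "nat \<Rightarrow> nat \<Rightarrow> nat \<Rightarrow> (nat \<Rightarrow> nat \<Rightarrow> int) \<Rightarrow> ('a, 'b) ring_scheme \<Rightarrow> (torus_elem \<Rightarrow> 'a) \<Rightarrow>
     (zvec \<Rightarrow> 'a) \<Rightarrow> ext_quiver \<Rightarrow> bool"
  where "quantum_super_seed n m l \<Lambda> F \<iota> M Q \<longleftrightarrow>
    extended_quiver n m Q \<and>
    (\<exists>\<phi> \<eta>. supertoric_frame_via n m \<Lambda> F \<iota> \<phi> \<eta> M \<and>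
      compatible_pair n m l (transferred_form n m \<Lambda> \<eta>) Q)"

definition exchange_in :: "nat \<Rightarrow> ext_quiver \<Rightarrow> nat \<Rightarrow> zvec"
  where "exchange_in n Q k =
    - unit_vec k + (\<Sum>i\<in>{i \<in> {1..n}. exchange_entry Q i k > 0}.
      Poly_Mapping.single i (exchange_entry Q i k))"

definition exchange_out :: "nat \<Rightarrow> ext_quiver \<Rightarrow> nat \<Rightarrow> zvec"
  where "exchange_out n Q k =
    - unit_vec k - (\<Sum>i\<in>{i \<in> {1..n}. exchange_entry Q i k < 0}.
      Poly_Mapping.single i (exchange_entry Q i k))"

definition mutated_variable ::
    "nat \<Rightarrow> ('a, 'b) ring_scheme \<Rightarrow> nat \<Rightarrow> (zvec \<Rightarrow> 'a) \<Rightarrow> ext_quiver \<Rightarrow> 'a"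
  where "mutated_variable n F k M Q =
    M (exchange_in n Q k) \<oplus>\<^bsub>F\<^esub> M (exchange_out n Q k) \<oplus>\<^bsub>F\<^esub>
    finsum F
      (\<lambda>(p, r).
        add_pow F ((- 1) ^ tau n (unit_vec p) (unit_vec r) * int (two_paths Q k p r))
          (M (exchange_in n Q k + unit_vec p + unit_vec r)))
      (odd_in Q k \<times> odd_out Q k)"

definition seed_mutation ::
    "nat \<Rightarrow> nat \<Rightarrow> nat \<Rightarrow> (nat \<Rightarrow> nat \<Rightarrow> int) \<Rightarrow> ('a, 'b) ring_scheme \<Rightarrow> (torus_elem \<Rightarrow> 'a) \<Rightarrow>
     nat \<Rightarrow> (zvec \<Rightarrow> 'a) \<times> ext_quiver \<Rightarrow> (zvec \<Rightarrow> 'a) \<times> ext_quiver \<Rightarrow> bool"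
  where "seed_mutation n m l \<Lambda> F \<iota> k = (\<lambda>(M, Q) (M', Q').
    quantum_super_seed n m l \<Lambda> F \<iota> M Q \<and> mutation_allowed n Q k \<and>
    Q' = mutate_quiver k Q \<and> supertoric_frame n m \<Lambda> F \<iota> M' \<and>
    (\<forall>i\<in>{1..n + m} - {k}. M' (unit_vec i) = M (unit_vec i)) \<and>
    M' (unit_vec k) = mutated_variable n F k M Q)"

definition cluster :: "nat \<Rightarrow> (zvec \<Rightarrow> 'a) \<Rightarrow> 'a set"
  where "cluster l M = {M (unit_vec i) | i. i \<in> {1..l}}"

definition cluster_variables ::
    "nat \<Rightarrow> nat \<Rightarrow> nat \<Rightarrow> (nat \<Rightarrow> nat \<Rightarrow> int) \<Rightarrow> ('a, 'b) ring_scheme \<Rightarrow> (torus_elem \<Rightarrow> 'a) \<Rightarrow>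
     (zvec \<Rightarrow> 'a) \<Rightarrow> ext_quiver \<Rightarrow> 'a set"
  where "cluster_variables n m l \<Lambda> F \<iota> M Q =
    {Y. \<exists>M' Q'. (\<lambda>s s'. \<exists>k\<in>{1..l}. seed_mutation n m l \<Lambda> F \<iota> k s s')\<^sup>*\<^sup>* (M, Q) (M', Q') \<and>
      Y \<in> cluster l M'}"


section \<open>The ground ring and the ring of Laurent polynomials\<close>

definition ground_ring ::
    "nat \<Rightarrow> nat \<Rightarrow> nat \<Rightarrow> ('a, 'b) ring_scheme \<Rightarrow> (torus_elem \<Rightarrow> 'a) \<Rightarrow> (zvec \<Rightarrow> 'a) \<Rightarrow> 'a set"
  where "ground_ring n m l F \<iota> M = generate_ring F
    ({\<iota> (scalar (Poly_Mapping.single a 1)) | a. a \<in> {1, - 1}} \<union>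
     {M (unit_vec i) | i. i \<in> {l + 1..n + m}} \<union>
     {inv\<^bsub>F\<^esub> (M (unit_vec i)) | i. i \<in> {l + 1..n}})"

definition laurent_ring ::
    "nat \<Rightarrow> nat \<Rightarrow> nat \<Rightarrow> ('a, 'b) ring_scheme \<Rightarrow> (torus_elem \<Rightarrow> 'a) \<Rightarrow> (zvec \<Rightarrow> 'a) \<Rightarrow> 'a set"
  where "laurent_ring n m l F \<iota> M = generate_ring F
    (ground_ring n m l F \<iota> M \<union> cluster l M \<union> {inv\<^bsub>F\<^esub> x | x. x \<in> cluster l M})"

end

theory Submission
  imports Defs
begin

text \<open>
  The proof follows the upper cluster algebra argument for the Laurent phenomenon. Three features
  of the super case make it work.

  First, the odd part of an exchange relation is harmless. If the odd vertices \<open>p\<close> and \<open>r\<close> are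
  joined by a 2-path, condition (B) makes \<open>\<theta>\<^sub>p\<^sub>r = q\<^sup>-\<^sup>\<lambda>\<^sup>/\<^sup>2 X\<^sub>p X\<^sub>r\<close>, with \<open>\<lambda> = \<Lambda>\<^sub>p\<^sub>r\<close>, commute with all
  variables. Let \<open>N\<^sub>k\<close> be the sum of the \<open>\<theta>\<^sub>p\<^sub>r\<close> over the 2-paths through \<open>x\<^sub>k\<close>. Then \<open>N\<^sub>k\<close> is central and
  \<open>N\<^sub>k\<^sup>2 = 0\<close> (\<open>quadratic_square\<close>), and the exchange relation reads
  \<open>X\<^sub>k' = M(c) (1 + N\<^sub>k) + M(c')\<close>, with \<open>c\<close> and \<open>c'\<close> the two exchange exponents (\<open>mutated_eq\<close>).
  This is an ordinary quantum exchange relation whose coefficient \<open>1 + N\<^sub>k\<close> is a central unit. Since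
  \<open>\<theta>\<^sub>p\<^sub>r = - \<theta>\<^sub>r\<^sub>p\<close>, the cancellation of opposite 2-paths is invisible in \<open>N\<^sub>j\<close>, and a mutation at \<open>k\<close> just
  replaces \<open>N\<^sub>j\<close> by \<open>N\<^sub>j + b N\<^sub>k\<close>, where \<open>b\<close> is the number of arrows \<open>x\<^sub>k \<rightarrow> x\<^sub>j\<close>. These elements all
  have square zero, hence \<open>N\<^sub>j N\<^sub>k = 0\<close> if \<open>b > 0\<close>, and \<open>1 + N\<^sub>j\<close> mutates to \<open>(1 + N\<^sub>j) (1 + N\<^sub>k)\<^sup>b\<close> as a coefficient should
  (\<open>nu'_other\<close>).

  Second, let \<open>L\<close> be the ring of Laurent polynomials of a seed, and \<open>A\<^sub>j \<subseteq> L\<close> the subring in which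
  \<open>X\<^sub>j\<^sup>-\<^sup>1\<close> is replaced by \<open>X\<^sub>j'\<close>. The upper bound of the seed is the intersection of \<open>L\<close> and all \<open>A\<^sub>j\<close>
  with \<open>j\<close> mutable. It contains the cluster and the neighbouring clusters, so it suffices
  that the upper bound of the seed mutated at \<open>k\<close> lies in the upper bound of the original one
  (\<open>upper_bound_mutation\<close>). For \<open>j = k\<close> the two rings \<open>A\<^sub>k\<close> are compared directly: mutating twice returns
  \<open>X\<^sub>k\<close> up to the factor \<open>1 - N\<^sub>k\<close>. For \<open>j \<noteq> k\<close> a rank-two computation (\<open>mutated'_upper\<close>) puts the new
  neighbour of \<open>X\<^sub>j\<close> into \<open>A\<^sub>j\<close>, so that every element \<open>f\<close> of the new \<open>A\<^sub>j\<close> satisfies \<open>f X\<^sub>k'\<^sup>r \<in> A\<^sub>j\<close> for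
  some \<open>r\<close>.

  Third, the factor \<open>X\<^sub>k'\<close> can be cancelled: \<open>f \<in> L\<close> and \<open>f X\<^sub>k' \<in> A\<^sub>j\<close> imply \<open>f \<in> A\<^sub>j\<close> (\<open>cancel_mutated\<close>).
  Conjugation by \<open>X\<^sub>k\<close> multiplies each monomial by a power of \<open>q\<close> and so grades \<open>L\<close>. By compatibility it
  gives the two terms of \<open>X\<^sub>j'\<close> the same degree, so that \<open>A\<^sub>j\<close> is graded, and the two terms of \<open>X\<^sub>k'\<close> different
  degrees. One of the latter does not involve \<open>X\<^sub>j\<close> and is a unit of \<open>A\<^sub>j\<close>; after dividing by it,
  \<open>f (1 - e) \<in> A\<^sub>j\<close> with \<open>e \<in> A\<^sub>j\<close> of nonzero degree. Hence \<open>f (1 - e\<^sup>r) \<in> A\<^sub>j\<close> for every \<open>r\<close>, and for large \<open>r\<close>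
  the components of \<open>f\<close> are components of this element (\<open>graded_cancel\<close>). This treats adjacent and
  non-adjacent directions uniformly and replaces the usual coprimality of exchange polynomials.
\<close>

section \<open>Rings graded by powers of the parameter q\<close>

inductive_set add_span :: "('a, 'b) ring_scheme \<Rightarrow> 'a set \<Rightarrow> 'a set"
  for R and H where
    zero: "\<zero>\<^bsub>R\<^esub> \<in> add_span R H"
  | incl: "h \<in> H \<Longrightarrow> h \<in> add_span R H"
  | neg: "h \<in> add_span R H \<Longrightarrow> \<ominus>\<^bsub>R\<^esub> h \<in> add_span R H"
  | plus: "h1 \<in> add_span R H \<Longrightarrow> h2 \<in> add_span R H \<Longrightarrow> h1 \<oplus>\<^bsub>R\<^esub> h2 \<in> add_span R H"

lemma (in ring) add_span_carrier:
  assumes "H \<subseteq> carrier R" "h \<in> add_span R H" shows "h \<in> carrier R"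
  using assms(2) by induction (use assms(1) in auto)

text \<open>
  Multiplicative closure passes from \<open>H\<close> to its additive span. This reduces statements about a
  generated ring to products of generators, which is where homogeneity arguments apply.
\<close>

lemma (in ring) add_span_mult:
  assumes H: "H \<subseteq> carrier R" and cl: "\<And>a b. a \<in> H \<Longrightarrow> b \<in> H \<Longrightarrow> a \<otimes> b \<in> H"
    and x: "x \<in> add_span R H" and y: "y \<in> add_span R H"
  shows "x \<otimes> y \<in> add_span R H"
  using x
proof induction
  case zero
  then show ?case using add_span_carrier[OF H y] by (simp add: add_span.zero)
next
  case (incl h)
  note h = incl
  then have hc: "h \<in> carrier R" using H by auto
  show ?case using y
  proof induction
    case zero then show ?case using hc by (simp add: add_span.zero)
  next
    case (incl h') then show ?case using cl h by (auto intro: add_span.incl)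
  next
    case (neg h') then show ?case using hc add_span_carrier[OF H neg.hyps]
      by (simp add: r_minus add_span.neg)
  next
    case (plus h1 h2) then show ?case
      using hc add_span_carrier[OF H plus.hyps(1)] add_span_carrier[OF H plus.hyps(2)]
      by (simp add: r_distr add_span.plus)
  qed
next
  case (neg h)
  then show ?case using add_span_carrier[OF H y] add_span_carrier[OF H neg.hyps]
    by (simp add: l_minus add_span.neg)
next
  case (plus h1 h2)
  then show ?case
    using add_span_carrier[OF H y] add_span_carrier[OF H plus.hyps(1)]
      add_span_carrier[OF H plus.hyps(2)]
    by (simp add: l_distr add_span.plus)
qed

lemma (in ring) generate_ring_add_span:
  assumes H: "H \<subseteq> carrier R" and cl: "\<And>a b. a \<in> H \<Longrightarrow> b \<in> H \<Longrightarrow> a \<otimes> b \<in> H"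
    and one: "\<one> \<in> H" and G: "G \<subseteq> H" and f: "f \<in> generate_ring R G"
  shows "f \<in> add_span R H"
  using f
  by induction (use G one in \<open>auto intro: add_span.intros add_span_mult[OF H cl]\<close>)

lemma (in ring) subring_finsum:
  assumes A: "subring A R" and g: "\<And>d. d \<in> E \<Longrightarrow> g d \<in> A"
  shows "finsum R g E \<in> A"
proof (cases "finite E")
  case True
  then show ?thesis using g
  proof (induction E rule: finite_induct)
    case (insert d E)
    then have "g d \<in> carrier R" "g \<in> E \<rightarrow> carrier R" using subringE(1)[OF A] by auto
    then show ?case using insert by (simp add: subringE(7)[OF A])
  qed (simp add: subringE(2)[OF A])
qed (simp add: subringE(2)[OF A] finsum_infinite)

text \<open>
  A ring with central elements \<open>qp a\<close>, standing for \<open>q\<^sup>a\<^sup>/\<^sup>2\<close>, that behave like powers of an element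
  transcendental over the integers, in so far as differences of distinct powers and positive integers
  are regular.
\<close>

locale q_ring = ring R for R :: "('a, 'b) ring_scheme" (structure) +
  fixes qp :: "int \<Rightarrow> 'a"
  assumes qp_closed [simp]: "qp a \<in> carrier R"
    and qp_0 [simp]: "qp 0 = \<one>"
    and qp_add: "qp (a + b) = qp a \<otimes> qp b"
    and qp_central: "x \<in> carrier R \<Longrightarrow> qp a \<otimes> x = x \<otimes> qp a"
    and qp_regular: "x \<in> carrier R \<Longrightarrow> qp a \<otimes> x = qp b \<otimes> x \<Longrightarrow> a \<noteq> b \<Longrightarrow> x = \<zero>"
    and torsion_free: "x \<in> carrier R \<Longrightarrow> k > 0 \<Longrightarrow> add_pow R (k::nat) x = \<zero> \<Longrightarrow> x = \<zero>"
begin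

lemma qp_swap: "x \<in> carrier R \<Longrightarrow> y \<in> carrier R \<Longrightarrow> x \<otimes> (qp a \<otimes> y) = qp a \<otimes> (x \<otimes> y)"
  using qp_central[of x a] by (simp flip: m_assoc)

lemma qp_qp: "x \<in> carrier R \<Longrightarrow> qp a \<otimes> (qp b \<otimes> x) = qp (a + b) \<otimes> x"
  by (simp add: qp_add m_assoc)

lemma qp_inverse: "qp a \<otimes> qp (- a) = \<one>"
  using qp_add[of a "- a"] by simp

lemma qp_move: "x \<in> carrier R \<Longrightarrow> y \<in> carrier R \<Longrightarrow> x = qp a \<otimes> y \<Longrightarrow> y = qp (- a) \<otimes> x"
  by (simp add: qp_qp)

text \<open>
  Being an eigenvector, with eigenvalue \<open>q\<^sup>d\<^sup>/\<^sup>2\<close>, of conjugation by \<open>x\<close>. It is stated without the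
  inverse of \<open>x\<close>, so that it is meaningful for every \<open>x\<close>.
\<close>

definition comm_deg :: "'a \<Rightarrow> int \<Rightarrow> 'a \<Rightarrow> bool"
  where "comm_deg x d f \<longleftrightarrow> f \<in> carrier R \<and> x \<otimes> f = qp d \<otimes> (f \<otimes> x)"

lemma comm_deg_carrier: "comm_deg x d f \<Longrightarrow> f \<in> carrier R"
  by (simp add: comm_deg_def)

lemma comm_deg_zero: "x \<in> carrier R \<Longrightarrow> comm_deg x d \<zero>"
  by (simp add: comm_deg_def)

lemma comm_deg_qp: "x \<in> carrier R \<Longrightarrow> comm_deg x 0 (qp a)"
  using qp_central[of x a] by (simp add: comm_deg_def)

lemma comm_deg_one: "x \<in> carrier R \<Longrightarrow> comm_deg x 0 \<one>"
  by (simp add: comm_deg_def)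

lemma comm_deg_mult:
  assumes x: "x \<in> carrier R" and "comm_deg x a f" "comm_deg x b g"
  shows "comm_deg x (a + b) (f \<otimes> g)"
proof -
  have c: "f \<in> carrier R" "g \<in> carrier R" using assms by (auto simp: comm_deg_def)
  have "x \<otimes> (f \<otimes> g) = (x \<otimes> f) \<otimes> g" using c x by (simp add: m_assoc)
  also have "\<dots> = qp a \<otimes> (f \<otimes> (x \<otimes> g))" using assms c by (simp add: comm_deg_def m_assoc)
  also have "\<dots> = qp a \<otimes> (f \<otimes> (qp b \<otimes> (g \<otimes> x)))" using assms by (simp add: comm_deg_def)
  also have "\<dots> = qp (a + b) \<otimes> ((f \<otimes> g) \<otimes> x)"
    using c x by (simp add: qp_swap[of f "g \<otimes> x"] qp_qp m_assoc)
  finally show ?thesis using c by (simp add: comm_deg_def)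
qed

lemma comm_deg_add:
  assumes x: "x \<in> carrier R" and "comm_deg x a f" "comm_deg x a g"
  shows "comm_deg x a (f \<oplus> g)"
  using assms by (auto simp: comm_deg_def r_distr l_distr)

lemma comm_deg_neg:
  assumes x: "x \<in> carrier R" and "comm_deg x a f"
  shows "comm_deg x a (\<ominus> f)"
  using assms by (auto simp: comm_deg_def r_minus l_minus)

lemma comm_deg_pow:
  assumes x: "x \<in> carrier R" and f: "comm_deg x a f"
  shows "comm_deg x (int N * a) (f [^] N)"
proof (induction N)
  case 0 then show ?case using x by (simp add: comm_deg_one)
next
  case (Suc N) then show ?case using comm_deg_mult[OF x Suc f] by (simp add: algebra_simps)
qed

lemma Units_right_cancel:
  assumes "x \<in> Units R" "a \<in> carrier R" "b \<in> carrier R" "a \<otimes> x = b \<otimes> x" shows "a = b"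
  using assms by (metis Units_closed Units_inv_closed Units_r_inv m_assoc r_one)

text \<open>
  Eigenvectors for distinct eigenvalues are independent: subtract \<open>q\<^sup>e\<^sup>/\<^sup>2\<close> times a vanishing sum from
  its conjugate. This kills the component of degree \<open>e\<close> and multiplies the others by the regular
  elements \<open>q\<^sup>d\<^sup>/\<^sup>2 - q\<^sup>e\<^sup>/\<^sup>2\<close>.
\<close>

lemma comm_deg_finsum_zero:
  assumes x: "x \<in> Units R" and "finite D"
    and "\<And>d. d \<in> D \<Longrightarrow> comm_deg x d (g d)" and "finsum R g D = \<zero>"
  shows "\<forall>d\<in>D. g d = \<zero>"
  using assms(2-)
proof (induction D arbitrary: g rule: finite_induct)
  case (insert e D)
  have xc: "x \<in> carrier R" using x by auto
  have gc: "g \<in> insert e D \<rightarrow> carrier R" using insert.prems(1) by (auto simp: comm_deg_def)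
  then have ge: "g e \<in> carrier R" and gD: "g \<in> D \<rightarrow> carrier R" by auto
  let ?S = "finsum R g D"
  have Sc: "?S \<in> carrier R" using gD by simp
  have S: "g e \<oplus> ?S = \<zero>" using insert.prems(2) insert.hyps gD ge by simp
  then have Se: "?S = \<ominus> g e" using ge Sc by (metis minus_equality a_comm)
  let ?h = "\<lambda>d. qp d \<otimes> g d \<ominus> qp e \<otimes> g d"
  have hc: "?h \<in> D \<rightarrow> carrier R" using gD by (auto simp: Pi_def)
  have "x \<otimes> ?S = (\<Oplus>d\<in>D. x \<otimes> g d)" using xc gD insert.hyps by (simp add: finsum_rdistr)
  also have "\<dots> = (\<Oplus>d\<in>D. qp d \<otimes> g d \<otimes> x)"
  proof (intro finsum_cong' refl)
    show "(\<lambda>d. qp d \<otimes> g d \<otimes> x) \<in> D \<rightarrow> carrier R" using gD xc by (auto simp: Pi_def)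
    fix d assume "d \<in> D" then show "x \<otimes> g d = qp d \<otimes> g d \<otimes> x"
      using insert.prems(1)[of d] xc by (simp add: comm_deg_def m_assoc)
  qed
  also have "\<dots> = (\<Oplus>d\<in>D. qp d \<otimes> g d) \<otimes> x"
    using xc gD insert.hyps by (subst finsum_ldistr) (auto simp: Pi_def)
  finally have 1: "x \<otimes> ?S = (\<Oplus>d\<in>D. qp d \<otimes> g d) \<otimes> x" .
  have "x \<otimes> ?S = \<ominus> (qp e \<otimes> g e \<otimes> x)"
    using Se insert.prems(1)[of e] xc ge by (simp add: comm_deg_def m_assoc r_minus)
  also have "\<dots> = qp e \<otimes> ?S \<otimes> x" using Se xc ge by (simp add: l_minus r_minus)
  finally have eq: "(\<Oplus>d\<in>D. qp d \<otimes> g d) \<otimes> x = (qp e \<otimes> ?S) \<otimes> x" using 1 by simp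
  have qgc: "(\<Oplus>d\<in>D. qp d \<otimes> g d) \<in> carrier R"
    using gD by (intro finsum_closed) (auto simp: Pi_def)
  have 2: "(\<Oplus>d\<in>D. qp d \<otimes> g d) = qp e \<otimes> ?S"
    by (rule Units_right_cancel[OF x qgc _ eq]) (simp add: Sc)
  have "finsum R ?h D = (\<Oplus>d\<in>D. qp d \<otimes> g d) \<oplus> (\<Oplus>d\<in>D. (\<ominus> qp e) \<otimes> g d)"
    using gD unfolding minus_eq
    by (subst finsum_addf[symmetric]) (auto simp: Pi_def l_minus intro!: finsum_cong')
  also have "(\<Oplus>d\<in>D. (\<ominus> qp e) \<otimes> g d) = (\<ominus> qp e) \<otimes> ?S"
    using gD insert.hyps by (simp add: finsum_rdistr)
  finally have "finsum R ?h D = \<zero>" using 2 Sc by (simp add: l_minus r_neg)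
  moreover have "comm_deg x d (?h d)" if "d \<in> D" for d
  proof -
    have g: "comm_deg x d (g d)" using insert.prems(1) that by auto
    show ?thesis unfolding minus_eq
      using comm_deg_mult[OF xc comm_deg_qp[OF xc] g]
      by (auto intro!: comm_deg_add comm_deg_neg xc)
  qed
  ultimately have "\<forall>d\<in>D. ?h d = \<zero>" using insert.IH[of ?h] by blast
  then have g0: "g d = \<zero>" if "d \<in> D" for d
    using that gD insert.hyps(2) qp_regular[of "g d" d e] by (auto simp: Pi_def)
  then have "?S = \<zero>" by (intro add.finprod_one_eqI) auto
  then have "g e = \<zero>" using S ge by simp
  then show ?case using g0 by auto
qed simp

text \<open>
  The homogeneous components of \<open>f\<close> are required to lie in \<open>A\<close> itself; a subring \<open>A\<close> is graded if
  this holds for all its elements.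
\<close>

definition graded_in :: "'a \<Rightarrow> 'a set \<Rightarrow> 'a \<Rightarrow> bool"
  where "graded_in x A f \<longleftrightarrow> (\<exists>g D. finite D \<and> (\<forall>d. comm_deg x d (g d) \<and> g d \<in> A) \<and>
    (\<forall>d. d \<notin> D \<longrightarrow> g d = \<zero>) \<and> f = finsum R g D)"

lemma finsum_enlarge:
  assumes "finite E" "D \<subseteq> E" "\<And>d. g d \<in> carrier R" "\<And>d. d \<notin> D \<Longrightarrow> g d = \<zero>"
  shows "finsum R g E = finsum R g D"
  using assms by (intro add.finprod_mono_neutral_cong_right) auto

lemma add_span_graded:
  assumes A: "subring A R" and x: "x \<in> carrier R"
    and f: "f \<in> add_span R {h \<in> A. \<exists>d. comm_deg x d h}"
  shows "graded_in x A f"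
  using f
proof induction
  case zero
  show ?case unfolding graded_in_def
    by (rule exI[of _ "\<lambda>_. \<zero>"], rule exI[of _ "{}"])
      (use A x in \<open>auto simp: comm_deg_zero subringE\<close>)
next
  case (incl h)
  then obtain d where d: "h \<in> A" "comm_deg x d h" by auto
  then have "finsum R (\<lambda>e. if e = d then h else \<zero>) {d} = h"
    using comm_deg_carrier by simp
  then show ?case unfolding graded_in_def using d A x
    by (intro exI[of _ "\<lambda>e. if e = d then h else \<zero>"] exI[of _ "{d}"])
      (auto simp: comm_deg_zero subringE)
next
  case (neg h)
  then obtain g D where g: "finite D" "\<And>d. comm_deg x d (g d)" "\<And>d. g d \<in> A"
    "\<And>d. d \<notin> D \<Longrightarrow> g d = \<zero>" "h = finsum R g D" unfolding graded_in_def by blast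
  have gc: "g d \<in> carrier R" for d using g(2) comm_deg_carrier by blast
  have "\<ominus> h = (\<ominus> \<one>) \<otimes> h" using g(5) gc by (simp add: l_minus)
  also have "\<dots> = (\<Oplus>d\<in>D. (\<ominus> \<one>) \<otimes> g d)" using g gc by (simp add: finsum_rdistr)
  also have "\<dots> = (\<Oplus>d\<in>D. \<ominus> g d)" using gc by (intro finsum_cong') (auto simp: l_minus)
  finally show ?case unfolding graded_in_def using g A x
    by (intro exI[of _ "\<lambda>d. \<ominus> g d"] exI[of _ D]) (auto simp: comm_deg_neg subringE)
next
  case (plus h1 h2)
  then obtain g1 D1 where g1: "finite D1" "\<And>d. comm_deg x d (g1 d)" "\<And>d. g1 d \<in> A"
    "\<And>d. d \<notin> D1 \<Longrightarrow> g1 d = \<zero>" "h1 = finsum R g1 D1" unfolding graded_in_def by blast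
  from plus obtain g2 D2 where g2: "finite D2" "\<And>d. comm_deg x d (g2 d)" "\<And>d. g2 d \<in> A"
    "\<And>d. d \<notin> D2 \<Longrightarrow> g2 d = \<zero>" "h2 = finsum R g2 D2" unfolding graded_in_def by blast
  have gc: "g1 d \<in> carrier R" "g2 d \<in> carrier R" for d
    using g1(2) g2(2) comm_deg_carrier by blast+
  have "h1 \<oplus> h2 = finsum R g1 (D1 \<union> D2) \<oplus> finsum R g2 (D1 \<union> D2)"
    using finsum_enlarge[of "D1 \<union> D2" D1 g1] finsum_enlarge[of "D1 \<union> D2" D2 g2] g1 g2 gc by auto
  also have "\<dots> = (\<Oplus>d\<in>D1 \<union> D2. g1 d \<oplus> g2 d)" using gc by (intro finsum_addf[symmetric]) auto
  finally show ?case unfolding graded_in_def using g1 g2 A x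
    by (intro exI[of _ "\<lambda>d. g1 d \<oplus> g2 d"] exI[of _ "D1 \<union> D2"]) (auto simp: comm_deg_add subringE)
qed

text \<open>
  Homogeneous generators generate a graded ring, because products of generators are homogeneous.
\<close>

lemma generate_ring_graded:
  assumes x: "x \<in> carrier R" and G: "G \<subseteq> carrier R" and A: "A = generate_ring R G"
    and hom: "\<And>h. h \<in> G \<Longrightarrow> \<exists>d. comm_deg x d h" and f: "f \<in> A"
  shows "graded_in x A f"
proof (rule add_span_graded)
  show "subring A R" using A G generate_ring_is_subring by auto
  then have A': "\<one> \<in> A" "A \<subseteq> carrier R" "\<And>a b. a \<in> A \<Longrightarrow> b \<in> A \<Longrightarrow> a \<otimes> b \<in> A"
    by (auto dest: subringE)
  show "f \<in> add_span R {h \<in> A. \<exists>d. comm_deg x d h}"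
    by (rule generate_ring_add_span[where G = G])
      (use A A' f hom in \<open>auto intro: generate_ring.incl comm_deg_one[OF x] comm_deg_mult[OF x]\<close>)
qed (use x in auto)

text \<open>
  From \<open>f (1 - e\<^sup>N\<^sup>+\<^sup>1) = f (1 - e\<^sup>N) + f (1 - e) e\<^sup>N\<close>.
\<close>

lemma telescope_power:
  assumes A: "subring A R" and f: "f \<in> carrier R" and e: "e \<in> A" and fe: "f \<ominus> f \<otimes> e \<in> A"
  shows "f \<ominus> f \<otimes> e [^] (N::nat) \<in> A"
proof -
  have ec: "e \<in> carrier R" using A e subringE(1) by blast
  have eN: "e [^] N \<in> A" for N :: nat using A e by (induction N) (auto simp: subringE)
  show ?thesis
  proof (induction N)
    case 0 then show ?case using f A by (simp add: minus_eq r_neg subringE)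
  next
    case (Suc N)
    have "f \<otimes> e \<otimes> e [^] N = f \<otimes> e [^] Suc N"
      using f ec nat_pow_Suc2[of e N] by (simp add: m_assoc)
    then have "(f \<ominus> f \<otimes> e) \<otimes> e [^] N = f \<otimes> e [^] N \<ominus> f \<otimes> e [^] Suc N"
      using f ec by (simp add: minus_eq l_distr l_minus)
    then have "f \<ominus> f \<otimes> e [^] Suc N = (f \<ominus> f \<otimes> e [^] N) \<oplus> (f \<ominus> f \<otimes> e) \<otimes> e [^] N"
      using f ec by (simp add: minus_eq a_assoc r_neg1 del: nat_pow_Suc)
    then show ?case using Suc fe eN A by (simp add: subringE)
  qed
qed

text \<open>
  In effect, the factor \<open>1 - e\<close> can be cancelled modulo the graded ring \<open>A\<close> although it is not
  invertible there. The element \<open>f - f e\<^sup>N\<close> lies in \<open>A\<close>, hence so do its homogeneous components. If \<open>N\<close>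
  is large, the degrees occurring in \<open>f e\<^sup>N\<close> are so far from those of \<open>f\<close> that the
  components of \<open>f\<close> are among them.
\<close>

lemma graded_cancel:
  assumes A: "subring A R" and x: "x \<in> Units R"
    and gA: "\<And>a. a \<in> A \<Longrightarrow> graded_in x A a"
    and f: "graded_in x (carrier R) f"
    and e: "e \<in> A" "comm_deg x \<delta> e" "\<delta> \<noteq> 0" and fe: "f \<ominus> f \<otimes> e \<in> A"
  shows "f \<in> A"
proof -
  have xc: "x \<in> carrier R" using x by auto
  have ec: "e \<in> carrier R" using e(2) comm_deg_carrier by auto
  obtain g D where g: "finite D" "\<And>d. comm_deg x d (g d)"
    "\<And>d. d \<notin> D \<Longrightarrow> g d = \<zero>" "f = finsum R g D" using f unfolding graded_in_def by blast
  have gc: "g d \<in> carrier R" for d using g(2) comm_deg_carrier by blast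
  have fc: "f \<in> carrier R" using g(4) gc by auto
  obtain B where B: "\<And>d. d \<in> D \<Longrightarrow> \<bar>d\<bar> \<le> B" "B \<ge> 0"
  proof
    show "\<bar>d\<bar> \<le> (\<Sum>d\<in>D. \<bar>d\<bar>)" if "d \<in> D" for d using that g(1) by (intro member_le_sum) auto
  qed (simp add: sum_nonneg)
  \<comment> \<open>two degrees of \<open>f\<close> differ by at most \<open>2 * B\<close>, less than the shift \<open>s\<close> caused by \<open>e [^] N\<close>\<close>
  define N where "N = nat (2 * B + 1)"
  define s where "s = int N * \<delta>"
  have "\<bar>s\<bar> \<ge> 2 * B + 1"
  proof -
    have "\<bar>s\<bar> = int N * \<bar>\<delta>\<bar>" by (simp add: s_def abs_mult)
    also have "\<dots> \<ge> int N * 1" using e(3) by (intro mult_left_mono) auto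
    finally show ?thesis using B(2) by (simp add: N_def)
  qed
  then have disj: "d - s \<notin> D" if "d \<in> D" for d using B(1)[of d] B(1)[of "d - s"] that by fastforce
  let ?e = "e [^] N"
  have eN: "comm_deg x s ?e" unfolding s_def by (rule comm_deg_pow[OF xc e(2)])
  have eNc: "?e \<in> carrier R" using ec by auto
  obtain h D' where h: "finite D'" "\<And>d. comm_deg x d (h d)" "\<And>d. h d \<in> A"
    "\<And>d. d \<notin> D' \<Longrightarrow> h d = \<zero>" "f \<ominus> f \<otimes> ?e = finsum R h D'"
    using gA[OF telescope_power[OF A fc e(1) fe, of N]] unfolding graded_in_def by blast
  have hc: "h d \<in> carrier R" for d using h(2) comm_deg_carrier by blast
  define T where "T = (\<lambda>d. d + s) ` D"
  define U where "U = D \<union> T \<union> D'"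
  have U: "finite U" "D \<subseteq> U" "T \<subseteq> U" "D' \<subseteq> U" using g(1) h(1) by (auto simp: U_def T_def)
  let ?g = "\<lambda>d. g (d - s) \<otimes> ?e"
  have sg: "comm_deg x d (?g d)" for d
    using comm_deg_mult[OF xc g(2)[of "d - s"] eN] by simp
  have "f \<otimes> ?e = (\<Oplus>d\<in>D. g d \<otimes> ?e)" using g gc eNc by (simp add: finsum_ldistr)
  also have "\<dots> = (\<Oplus>d\<in>D. ?g (d + s))" by simp
  also have "\<dots> = finsum R ?g T" unfolding T_def using gc eNc
    by (intro finsum_reindex[symmetric]) (auto simp: inj_on_def)
  also have "\<dots> = finsum R ?g U"
  proof (rule finsum_enlarge[symmetric, OF U(1) U(3)])
    show "?g d = \<zero>" if "d \<notin> T" for d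
    proof -
      have "d - s \<notin> D" using that unfolding T_def by force
      then show ?thesis using g(3) eNc by simp
    qed
  qed (use gc eNc in auto)
  finally have feU: "f \<otimes> ?e = finsum R ?g U" .
  have fU: "f = finsum R g U" using finsum_enlarge[OF U(1,2)] g gc by auto
  have hU: "f \<ominus> f \<otimes> ?e = finsum R h U" using finsum_enlarge[OF U(1,4)] h hc by auto
  let ?k = "\<lambda>d. g d \<oplus> (\<ominus> \<one>) \<otimes> ?g d \<oplus> (\<ominus> \<one>) \<otimes> h d"
  have "finsum R ?k U = finsum R g U \<oplus> (\<ominus> \<one>) \<otimes> finsum R ?g U \<oplus> (\<ominus> \<one>) \<otimes> finsum R h U"
    using U(1) gc hc eNc by (simp add: finsum_addf finsum_rdistr Pi_def)
  also have "\<dots> = \<zero>" using hU[symmetric] feU[symmetric] fU[symmetric] fc eNc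
    by (simp add: l_minus minus_eq r_neg)
  finally have "finsum R ?k U = \<zero>" .
  moreover have "comm_deg x d (?k d)" for d
    using g(2) sg h(2) by (auto intro!: comm_deg_add xc comm_deg_neg simp: l_minus gc eNc hc)
  ultimately have k0: "?k d = \<zero>" if "d \<in> U" for d
    using comm_deg_finsum_zero[of x U ?k] x U(1) that by blast
  have "g d \<in> A" for d
  proof (cases "d \<in> D")
    case True
    then have "g d \<oplus> \<ominus> h d = \<zero>" using k0[of d] U(2) g(3)[OF disj] gc hc eNc
      by (auto simp: l_minus)
    then have "g d = h d" using gc hc by (metis minus_equality minus_minus add.inv_closed)
    then show ?thesis using h(3) by simp
  qed (use g(3) A in \<open>auto simp: subringE\<close>)
  then show ?thesis unfolding g(4) by (rule subring_finsum[OF A])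
qed

end

section \<open>Quantum tori\<close>

lemma lookup_outside: "keys c \<subseteq> S \<Longrightarrow> j \<notin> S \<Longrightarrow> lookup c j = 0"
  using not_in_keys_iff_lookup_eq_zero by fast

lemma even_sublattice_lookup: "c \<in> even_sublattice n m \<Longrightarrow> j > n \<Longrightarrow> lookup c j = 0"
  unfolding even_sublattice_def by (rule lookup_outside[of c "{1..n}"]) auto

lemma even_sublatticeI: "(\<And>j. j = 0 \<or> j > n \<Longrightarrow> lookup c j = 0) \<Longrightarrow> c \<in> even_sublattice n m"
proof -
  assume h: "\<And>j. j = 0 \<or> j > n \<Longrightarrow> lookup c j = 0"
  have "j \<in> {1..n}" if "j \<in> keys c" for j
    using that h[of j] by (cases "j = 0 \<or> j > n") auto
  then show ?thesis unfolding even_sublattice_def by blast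
qed

lemma even_sublattice_lookup_0: "c \<in> even_sublattice n m \<Longrightarrow> lookup c 0 = 0"
  unfolding even_sublattice_def by (rule lookup_outside[of c "{1..n}"]) auto

lemma even_sublattice_closed [simp]:
  "0 \<in> even_sublattice n m"
  "c \<in> even_sublattice n m \<Longrightarrow> d \<in> even_sublattice n m \<Longrightarrow> c + d \<in> even_sublattice n m"
  "c \<in> even_sublattice n m \<Longrightarrow> d \<in> even_sublattice n m \<Longrightarrow> c - d \<in> even_sublattice n m"
  "c \<in> even_sublattice n m \<Longrightarrow> - c \<in> even_sublattice n m"
  "i \<in> {1..n} \<Longrightarrow> Poly_Mapping.single i a \<in> even_sublattice n m"
  by (auto intro!: even_sublatticeI simp: lookup_add lookup_minus lookup_single when_def
      even_sublattice_lookup even_sublattice_lookup_0)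

lemma lookup_of_nat_mult: "lookup (of_nat b * c :: zvec) i = int b * lookup c i"
  by (induction b) (auto simp: lookup_add algebra_simps)

lemma even_sublattice_of_nat [simp]:
  "c \<in> even_sublattice n m \<Longrightarrow> of_nat b * c \<in> even_sublattice n m"
  by (auto intro!: even_sublatticeI simp: lookup_of_nat_mult
      even_sublattice_lookup even_sublattice_lookup_0)

lemma even_add_exponents:
  assumes c: "c \<in> even_sublattice n m" and d: "d \<in> exponents n m"
  shows "c + d \<in> exponents n m" "d + c \<in> exponents n m"
proof -
  have "keys (c + d) \<subseteq> keys c \<union> keys d" by (rule keys_add)
  moreover have "lookup (c + d) j \<in> {0, 1}" if "j \<in> odd_vertices n m" for j
    using that d even_sublattice_lookup[OF c, of j]
    by (simp add: lookup_add exponents_def odd_vertices_def)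
  ultimately show "c + d \<in> exponents n m" using c d
    unfolding exponents_def superlattice_def even_sublattice_def by fastforce
  then show "d + c \<in> exponents n m" by (simp add: add.commute)
qed

lemma exponents_lookup_outside: "c \<in> exponents n m \<Longrightarrow> j = 0 \<or> j > n + m \<Longrightarrow> lookup c j = 0"
  unfolding exponents_def superlattice_def by (rule lookup_outside[of c "{1..n + m}"]) auto

lemma exponents_lookup_odd: "c \<in> exponents n m \<Longrightarrow> j \<in> odd_vertices n m \<Longrightarrow> lookup c j \<in> {0, 1}"
  unfolding exponents_def by auto

lemma exponentsI:
  "(\<And>j. j = 0 \<or> j > n + m \<Longrightarrow> lookup c j = 0) \<Longrightarrow>
    (\<And>j. n < j \<Longrightarrow> j \<le> n + m \<Longrightarrow> lookup c j \<in> {0, 1}) \<Longrightarrow> c \<in> exponents n m"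
proof -
  assume h: "\<And>j. j = 0 \<or> j > n + m \<Longrightarrow> lookup c j = 0"
    and h': "\<And>j. n < j \<Longrightarrow> j \<le> n + m \<Longrightarrow> lookup c j \<in> {0, 1}"
  have "j \<in> {1..n + m}" if "j \<in> keys c" for j
    using that h[of j] by (cases "j = 0 \<or> j > n + m") auto
  then show ?thesis using h' unfolding exponents_def superlattice_def odd_vertices_def by auto
qed

lemma even_sublattice_exponents: "c \<in> even_sublattice n m \<Longrightarrow> c \<in> exponents n m"
  by (rule exponentsI) (auto simp: even_sublattice_lookup even_sublattice_lookup_0)

lemma unit_vec_exponents [simp]: "i \<in> {1..n + m} \<Longrightarrow> unit_vec i \<in> exponents n m"
  by (rule exponentsI) (auto simp: lookup_single when_def)

lemma zero_exponents [simp]: "0 \<in> exponents n m"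
  by (rule exponentsI) auto

lemma tau_even_left: "c \<in> even_sublattice n m \<Longrightarrow> tau n c d = 0"
proof -
  assume "c \<in> even_sublattice n m"
  then have "{(j1, j2). j2 < j1 \<and> n < j2 \<and> lookup c j1 \<noteq> 0 \<and> lookup d j2 \<noteq> 0} = {}"
    using even_sublattice_lookup[of c n m] by force
  then show ?thesis by (simp only: tau_def card.empty)
qed

lemma tau_even_right: "d \<in> even_sublattice n m \<Longrightarrow> tau n c d = 0"
proof -
  assume "d \<in> even_sublattice n m"
  then have "{(j1, j2). j2 < j1 \<and> n < j2 \<and> lookup c j1 \<noteq> 0 \<and> lookup d j2 \<noteq> 0} = {}"
    using even_sublattice_lookup[of d n m] by force
  then show ?thesis by (simp only: tau_def card.empty)
qed

lemma tau_unit_vec: "p > n \<Longrightarrow> r > n \<Longrightarrow> tau n (unit_vec p) (unit_vec r) = (if r < p then 1 else 0)"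
proof -
  assume "p > n" "r > n"
  then have "{(j1, j2). j2 < j1 \<and> n < j2 \<and> lookup (unit_vec p) j1 \<noteq> 0 \<and> lookup (unit_vec r) j2 \<noteq> 0}
    = (if r < p then {(p, r)} else {})"
    by (auto simp: lookup_single when_def split: if_splits)
  then show ?thesis by (simp only: tau_def) simp
qed

lemma bilin_form_add_left: "bilin_form N \<Lambda> (c + c') d = bilin_form N \<Lambda> c d + bilin_form N \<Lambda> c' d"
  by (simp add: bilin_form_def lookup_add algebra_simps sum.distrib)

lemma bilin_form_add_right: "bilin_form N \<Lambda> c (d + d') = bilin_form N \<Lambda> c d + bilin_form N \<Lambda> c d'"
  by (simp add: bilin_form_def lookup_add algebra_simps sum.distrib)

lemma bilin_form_zero [simp]: "bilin_form N \<Lambda> 0 d = 0" "bilin_form N \<Lambda> c 0 = 0"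
  by (simp_all add: bilin_form_def)

lemma bilin_form_minus_left: "bilin_form N \<Lambda> (- c) d = - bilin_form N \<Lambda> c d"
  by (simp add: bilin_form_def sum_negf)

lemma bilin_form_minus_right: "bilin_form N \<Lambda> c (- d) = - bilin_form N \<Lambda> c d"
  by (simp add: bilin_form_def sum_negf)

lemma bilin_form_diff_left: "bilin_form N \<Lambda> (c - c') d = bilin_form N \<Lambda> c d - bilin_form N \<Lambda> c' d"
  using bilin_form_add_left[of N \<Lambda> c "- c'" d] by (simp add: bilin_form_minus_left)

lemma bilin_form_diff_right: "bilin_form N \<Lambda> c (d - d') = bilin_form N \<Lambda> c d - bilin_form N \<Lambda> c d'"
  using bilin_form_add_right[of N \<Lambda> c d "- d'"] by (simp add: bilin_form_minus_right)

lemma bilin_form_of_nat_left: "bilin_form N \<Lambda> (of_nat b * c) d = int b * bilin_form N \<Lambda> c d"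
  by (simp add: bilin_form_def lookup_of_nat_mult sum_distrib_left mult.assoc)

lemma bilin_form_of_nat_right: "bilin_form N \<Lambda> c (of_nat b * d) = int b * bilin_form N \<Lambda> c d"
  unfolding bilin_form_def lookup_of_nat_mult by (simp add: sum_distrib_left mult_ac)

lemmas bilin_form_linear = bilin_form_add_left bilin_form_add_right bilin_form_minus_left
  bilin_form_minus_right bilin_form_diff_left bilin_form_diff_right bilin_form_of_nat_left
  bilin_form_of_nat_right

lemma bilin_form_skew:
  assumes "skew_symmetric N \<Lambda>" shows "bilin_form N \<Lambda> d c = - bilin_form N \<Lambda> c d"
proof -
  have "bilin_form N \<Lambda> d c = (\<Sum>j\<in>{1..N}. \<Sum>i\<in>{1..N}. lookup d i * \<Lambda> i j * lookup c j)"
    unfolding bilin_form_def by (rule sum.swap)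
  also have "\<dots> = (\<Sum>j\<in>{1..N}. \<Sum>i\<in>{1..N}. - (lookup c j * \<Lambda> j i * lookup d i))"
  proof (intro sum.cong refl)
    fix i j assume "i \<in> {1..N}" "j \<in> {1..N}"
    then have "\<Lambda> i j = - \<Lambda> j i" using assms unfolding skew_symmetric_def by blast
    then show "lookup d i * \<Lambda> i j * lookup c j = - (lookup c j * \<Lambda> j i * lookup d i)" by simp
  qed
  also have "\<dots> = - bilin_form N \<Lambda> c d" by (simp add: bilin_form_def sum_negf)
  finally show ?thesis .
qed

lemma bilin_form_self: "skew_symmetric N \<Lambda> \<Longrightarrow> bilin_form N \<Lambda> c c = 0"
  using bilin_form_skew[of N \<Lambda> c c] by simp

lemma bilin_form_single_right:
  assumes "i \<in> {1..N}"
  shows "bilin_form N \<Lambda> c (Poly_Mapping.single i a) = (\<Sum>s\<in>{1..N}. lookup c s * \<Lambda> s i) * a"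
proof -
  have "(\<Sum>j\<in>{1..N}. lookup c s * \<Lambda> s j * lookup (Poly_Mapping.single i a) j) =
      lookup c s * \<Lambda> s i * a" for s
    using assms by (subst sum.remove[of _ i]) (auto simp: lookup_single when_def)
  then show ?thesis by (simp add: bilin_form_def sum_distrib_right)
qed

lemma bilin_form_unit_vec:
  assumes "i \<in> {1..N}" "j \<in> {1..N}"
  shows "bilin_form N \<Lambda> (unit_vec i) (unit_vec j) = \<Lambda> i j"
proof -
  have "(\<Sum>s\<in>{1..N}. lookup (unit_vec i) s * \<Lambda> s j) = \<Lambda> i j"
    using assms(1) by (subst sum.remove[of _ i]) (auto simp: lookup_single when_def)
  then show ?thesis using bilin_form_single_right[OF assms(2), of \<Lambda> "unit_vec i" 1] by simp
qed

lemma keys_scalar: "keys (scalar c) = (if c = 0 then {} else {0})"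
  by (simp add: scalar_def)

lemma scalar_in_T1: "scalar c \<in> torus_T1 n m"
  unfolding torus_T1_def by (auto simp: keys_scalar split: if_splits)

lemma scalar_denominators:
  assumes "c \<noteq> 0" shows "scalar c \<in> denominators n m"
proof -
  have "scalar c \<noteq> 0" using keys_scalar[of c] assms by auto
  moreover have "0 \<in> torus_T2 n m" by (simp add: torus_T2_def)
  moreover have "scalar c = scalar c + 0" by simp
  ultimately show ?thesis unfolding denominators_def using scalar_in_T1 by blast
qed

lemma torus_mult_scalar_left:
  assumes t: "keys t \<subseteq> exponents n m"
  shows "torus_mult n m \<Lambda> (scalar c) t = (\<Sum>f\<in>keys t. Poly_Mapping.single f (c * lookup t f))"
proof (cases "c = 0")
  case False
  have g: "signed_qpower (tau n 0 f) 0 = 1" for f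
    using tau_even_left[OF even_sublattice_closed(1), of n] by (simp add: signed_qpower_def)
  have "lookup (scalar c) 0 = c" by (simp add: scalar_def)
  then show ?thesis using False t unfolding torus_mult_def keys_scalar
    by (auto simp: g subset_iff intro!: sum.cong)
qed (simp add: torus_mult_def scalar_def)

lemma torus_mult_scalar_right:
  assumes t: "keys t \<subseteq> exponents n m"
  shows "torus_mult n m \<Lambda> t (scalar c) = (\<Sum>f\<in>keys t. Poly_Mapping.single f (c * lookup t f))"
proof (cases "c = 0")
  case False
  have g: "signed_qpower (tau n f 0) 0 = 1" for f
    using tau_even_right[OF even_sublattice_closed(1), of n] by (simp add: signed_qpower_def)
  have "lookup (scalar c) 0 = c" by (simp add: scalar_def)
  then show ?thesis using False t unfolding torus_mult_def keys_scalar
    by (auto simp: g subset_iff mult.commute intro!: sum.cong)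
qed (simp add: torus_mult_def scalar_def)

lemma torus_mult_scalar_scalar: "torus_mult n m \<Lambda> (scalar c) (scalar d) = scalar (c * d)"
  by (subst torus_mult_scalar_left) (auto simp: keys_scalar scalar_def)

lemma keys_torus_basis: "keys (torus_basis e) = {e}"
  unfolding torus_basis_def keys_single by simp

text \<open>
  Multiplication by \<open>X\<^sup>e\<close> on the right shifts exponents injectively, and a term of \<open>s\<close> with purely even
  exponent, which exists for a denominator, is never sent to zero. So no basis element is annihilated by
  a denominator, and all of them survive in the ring of fractions.
\<close>

lemma torus_mult_denominator_basis:
  assumes s: "s \<in> denominators n m" and e: "e \<in> exponents n m"
  shows "torus_mult n m \<Lambda> s (torus_basis e) \<noteq> 0"
proof -
  obtain t1 t2 where t: "s = t1 + t2" "t1 \<in> torus_T1 n m" "t2 \<in> torus_T2 n m" "t1 \<noteq> 0"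
    using s unfolding denominators_def by blast
  then obtain e0 where e0: "e0 \<in> keys t1" by (metis all_not_in_conv keys_eq_empty)
  have e0e: "e0 \<in> exponents n m" "\<And>j. j \<in> odd_vertices n m \<Longrightarrow> lookup e0 j = 0"
    using e0 t(2) unfolding torus_T1_def by auto
  then have "e0 \<notin> keys t2" using t(3) unfolding torus_T2_def by auto
  then have l0: "lookup s e0 \<noteq> 0" 
    using e0 t(1) not_in_keys_iff_lookup_eq_zero[of e0 t2] in_keys_iff[of e0 t1]
    by (metis lookup_add add.right_neutral)
  have ev: "e0 \<in> even_sublattice n m"
  proof (rule even_sublatticeI)
    fix j assume "j = 0 \<or> j > n"
    then have "j = 0 \<or> j > n + m \<or> j \<in> odd_vertices n m" by (auto simp: odd_vertices_def)
    then show "lookup e0 j = 0" using e0e exponents_lookup_outside[OF e0e(1), of j] by blast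
  qed
  let ?g = "\<lambda>f. signed_qpower (tau n f e) (bilin_form (n + m) \<Lambda> f e)"
  have eq: "torus_mult n m \<Lambda> s (torus_basis e) = (\<Sum>f\<in>keys s. if f + e \<in> exponents n m
      then Poly_Mapping.single (f + e) (lookup s f * ?g f) else 0)"
    unfolding torus_mult_def keys_torus_basis by (intro sum.cong refl) (simp add: torus_basis_def)
  have "lookup (torus_mult n m \<Lambda> s (torus_basis e)) (e0 + e) =
      (\<Sum>f\<in>keys s. if f = e0 then lookup s e0 * ?g e0 else 0)"
    unfolding eq lookup_sum
  proof (intro sum.cong refl)
    fix f
    show "lookup (if f + e \<in> exponents n m then Poly_Mapping.single (f + e) (lookup s f * ?g f)
        else 0) (e0 + e) = (if f = e0 then lookup s e0 * ?g e0 else 0)"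
      using even_add_exponents(1)[OF ev e] by (cases "f = e0") (simp_all add: lookup_single_not_eq)
  qed
  also have "\<dots> = lookup s e0 * ?g e0"
  proof -
    have "e0 \<in> keys s" using l0 in_keys_iff by fast
    then show ?thesis by simp
  qed
  also have "\<dots> \<noteq> 0"
  proof -
    have "lookup (signed_qpower t a) a \<noteq> 0" for t a
      unfolding signed_qpower_def lookup_single_eq by simp
    then have "?g e0 \<noteq> 0" by (metis lookup_zero)
    then show ?thesis using l0 by simp
  qed
  finally show ?thesis by auto
qed

section \<open>Scalars in the ring of fractions\<close>

locale fraction_superring =
  fixes n m :: nat and \<Lambda> :: "nat \<Rightarrow> nat \<Rightarrow> int" and F :: "('a, 'b) ring_scheme" (structure)
    and \<iota> :: "torus_elem \<Rightarrow> 'a"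
  assumes fractions: "left_fraction_ring (supertorus n m \<Lambda>) (denominators n m) F \<iota>"

sublocale fraction_superring \<subseteq> ring F
  using fractions unfolding left_fraction_ring_def by auto

context fraction_superring
begin

definition qpow :: "int \<Rightarrow> 'a" where "qpow a = \<iota> (scalar (Poly_Mapping.single a 1))"

lemma iota_hom: "\<iota> \<in> ring_hom (supertorus n m \<Lambda>) F"
  using fractions unfolding left_fraction_ring_def by auto

lemma iota_closed: "keys t \<subseteq> exponents n m \<Longrightarrow> \<iota> t \<in> carrier F"
  using ring_hom_closed[OF iota_hom, of t] by (simp add: supertorus_def)

lemma iota_mult: "keys s \<subseteq> exponents n m \<Longrightarrow> keys t \<subseteq> exponents n m \<Longrightarrow>
    \<iota> (torus_mult n m \<Lambda> s t) = \<iota> s \<otimes> \<iota> t"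
  using ring_hom_mult[OF iota_hom, of s t] by (simp add: supertorus_def)

lemma iota_add: "keys s \<subseteq> exponents n m \<Longrightarrow> keys t \<subseteq> exponents n m \<Longrightarrow> \<iota> (s + t) = \<iota> s \<oplus> \<iota> t"
  using ring_hom_add[OF iota_hom, of s t] by (simp add: supertorus_def)

lemma iota_one: "\<iota> (torus_basis 0) = \<one>"
  using ring_hom_one[OF iota_hom] by (simp add: supertorus_def)

lemma keys_scalar_exponents: "keys (scalar c) \<subseteq> exponents n m"
  by (simp add: keys_scalar)

lemma iota_scalar_closed [simp]: "\<iota> (scalar c) \<in> carrier F"
  by (rule iota_closed[OF keys_scalar_exponents])

lemma iota_scalar_mult: "\<iota> (scalar (c * d)) = \<iota> (scalar c) \<otimes> \<iota> (scalar d)"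
  using iota_mult[OF keys_scalar_exponents keys_scalar_exponents]
  by (simp add: torus_mult_scalar_scalar)

lemma iota_scalar_add: "\<iota> (scalar (c + d)) = \<iota> (scalar c) \<oplus> \<iota> (scalar d)"
  using iota_add[OF keys_scalar_exponents keys_scalar_exponents, of c d]
  by (simp add: scalar_def single_add)

lemma iota_scalar_one: "\<iota> (scalar 1) = \<one>"
  using iota_one by (simp add: torus_basis_def scalar_def)

lemma iota_scalar_zero: "\<iota> (scalar 0) = \<zero>"
  using iota_scalar_add[of 0 0] by (simp add: add.l_cancel_one)

lemma iota_scalar_neg: "\<iota> (scalar (- c)) = \<ominus> \<iota> (scalar c)"
  using iota_scalar_add[of "- c" c] by (simp add: iota_scalar_zero minus_equality)

text \<open>
  Nonzero scalars are denominators, so they become invertible. This is why integers and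
  differences of powers of \<open>q\<close> are regular in the ring of fractions.
\<close>

lemma iota_scalar_unit: "c \<noteq> 0 \<Longrightarrow> \<iota> (scalar c) \<in> Units F"
  using fractions scalar_denominators unfolding left_fraction_ring_def by auto

lemma denominators_keys: "s \<in> denominators n m \<Longrightarrow> keys s \<subseteq> exponents n m"
proof -
  assume "s \<in> denominators n m"
  then obtain t1 t2 where "s = t1 + t2" "t1 \<in> torus_T1 n m" "t2 \<in> torus_T2 n m"
    unfolding denominators_def by blast
  then show ?thesis using keys_add[of t1 t2] unfolding torus_T1_def torus_T2_def by blast
qed

lemma iota_scalar_central_torus:
  "keys t \<subseteq> exponents n m \<Longrightarrow> \<iota> (scalar c) \<otimes> \<iota> t = \<iota> t \<otimes> \<iota> (scalar c)"
  using iota_mult[OF keys_scalar_exponents, of t c] iota_mult[OF _ keys_scalar_exponents, of t c]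
  by (simp add: torus_mult_scalar_left torus_mult_scalar_right)

lemma commute_inverse:
  assumes "s \<in> Units F" "c \<in> carrier F" "c \<otimes> s = s \<otimes> c" shows "c \<otimes> inv s = inv s \<otimes> c"
proof -
  have s: "s \<in> carrier F" "inv s \<in> carrier F" using assms(1) by auto
  have "inv s \<otimes> (c \<otimes> s) \<otimes> inv s = inv s \<otimes> (s \<otimes> c) \<otimes> inv s" using assms(3) by simp
  then have "(inv s \<otimes> c) \<otimes> (s \<otimes> inv s) = (inv s \<otimes> s) \<otimes> (c \<otimes> inv s)"
    using s assms(2) by (simp only: m_assoc m_closed)
  then show ?thesis using s assms by simp
qed

lemma iota_scalar_central:
  assumes "x \<in> carrier F" shows "\<iota> (scalar c) \<otimes> x = x \<otimes> \<iota> (scalar c)"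
proof -
  obtain s t where st: "s \<in> denominators n m" "keys t \<subseteq> exponents n m" "x = inv (\<iota> s) \<otimes> \<iota> t"
    using fractions assms unfolding left_fraction_ring_def supertorus_def by force
  have u: "\<iota> s \<in> Units F" using st(1) fractions unfolding left_fraction_ring_def by auto
  have tc: "\<iota> t \<in> carrier F" using st(2) by (rule iota_closed)
  have s: "\<iota> (scalar c) \<otimes> inv (\<iota> s) = inv (\<iota> s) \<otimes> \<iota> (scalar c)"
    by (rule commute_inverse[OF u]) (auto simp: iota_scalar_central_torus denominators_keys st(1))
  have "\<iota> (scalar c) \<otimes> x = inv (\<iota> s) \<otimes> (\<iota> (scalar c) \<otimes> \<iota> t)"
    using s u tc by (simp add: st(3) flip: m_assoc)
  also have "\<dots> = x \<otimes> \<iota> (scalar c)" using u tc by (simp add: st(2,3) iota_scalar_central_torus m_assoc)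
  finally show ?thesis .
qed

lemma unit_regular: "u \<in> Units F \<Longrightarrow> x \<in> carrier F \<Longrightarrow> u \<otimes> x = \<zero> \<Longrightarrow> x = \<zero>"
proof -
  assume u: "u \<in> Units F" and x: "x \<in> carrier F" and ux: "u \<otimes> x = \<zero>"
  have "inv u \<otimes> (u \<otimes> x) = x" using m_assoc[of "inv u" u x] u x Units_closed[OF u] by simp
  then show "x = \<zero>" using u by (simp add: ux)
qed

lemma iota_basis_nonzero:
  assumes "e \<in> exponents n m" shows "\<iota> (torus_basis e) \<noteq> \<zero>"
proof
  assume "\<iota> (torus_basis e) = \<zero>"
  moreover have "torus_basis e \<in> carrier (supertorus n m \<Lambda>)"
    using assms by (simp add: supertorus_def torus_basis_def)
  ultimately obtain s where "s \<in> denominators n m" "torus_mult n m \<Lambda> s (torus_basis e) = 0"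
    using fractions unfolding left_fraction_ring_def supertorus_def by auto
  then show False using torus_mult_denominator_basis[OF _ assms] by blast
qed

lemma iota_scalar_of_nat: "x \<in> carrier F \<Longrightarrow> \<iota> (scalar (of_nat k)) \<otimes> x = add_pow F k x"
proof (induction k)
  case 0 then show ?case by (simp add: iota_scalar_zero)
next
  case (Suc k)
  have "\<iota> (scalar (of_nat (Suc k))) = \<iota> (scalar (of_nat k)) \<oplus> \<one>"
    using iota_scalar_add[of "of_nat k" 1] by (simp add: iota_scalar_one add.commute)
  then show ?case using Suc by (simp add: l_distr)
qed

end

sublocale fraction_superring \<subseteq> q_ring F qpow
proof
  show "qpow a \<in> carrier F" for a by (simp add: qpow_def)
  show "qpow 0 = \<one>" by (simp add: qpow_def iota_scalar_one)
  show "qpow (a + b) = qpow a \<otimes> qpow b" for a b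
    unfolding qpow_def by (subst iota_scalar_mult[symmetric]) (simp add: mult_single)
  show "qpow a \<otimes> x = x \<otimes> qpow a" if "x \<in> carrier F" for a x
    unfolding qpow_def by (rule iota_scalar_central[OF that])
  show "x = \<zero>" if "x \<in> carrier F" "qpow a \<otimes> x = qpow b \<otimes> x" "a \<noteq> b" for x a b
  proof -
    let ?p = "Poly_Mapping.single a 1 + - Poly_Mapping.single b 1 :: qlaurent"
    have "lookup ?p a = 1" using that(3) by (simp add: lookup_minus lookup_single when_def)
    then have "?p \<noteq> 0" by (metis lookup_zero zero_neq_one)
    then have "\<iota> (scalar ?p) \<in> Units F" by (rule iota_scalar_unit)
    then have "qpow a \<oplus> \<ominus> qpow b \<in> Units F" unfolding qpow_def iota_scalar_add iota_scalar_neg .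
    moreover have "(qpow a \<oplus> \<ominus> qpow b) \<otimes> x = \<zero>"
      using that(1,2) by (simp add: l_distr l_minus r_neg qpow_def)
    ultimately show ?thesis using that(1) unit_regular by blast
  qed
  show "x = \<zero>" if "x \<in> carrier F" "k > 0" "add_pow F (k::nat) x = \<zero>" for x k
  proof -
    have "\<iota> (scalar (of_nat k)) \<in> Units F" using that(2) by (intro iota_scalar_unit) simp
    then show ?thesis using unit_regular[OF _ that(1)] that by (simp add: iota_scalar_of_nat)
  qed
qed

section \<open>Supertoric frames\<close>

definition (in q_ring) qsign :: "nat \<Rightarrow> int \<Rightarrow> 'a"
  where "qsign t a = (if even t then qp a else \<ominus> qp a)"

lemma (in q_ring) qsign_closed [simp]: "qsign t a \<in> carrier R"
  by (simp add: qsign_def)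

lemma (in q_ring) qsign_inverse: "qsign t (- a) \<otimes> qsign t a = \<one>"
  using qp_inverse[of "- a"] by (simp add: qsign_def l_minus r_minus)

lemma (in fraction_superring) iota_signed_qpower:
  "\<iota> (scalar (signed_qpower t a)) = qsign t a"
  by (simp add: qsign_def signed_qpower_def qpow_def single_uminus iota_scalar_neg)

text \<open>
  What calculations in a supertoric frame rely on, stated without reference to the automorphism and the
  lattice isomorphism behind it.
\<close>

locale super_frame = q_ring R qp for R :: "('a, 'b) ring_scheme" (structure) and qp +
  fixes n m :: nat and \<Lambda> :: "nat \<Rightarrow> nat \<Rightarrow> int" and M :: "zvec \<Rightarrow> 'a"
  assumes M_closed [simp]: "c \<in> exponents n m \<Longrightarrow> M c \<in> carrier R"
    and M_zero: "M 0 = \<one>"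
    and M_nonzero: "c \<in> exponents n m \<Longrightarrow> M c \<noteq> \<zero>"
    and M_mult: "c \<in> exponents n m \<Longrightarrow> d \<in> exponents n m \<Longrightarrow> c + d \<in> exponents n m \<Longrightarrow>
      M c \<otimes> M d = qsign (tau n c d) (bilin_form (n + m) \<Lambda> c d) \<otimes> M (c + d)"
    and M_mult_zero: "c \<in> exponents n m \<Longrightarrow> d \<in> exponents n m \<Longrightarrow> c + d \<notin> exponents n m \<Longrightarrow>
      M c \<otimes> M d = \<zero>"
    and skew: "skew_symmetric (n + m) \<Lambda>"

lemma (in fraction_superring) super_frame:
  assumes via: "supertoric_frame_via n m \<Lambda> F \<iota> \<phi> \<eta> M"
    and skew: "skew_symmetric (n + m) (transferred_form n m \<Lambda> \<eta>)"
  shows "super_frame F qpow n m (transferred_form n m \<Lambda> \<eta>) M"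
proof
  have aut: "\<phi> \<in> ring_iso F F" and iso: "superlattice_iso n m \<eta>"
    using via unfolding supertoric_frame_via_def superalgebra_automorphism_def by auto
  have hom: "\<phi> \<in> ring_hom F F" and inj: "inj_on \<phi> (carrier F)"
    using aut unfolding ring_iso_def bij_betw_def by auto
  have phi0: "\<phi> \<zero> = \<zero>" using ring_hom_zero[OF hom] ring_axioms by blast
  have eta: "\<eta> c \<in> exponents n m" "M c = \<phi> (\<iota> (torus_basis (\<eta> c)))"
    if "c \<in> exponents n m" for c
    using via that unfolding supertoric_frame_via_def by blast+
  have ic: "\<iota> (torus_basis (\<eta> c)) \<in> carrier F" if "c \<in> exponents n m" for c
    using eta(1)[OF that] by (intro iota_closed) (simp add: torus_basis_def)
  show "M c \<in> carrier F" if "c \<in> exponents n m" for c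
    using eta(2)[OF that] ring_hom_closed[OF hom ic[OF that]] by simp
  have "\<eta> (0 + 0) = \<eta> 0 + \<eta> 0" using iso unfolding superlattice_iso_def superlattice_def
    by (metis (no_types, lifting) keys_zero empty_subsetI mem_Collect_eq)
  then have "\<eta> 0 = 0" by simp
  then show "M 0 = \<one>" using eta(2)[of 0] iota_one ring_hom_one[OF hom] by simp
  show "M c \<noteq> \<zero>" if "c \<in> exponents n m" for c
    using eta[OF that] ic[OF that] inj phi0 iota_basis_nonzero[of "\<eta> c"]
    by (metis inj_onD zero_closed)
  have mult: "M c \<otimes> M d = (if c + d \<in> exponents n m
         then \<iota> (scalar (signed_qpower (tau n c d)
                (bilin_form (n + m) (transferred_form n m \<Lambda> \<eta>) c d))) \<otimes> M (c + d) else \<zero>)"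
    if "c \<in> exponents n m" "d \<in> exponents n m" for c d
    using via that unfolding supertoric_frame_via_def by blast
  show "M c \<otimes> M d = qsign (tau n c d) (bilin_form (n + m) (transferred_form n m \<Lambda> \<eta>) c d) \<otimes>
      M (c + d)" if "c \<in> exponents n m" "d \<in> exponents n m" "c + d \<in> exponents n m" for c d
    using mult[OF that(1,2)] that(3) by (simp add: iota_signed_qpower)
  show "M c \<otimes> M d = \<zero>"
    if "c \<in> exponents n m" "d \<in> exponents n m" "c + d \<notin> exponents n m" for c d
    using mult[OF that(1,2)] that(3) by simp
qed (rule skew)

context super_frame
begin

abbreviation form :: "zvec \<Rightarrow> zvec \<Rightarrow> int" where "form \<equiv> bilin_form (n + m) \<Lambda>"
abbreviation evens :: "zvec set" where "evens \<equiv> even_sublattice n m"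

lemmas form_skew = bilin_form_skew[OF skew]
lemmas form_self = bilin_form_self[OF skew]

lemma M_mult_even_left:
  "c \<in> evens \<Longrightarrow> d \<in> exponents n m \<Longrightarrow> M c \<otimes> M d = qp (form c d) \<otimes> M (c + d)"
  using M_mult[OF even_sublattice_exponents _ even_add_exponents(1)]
  by (simp add: tau_even_left qsign_def)

lemma M_mult_even_right:
  "c \<in> exponents n m \<Longrightarrow> d \<in> evens \<Longrightarrow> M c \<otimes> M d = qp (form c d) \<otimes> M (c + d)"
  using M_mult[OF _ even_sublattice_exponents even_add_exponents(2)]
  by (simp add: tau_even_right qsign_def)

lemma M_split_even:
  assumes "c \<in> evens" "d \<in> exponents n m"
  shows "M (c + d) = qp (- form c d) \<otimes> (M c \<otimes> M d)"
  using assms even_sublattice_exponents[OF assms(1)] even_add_exponents(1)[OF assms]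
  by (simp add: M_mult_even_left qp_qp)

lemma M_inverse: "c \<in> evens \<Longrightarrow> M c \<otimes> M (- c) = \<one>"
  using M_mult_even_left[of c "- c"] even_sublattice_exponents[of "- c"]
  by (simp add: M_zero bilin_form_minus_right form_self)

lemma M_inverse': "c \<in> evens \<Longrightarrow> M (- c) \<otimes> M c = \<one>"
  using M_inverse[of "- c"] by simp

lemma M_Units: "c \<in> evens \<Longrightarrow> M c \<in> Units R"
  using M_inverse M_inverse' even_sublattice_exponents[of c] even_sublattice_exponents[of "- c"]
  unfolding Units_def by (auto intro!: bexI[of _ "M (- c)"])

lemma M_inv: "c \<in> evens \<Longrightarrow> inv (M c) = M (- c)"
  using M_inverse M_inverse' even_sublattice_exponents[of c] even_sublattice_exponents[of "- c"]
  by (intro inv_char) auto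

text \<open>
  An even monomial \<open>M c\<close> grades everything by the form: conjugation multiplies \<open>M d\<close> by
  \<open>q\<^sup>f\<close>, \<open>f = form c d\<close>, which is \<open>qp (2 * f)\<close>.
\<close>

lemma M_comm_deg:
  assumes "c \<in> evens" "d \<in> exponents n m"
  shows "comm_deg (M c) (2 * form c d) (M d)"
  using assms even_sublattice_exponents[OF assms(1)] even_add_exponents[OF assms]
    form_skew[of d c]
  by (simp add: comm_deg_def M_mult_even_left M_mult_even_right qp_qp add.commute)

lemma M_pow: "c \<in> evens \<Longrightarrow> M c [^] (b :: nat) = M (of_nat b * c)"
proof (induction b)
  case (Suc b)
  have "M (of_nat b * c) \<otimes> M c = M (of_nat b * c + c)"
    using M_mult_even_left[of "of_nat b * c" c] even_sublattice_exponents[of c n m]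
      even_sublattice_exponents[of "of_nat b * c + c" n m] Suc.prems
    by (simp add: bilin_form_of_nat_left form_self )
  moreover have "of_nat (Suc b) * c = of_nat b * c + c" by (simp add: algebra_simps)
  ultimately show ?case using Suc by simp
qed (simp add: M_zero)

lemma M_split:
  assumes "c \<in> exponents n m" "d \<in> exponents n m" "c + d \<in> exponents n m"
  shows "M (c + d) = qsign (tau n c d) (- form c d) \<otimes> (M c \<otimes> M d)"
  using assms by (simp add: M_mult qsign_inverse flip: m_assoc)

end

lemma unit_vec_add_exponents:
  "i \<in> {1..n + m} \<Longrightarrow> j \<in> {1..n + m} \<Longrightarrow> i \<noteq> j \<Longrightarrow> unit_vec i + unit_vec j \<in> exponents n m"
  by (rule exponentsI) (auto simp: lookup_add lookup_single when_def split: if_splits)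

text \<open>
  The induction step for decomposing \<open>M c\<close> into variables and inverses of even variables: one basis
  vector with coefficient of the right sign is split off, and the remaining coefficients keep their signs.
\<close>

lemma exponents_peel:
  assumes c: "c \<in> exponents n m" and "c \<noteq> 0"
  obtains i s where "i \<in> {1..n + m}" "Poly_Mapping.single i s \<in> exponents n m"
    "c - Poly_Mapping.single i s \<in> exponents n m" "lookup c i \<noteq> 0"
    "s = 1 \<and> lookup c i > 0 \<or> s = - 1 \<and> lookup c i < 0 \<and> i \<in> {1..n}"
    "(\<Sum>j\<in>{1..n + m}. nat \<bar>lookup (c - Poly_Mapping.single i s) j\<bar>) <
      (\<Sum>j\<in>{1..n + m}. nat \<bar>lookup c j\<bar>)"
    "\<And>j. lookup (c - Poly_Mapping.single i s) j > 0 \<Longrightarrow> lookup c j > 0"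
    "\<And>j. lookup (c - Poly_Mapping.single i s) j < 0 \<Longrightarrow> lookup c j < 0"
proof -
  obtain i where i: "lookup c i \<noteq> 0" using assms(2) by (metis poly_mapping_eqI lookup_zero)
  then have i1: "i \<in> {1..n + m}" using exponents_lookup_outside[OF c, of i] by force
  define s where "s = sgn (lookup c i)"
  have io: "lookup c i \<in> {0, 1}" if "i > n" 
    using exponents_lookup_odd[OF c, of i] i1 that by (simp add: odd_vertices_def)
  have s: "s = 1 \<and> lookup c i > 0 \<or> s = - 1 \<and> lookup c i < 0 \<and> i \<in> {1..n}"
    using i i1 io unfolding s_def by (cases "i > n") (auto simp: sgn_if)
  let ?d = "c - Poly_Mapping.single i s"
  have ld: "lookup ?d j = (if j = i then lookup c i - s else lookup c j)" for j
    by (simp add: lookup_minus lookup_single when_def)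
  have 1: "Poly_Mapping.single i s \<in> exponents n m"
    using s i1 by (intro exponentsI) (auto simp: lookup_single when_def)
  have 2: "?d \<in> exponents n m"
  proof (rule exponentsI)
    show "lookup ?d j = 0" if "j = 0 \<or> j > n + m" for j
      using that exponents_lookup_outside[OF c that] i1 ld by auto
    show "lookup ?d j \<in> {0, 1}" if "n < j" "j \<le> n + m" for j
      using that exponents_lookup_odd[OF c, of j] s ld io i by (auto simp: odd_vertices_def)
  qed
  have 3: "(\<Sum>j\<in>{1..n + m}. nat \<bar>lookup ?d j\<bar>) < (\<Sum>j\<in>{1..n + m}. nat \<bar>lookup c j\<bar>)"
  proof (rule sum_strict_mono_ex1)
    show "\<exists>j\<in>{1..n + m}. nat \<bar>lookup ?d j\<bar> < nat \<bar>lookup c j\<bar>"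
      by (rule bexI[OF _ i1]) (use s ld in auto)
  qed (use s ld in auto)
  show ?thesis
    by (rule that[OF i1 1 2 i s 3]) (use s ld in \<open>auto split: if_splits\<close>)
qed

context super_frame
begin

lemma qsign_subring: "subring A R \<Longrightarrow> (\<And>a. qp a \<in> A) \<Longrightarrow> qsign t a \<in> A"
  by (auto simp: qsign_def subringE)

text \<open>
  The signs of the coordinates of \<open>c\<close> decide which variables have to be inverted. This precision is needed
  for rings that contain \<open>X j\<close> but not its inverse.
\<close>

lemma M_generated:
  assumes A: "subring A R" "\<And>a. qp a \<in> A"
    and c: "c \<in> exponents n m"
    and pos: "\<And>i. i \<in> {1..n + m} \<Longrightarrow> lookup c i > 0 \<Longrightarrow> M (unit_vec i) \<in> A"
    and neg: "\<And>i. i \<in> {1..n} \<Longrightarrow> lookup c i < 0 \<Longrightarrow> M (- unit_vec i) \<in> A"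
  shows "M c \<in> A"
  using c pos neg
proof (induction "\<Sum>j\<in>{1..n + m}. nat \<bar>lookup c j\<bar>" arbitrary: c rule: less_induct)
  case less
  show ?case
  proof (cases "c = 0")
    case True then show ?thesis using A by (simp add: M_zero subringE)
  next
    case False
    from exponents_peel[OF less.prems(1) False] obtain i s where
      i: "i \<in> {1..n + m}" "Poly_Mapping.single i s \<in> exponents n m"
      and d: "c - Poly_Mapping.single i s \<in> exponents n m"
      and s: "s = 1 \<and> lookup c i > 0 \<or> s = - 1 \<and> lookup c i < 0 \<and> i \<in> {1..n}"
      and lt: "(\<Sum>j\<in>{1..n + m}. nat \<bar>lookup (c - Poly_Mapping.single i s) j\<bar>) <
        (\<Sum>j\<in>{1..n + m}. nat \<bar>lookup c j\<bar>)"
      and sg: "\<And>j. lookup (c - Poly_Mapping.single i s) j > 0 \<Longrightarrow> lookup c j > 0"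
        "\<And>j. lookup (c - Poly_Mapping.single i s) j < 0 \<Longrightarrow> lookup c j < 0" by metis
    have "M (c - Poly_Mapping.single i s) \<in> A"
      using sg by (intro less.hyps[OF lt d]) (auto intro: less.prems)
    moreover have "M (Poly_Mapping.single i s) \<in> A"
      using s less.prems(2)[OF i(1)] less.prems(3)[of i] by (auto simp: single_uminus)
    moreover have "M c = qsign (tau n (Poly_Mapping.single i s) (c - Poly_Mapping.single i s))
        (- form (Poly_Mapping.single i s) (c - Poly_Mapping.single i s)) \<otimes>
        (M (Poly_Mapping.single i s) \<otimes> M (c - Poly_Mapping.single i s))"
      using M_split[OF i(2) d] less.prems(1) by simp
    ultimately show ?thesis using A qsign_subring by (simp add: subringE)
  qed
qed

text \<open>
  For \<open>p = r\<close> both sides vanish. Otherwise exactly one of the two orders of \<open>p\<close> and \<open>r\<close> contributes a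
  sign \<open>\<tau>\<close>.
\<close>

lemma odd_anticommute:
  assumes p: "p \<in> odd_vertices n m" and r: "r \<in> odd_vertices n m"
  shows "M (unit_vec p) \<otimes> M (unit_vec r) =
    \<ominus> (qp (2 * \<Lambda> p r) \<otimes> (M (unit_vec r) \<otimes> M (unit_vec p)))"
proof (cases "p = r")
  case True
  have "lookup (unit_vec p + unit_vec p) p = 2"
    unfolding lookup_add lookup_single_eq by simp
  then have "unit_vec p + unit_vec p \<notin> exponents n m"
    using exponents_lookup_odd[OF _ p] by fastforce
  then show ?thesis using True p by (simp add: M_mult_zero odd_vertices_def)
next
  case False
  have pr: "p \<in> {1..n + m}" "r \<in> {1..n + m}" "p > n" "r > n"
    using p r by (auto simp: odd_vertices_def)
  have e: "unit_vec p + unit_vec r \<in> exponents n m" "unit_vec r + unit_vec p \<in> exponents n m"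
    using False pr by (auto intro!: unit_vec_add_exponents)
  have sk: "\<Lambda> r p = - \<Lambda> p r" using skew pr unfolding skew_symmetric_def by blast
  show ?thesis
    using False pr e M_mult[of "unit_vec p" "unit_vec r"] M_mult[of "unit_vec r" "unit_vec p"]
    by (cases "r < p") (auto simp: tau_unit_vec bilin_form_unit_vec sk qsign_def l_minus r_minus
        qp_qp add.commute[of "unit_vec r"])
qed

lemma odd_square:
  assumes p: "p \<in> odd_vertices n m" shows "M (unit_vec p) \<otimes> M (unit_vec p) = \<zero>"
proof -
  have "lookup (unit_vec p + unit_vec p) p = 2"
    unfolding lookup_add lookup_single_eq by simp
  then have "unit_vec p + unit_vec p \<notin> exponents n m"
    using exponents_lookup_odd[OF _ p] by fastforce
  then show ?thesis using p by (simp add: M_mult_zero odd_vertices_def)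
qed

end

text \<open>
  Two frames in the same ring; later they belong to adjacent seeds and differ in one variable only.
\<close>

locale two_frames = F1: super_frame R qp n m \<Lambda> M + F2: super_frame R qp n m \<Lambda>' M'
  for R :: "('a, 'b) ring_scheme" (structure) and qp n m \<Lambda> M \<Lambda>' M'
begin

text \<open>
  The form can be read off from commutation relations, since a product of two different variables is
  nonzero and powers of \<open>q\<close> are distinguished by their action on nonzero elements.
\<close>

lemma forms_agree:
  assumes i: "i \<in> {1..n + m}" and j: "j \<in> {1..n + m}" and "i \<noteq> j"
    and Mi: "M' (unit_vec i) = M (unit_vec i)" and Mj: "M' (unit_vec j) = M (unit_vec j)"
  shows "\<Lambda>' i j = \<Lambda> i j"
proof -
  have e: "unit_vec j + unit_vec i \<in> exponents n m"
    using assms by (auto intro!: unit_vec_add_exponents)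
  let ?y = "M (unit_vec j) \<otimes> M (unit_vec i)"
  have yc: "?y \<in> carrier R" using i j by simp
  have y: "?y \<noteq> \<zero>"
  proof
    assume "?y = \<zero>"
    moreover have "M (unit_vec j + unit_vec i) \<noteq> \<zero>" using e F1.M_nonzero by auto
    ultimately show False using F1.M_split[OF _ _ e] i j by simp
  qed
  have "qp (2 * \<Lambda>' i j) \<otimes> ?y = qp (2 * \<Lambda> i j) \<otimes> ?y"
  proof (cases "i \<le> n \<or> j \<le> n")
    case False
    then have o: "i \<in> odd_vertices n m" "j \<in> odd_vertices n m"
      using i j by (auto simp: odd_vertices_def)
    show ?thesis using F1.odd_anticommute[OF o] F2.odd_anticommute[OF o] yc
      by (simp add: Mi Mj) (metis F1.minus_minus F1.qp_closed F1.m_closed)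
  next
    case True
    then consider "unit_vec i \<in> even_sublattice n m" | "unit_vec j \<in> even_sublattice n m"
      using i j by (meson even_sublattice_closed(5) atLeastAtMost_iff)
    then show ?thesis
    proof cases
      case 1
      then show ?thesis using F1.M_comm_deg[OF 1, of "unit_vec j"] F2.M_comm_deg[OF 1, of "unit_vec j"]
          i j by (simp add: F1.comm_deg_def Mi Mj bilin_form_unit_vec)
    next
      case 2
      have s: "\<Lambda> j i = - \<Lambda> i j" "\<Lambda>' j i = - \<Lambda>' i j"
        using F1.skew F2.skew i j unfolding skew_symmetric_def by blast+
      have "qp (2 * \<Lambda> j i) \<otimes> (M (unit_vec i) \<otimes> M (unit_vec j)) = ?y"
        "qp (2 * \<Lambda>' j i) \<otimes> (M (unit_vec i) \<otimes> M (unit_vec j)) = ?y"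
        using F1.M_comm_deg[OF 2, of "unit_vec i"] F2.M_comm_deg[OF 2, of "unit_vec i"]
          i j by (simp_all add: F1.comm_deg_def Mi Mj bilin_form_unit_vec)
      moreover have "M (unit_vec i) \<otimes> M (unit_vec j) \<in> carrier R" using i j by simp
      ultimately have "M (unit_vec i) \<otimes> M (unit_vec j) = qp (- (2 * \<Lambda> j i)) \<otimes> ?y"
        "M (unit_vec i) \<otimes> M (unit_vec j) = qp (- (2 * \<Lambda>' j i)) \<otimes> ?y"
        using F1.qp_move[OF yc] by metis+
      then show ?thesis by (simp add: s)
    qed
  qed
  then show ?thesis using F1.qp_regular[OF yc] y by fastforce
qed

text \<open>
  A frame is determined by its values on basis vectors; only those that occur in \<open>c\<close> are relevant.
\<close>

lemma frames_agree:
  assumes c: "c \<in> exponents n m"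
    and Mi: "\<And>i. i \<in> keys c \<Longrightarrow> M' (unit_vec i) = M (unit_vec i)"
  shows "M' c = M c"
  using assms
proof (induction "\<Sum>j\<in>{1..n + m}. nat \<bar>lookup c j\<bar>" arbitrary: c rule: less_induct)
  case less
  show ?case
  proof (cases "c = 0")
    case True then show ?thesis by (simp add: F1.M_zero F2.M_zero)
  next
    case False
    from exponents_peel[OF less.prems(1) False] obtain i s where
      i: "i \<in> {1..n + m}" "Poly_Mapping.single i s \<in> exponents n m"
      and d: "c - Poly_Mapping.single i s \<in> exponents n m" and ci: "lookup c i \<noteq> 0"
      and s: "s = 1 \<and> lookup c i > 0 \<or> s = - 1 \<and> lookup c i < 0 \<and> i \<in> {1..n}"
      and lt: "(\<Sum>j\<in>{1..n + m}. nat \<bar>lookup (c - Poly_Mapping.single i s) j\<bar>) <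
        (\<Sum>j\<in>{1..n + m}. nat \<bar>lookup c j\<bar>)"
      and sg: "\<And>j. lookup (c - Poly_Mapping.single i s) j > 0 \<Longrightarrow> lookup c j > 0"
        "\<And>j. lookup (c - Poly_Mapping.single i s) j < 0 \<Longrightarrow> lookup c j < 0" by metis
    let ?u = "Poly_Mapping.single i s" and ?d = "c - Poly_Mapping.single i s"
    have ik: "i \<in> keys c" using ci in_keys_iff by fast
    have dk: "j \<in> keys c" if "j \<in> keys ?d" for j
    proof -
      have "lookup ?d j \<noteq> 0" using that in_keys_iff by fast
      then have "lookup c j \<noteq> 0" using sg[of j] by (metis linorder_neqE_linordered_idom less_irrefl)
      then show ?thesis using in_keys_iff by fast
    qed
    have Md: "M' ?d = M ?d" using dk by (intro less.hyps[OF lt d]) (auto intro: less.prems)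
    have Mu: "M' ?u = M ?u"
    proof (cases "s = 1")
      case False
      then have "?u = - unit_vec i" "i \<in> {1..n}" using s by (auto simp: single_uminus)
      then show ?thesis using less.prems(2)[OF ik] F1.M_inv[of "unit_vec i"] F2.M_inv[of "unit_vec i"]
        by (simp del: F1.inv_char)
    qed (use less.prems(2)[OF ik] in simp)
    have f: "bilin_form (n + m) \<Lambda>' ?u ?d = bilin_form (n + m) \<Lambda> ?u ?d"
      unfolding bilin_form_def
    proof (intro sum.cong refl)
      fix a b assume ab: "a \<in> {1..n + m}" "b \<in> {1..n + m}"
      show "lookup ?u a * \<Lambda>' a b * lookup ?d b = lookup ?u a * \<Lambda> a b * lookup ?d b"
      proof (cases "a = i \<and> b \<in> keys ?d")
        case True
        have "\<Lambda>' i b = \<Lambda> i b"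
        proof (cases "i = b")
          case True
          have "\<Lambda> i i = 0" "\<Lambda>' i i = 0"
            using i(1) F1.skew F2.skew unfolding skew_symmetric_def by fastforce+
          then show ?thesis using True by simp
        qed (use ab i True dk ik less.prems(2) in \<open>auto intro: forms_agree\<close>)
        then show ?thesis using True by simp
      next
        case False
        then have "lookup ?u a = 0 \<or> lookup ?d b = 0"
          using lookup_single_not_eq[of i a s] not_in_keys_iff_lookup_eq_zero[of b ?d] by auto
        then show ?thesis by auto
      qed
    qed
    have "M' (?u + ?d) = M (?u + ?d)"
      using F1.M_split[OF i(2) d] F2.M_split[OF i(2) d] less.prems(1) Md Mu f by simp
    then show ?thesis by simp
  qed
qed

end

section \<open>Central nilpotent elements from pairs of odd variables\<close>

lemma (in abelian_monoid) finsum_Times: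
  assumes "finite A" "finite B" "\<And>x y. x \<in> A \<Longrightarrow> y \<in> B \<Longrightarrow> f (x, y) \<in> carrier G"
  shows "finsum G f (A \<times> B) = (\<Oplus>x\<in>A. \<Oplus>y\<in>B. f (x, y))"
  using assms(1,3)
proof (induction A rule: finite_induct)
  case (insert a A)
  have "insert a A \<times> B = Pair a ` B \<union> A \<times> B" by auto
  then have "finsum G f (insert a A \<times> B) = finsum G f (Pair a ` B) \<oplus> finsum G f (A \<times> B)"
    using insert assms(2) by (simp only:) (intro finsum_Un_disjoint, auto)
  also have "finsum G f (Pair a ` B) = (\<Oplus>y\<in>B. f (a, y))"
    using insert.prems by (intro finsum_reindex) (auto simp: inj_on_def)
  finally show ?case using insert by (simp add: finsum_insert Pi_def)
qed simp

lemma (in ring) finsum_neg: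
  assumes "f \<in> A \<rightarrow> carrier R" shows "(\<Oplus>x\<in>A. \<ominus> f x) = \<ominus> (finsum R f A)"
proof (cases "finite A")
  case True
  have "(\<Oplus>x\<in>A. \<ominus> f x) = (\<Oplus>x\<in>A. (\<ominus> \<one>) \<otimes> f x)"
    using assms by (intro finsum_cong') (auto simp: l_minus Pi_def)
  also have "\<dots> = (\<ominus> \<one>) \<otimes> finsum R f A" using True assms by (simp add: finsum_rdistr)
  finally show ?thesis using assms by (simp add: l_minus)
qed (simp add: finsum_infinite)

lemma (in q_ring) antisymmetric_zero:
  assumes "x \<in> carrier R" "x = \<ominus> x" shows "x = \<zero>"
proof (rule torsion_free[of x 2])
  have "add_pow R (2 :: nat) x = x \<oplus> x" using assms(1) by (simp add: numeral_2_eq_2)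
  then show "add_pow R (2 :: nat) x = \<zero>" using assms by (metis r_neg)
qed (use assms in auto)

lemma (in ring) subring_add_pow:
  assumes "subring A R" "x \<in> A" shows "add_pow R (z :: int) x \<in> A"
proof -
  have "add_pow R (k :: nat) x \<in> A" for k
    using assms by (induction k) (auto simp: subringE)
  then show ?thesis using assms
    by (cases "z \<ge> 0") (auto simp: add_pow_int_ge add_pow_int_lt subringE)
qed

lemma (in ring) add_pow_int_zero [simp]: "add_pow R (0 :: int) x = \<zero>"
  by (simp add: add_pow_int_ge)

lemma (in ring) add_pow_mult:
  assumes "a \<in> carrier R" "b \<in> carrier R"
  shows "add_pow R (z :: int) a \<otimes> add_pow R (w :: int) b = add_pow R (z * w) (a \<otimes> b)"
  using assms by (simp add: add_pow_ldistr_int add_pow_rdistr_int add.int_pow_pow mult.commute)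

lemma (in ring) centralizer_subring:
  assumes x: "x \<in> carrier R" shows "subring {y \<in> carrier R. y \<otimes> x = x \<otimes> y} R"
proof (rule subringI)
  fix h1 h2 assume h: "h1 \<in> {y \<in> carrier R. y \<otimes> x = x \<otimes> y}" "h2 \<in> {y \<in> carrier R. y \<otimes> x = x \<otimes> y}"
  have "h1 \<otimes> h2 \<otimes> x = h1 \<otimes> (h2 \<otimes> x)" using h x by (simp add: m_assoc)
  also have "\<dots> = (h1 \<otimes> x) \<otimes> h2" using h x m_assoc[of h1 x h2] by simp
  also have "\<dots> = x \<otimes> (h1 \<otimes> h2)" using h x m_assoc[of x h1 h2] by simp
  finally show "h1 \<otimes> h2 \<in> {y \<in> carrier R. y \<otimes> x = x \<otimes> y}" using h by simp
qed (use x in \<open>auto simp: l_minus r_minus l_distr r_distr\<close>)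

context super_frame
begin

abbreviation X :: "nat \<Rightarrow> 'a" where "X i \<equiv> M (unit_vec i)"
abbreviation odds :: "nat set" where "odds \<equiv> odd_vertices n m"

lemma X_closed [simp]: "i \<in> {1..n + m} \<Longrightarrow> X i \<in> carrier R"
  by simp

lemma X_odd_closed [simp]: "p \<in> odds \<Longrightarrow> X p \<in> carrier R"
  by (rule X_closed) (auto simp: odd_vertices_def)

text \<open>
  The normalisation makes \<open>theta\<close> exactly antisymmetric. For \<open>p \<noteq> r\<close> it is the signed monomial
  \<open>(- 1)\<^sup>\<tau> M (e\<^sub>p + e\<^sub>r)\<close> of the exchange relation.
\<close>

definition theta :: "nat \<Rightarrow> nat \<Rightarrow> 'a"
  where "theta p r = qp (- \<Lambda> p r) \<otimes> (X p \<otimes> X r)"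

lemma theta_closed [simp]: "p \<in> odds \<Longrightarrow> r \<in> odds \<Longrightarrow> theta p r \<in> carrier R"
  by (simp add: theta_def)

lemma skew_odd: "p \<in> odds \<Longrightarrow> r \<in> odds \<Longrightarrow> \<Lambda> r p = - \<Lambda> p r"
proof -
  assume "p \<in> odds" "r \<in> odds"
  then have "r \<in> {1..n + m}" "p \<in> {1..n + m}" by (auto simp: odd_vertices_def)
  then show ?thesis using skew unfolding skew_symmetric_def by blast
qed

lemma theta_swap:
  assumes "p \<in> odds" "r \<in> odds" shows "theta r p = \<ominus> theta p r"
proof -
  have "theta r p = qp (\<Lambda> p r) \<otimes> (\<ominus> (qp (- (2 * \<Lambda> p r)) \<otimes> (X p \<otimes> X r)))"
    using odd_anticommute[OF assms(2,1)] by (simp add: theta_def skew_odd[OF assms])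
  then show ?thesis using assms by (simp add: theta_def r_minus qp_qp)
qed

lemma theta_self: "p \<in> odds \<Longrightarrow> theta p p = \<zero>"
  by (simp add: theta_def odd_square)

lemma theta_eq:
  assumes p: "p \<in> odds" and r: "r \<in> odds" and "p \<noteq> r"
  shows "add_pow R ((- 1) ^ tau n (unit_vec p) (unit_vec r) * z) (M (unit_vec p + unit_vec r)) =
    add_pow R (z :: int) (theta p r)"
proof -
  have pr: "p \<in> {1..n + m}" "r \<in> {1..n + m}" using p r by (auto simp: odd_vertices_def)
  let ?t = "tau n (unit_vec p) (unit_vec r)" and ?M = "M (unit_vec p + unit_vec r)"
  have e: "unit_vec p + unit_vec r \<in> exponents n m" using pr assms(3) by (rule unit_vec_add_exponents)
  then have Mc: "?M \<in> carrier R" by simp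
  have "theta p r = qsign ?t 0 \<otimes> ?M"
    using pr e M_mult[of "unit_vec p" "unit_vec r"]
    by (auto simp: theta_def bilin_form_unit_vec qsign_def qp_qp l_minus r_minus)
  then show ?thesis using Mc
    by (auto simp: qsign_def l_minus add.int_pow_inv add.int_pow_neg)
qed

text \<open>
  What compatibility demands of the ends of an odd-even-odd 2-path.
\<close>

definition balanced :: "nat \<Rightarrow> nat \<Rightarrow> bool"
  where "balanced p r \<longleftrightarrow> (\<forall>i\<in>{1..n + m} - {p, r}. \<Lambda> i p = - \<Lambda> i r)"

text \<open>
  For a balanced pair the powers of \<open>q\<close> from commuting \<open>X i\<close> past \<open>X p\<close> and past \<open>X r\<close> cancel, and if
  \<open>i\<close> is odd, so do the two signs. If \<open>i\<close> is one of \<open>p\<close> and \<open>r\<close>, both sides contain the square of an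
  odd variable.
\<close>

lemma theta_commute_X:
  assumes p: "p \<in> odds" and r: "r \<in> odds" and b: "balanced p r" and i: "i \<in> {1..n + m}"
  shows "X i \<otimes> theta p r = theta p r \<otimes> X i"
proof (cases "i \<le> n")
  case True
  then have i1: "i \<in> {1..n}" using i by auto
  then have "i \<notin> {p, r}" using p r by (auto simp: odd_vertices_def)
  then have l: "\<Lambda> i p = - \<Lambda> i r" using b i unfolding balanced_def by blast
  have pr: "p \<in> {1..n + m}" "r \<in> {1..n + m}" using p r by (auto simp: odd_vertices_def)
  have "comm_deg (X i) (2 * \<Lambda> i p + 2 * \<Lambda> i r) (X p \<otimes> X r)"
    using M_comm_deg[of "unit_vec i" "unit_vec p"] M_comm_deg[of "unit_vec i" "unit_vec r"] i i1 pr
    by (intro comm_deg_mult) (auto simp: bilin_form_unit_vec)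
  then have "comm_deg (X i) (0 + 0) (theta p r)" unfolding theta_def using i l
    by (intro comm_deg_mult comm_deg_qp) auto
  then show ?thesis using i p r by (simp add: comm_deg_def)
next
  case False
  then have io: "i \<in> odds" using i by (auto simp: odd_vertices_def)
  note [simp] = X_odd_closed[OF io] X_odd_closed[OF p] X_odd_closed[OF r]
  have zero: "X i \<otimes> (X p \<otimes> X r) = \<zero> \<and> (X p \<otimes> X r) \<otimes> X i = \<zero>" if "i = p \<or> i = r"
  proof -
    have "X p \<otimes> (X p \<otimes> X r) = \<zero>" using p by (simp add: odd_square flip: m_assoc)
    moreover have "(X p \<otimes> X r) \<otimes> X r = \<zero>" using r by (simp add: odd_square m_assoc)
    moreover have "X p \<otimes> X r = \<ominus> (qp (2 * \<Lambda> p r) \<otimes> (X r \<otimes> X p))" by (rule odd_anticommute[OF p r])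
    moreover have "X r \<otimes> (X r \<otimes> X p) = \<zero>" using r by (simp add: odd_square flip: m_assoc)
    moreover have "(X r \<otimes> X p) \<otimes> X p = \<zero>" using p by (simp add: odd_square m_assoc)
    ultimately show ?thesis using that
      by (auto simp: r_minus l_minus qp_swap[of "X r" "X r \<otimes> X p"] m_assoc[of "qp (2 * \<Lambda> p r)"])
  qed
  have "X i \<otimes> (X p \<otimes> X r) = (X p \<otimes> X r) \<otimes> X i"
  proof (cases "i = p \<or> i = r")
    case True then show ?thesis using zero by simp
  next
    case False
    then have l: "\<Lambda> i p = - \<Lambda> i r" using b i unfolding balanced_def by blast
    have "X i \<otimes> (X p \<otimes> X r) = (X i \<otimes> X p) \<otimes> X r" by (simp add: m_assoc)
    also have "\<dots> = \<ominus> (qp (2 * \<Lambda> i p) \<otimes> (X p \<otimes> (X i \<otimes> X r)))"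
      by (subst odd_anticommute[OF io p]) (simp add: l_minus m_assoc)
    also have "\<dots> = qp (2 * \<Lambda> i p) \<otimes> (X p \<otimes> (qp (2 * \<Lambda> i r) \<otimes> (X r \<otimes> X i)))"
      by (subst odd_anticommute[OF io r]) (simp add: r_minus)
    also have "\<dots> = (X p \<otimes> X r) \<otimes> X i"
      by (simp add: l qp_swap[of "X p"] qp_qp m_assoc)
    finally show ?thesis .
  qed
  then show ?thesis by (simp add: theta_def m_assoc qp_swap[of "X i" "X p \<otimes> X r"])
qed

lemma X_inverse_commute:
  assumes i: "i \<in> {1..n}" and x: "x \<in> carrier R" and c: "X i \<otimes> x = x \<otimes> X i"
  shows "M (- unit_vec i) \<otimes> x = x \<otimes> M (- unit_vec i)"
proof -
  have e: "unit_vec i \<in> evens" using i by simp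
  have cl: "X i \<in> carrier R" "M (- unit_vec i) \<in> carrier R"
    using even_sublattice_exponents[OF e] even_sublattice_exponents[of "- unit_vec i"] e by auto
  have "M (- unit_vec i) \<otimes> x = M (- unit_vec i) \<otimes> (x \<otimes> X i) \<otimes> M (- unit_vec i)"
    using cl x M_inverse[OF e] by (simp add: m_assoc)
  also have "\<dots> = (M (- unit_vec i) \<otimes> X i) \<otimes> x \<otimes> M (- unit_vec i)"
    using cl x by (simp add: c[symmetric] m_assoc)
  also have "\<dots> = x \<otimes> M (- unit_vec i)" using M_inverse'[OF e] x by simp
  finally show ?thesis .
qed

lemma commute_M:
  assumes x: "x \<in> carrier R" and com: "\<And>i. i \<in> {1..n + m} \<Longrightarrow> X i \<otimes> x = x \<otimes> X i"
    and c: "c \<in> exponents n m"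
  shows "M c \<otimes> x = x \<otimes> M c"
proof -
  have "M c \<in> {y \<in> carrier R. y \<otimes> x = x \<otimes> y}"
  proof (rule M_generated[OF centralizer_subring[OF x] _ c])
    fix i :: nat assume "i \<in> {1..n}"
    then show "M (- unit_vec i) \<in> {y \<in> carrier R. y \<otimes> x = x \<otimes> y}"
      using X_inverse_commute[OF _ x com] even_sublattice_exponents[of "- unit_vec i" n m] by simp
  qed (use x com qp_central in auto)
  then show ?thesis by simp
qed

text \<open>
  The coefficients are arbitrary integers, so that cancellation of opposite 2-paths can be
  treated as linear algebra in \<open>c\<close>.
\<close>

definition quadratic :: "(nat \<Rightarrow> nat \<Rightarrow> int) \<Rightarrow> 'a"
  where "quadratic c = finsum R (\<lambda>(p, r). add_pow R (c p r) (theta p r)) (odds \<times> odds)"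

lemma finite_odds [simp]: "finite odds"
  by (simp add: odd_vertices_def)

lemma quadratic_term_closed: "(\<lambda>(p, r). add_pow R (c p r :: int) (theta p r)) \<in> odds \<times> odds \<rightarrow> carrier R"
  by auto

lemma quadratic_closed [simp]: "quadratic c \<in> carrier R"
  unfolding quadratic_def by (rule finsum_closed[OF quadratic_term_closed])

lemma quadratic_cong: "(\<And>p r. p \<in> odds \<Longrightarrow> r \<in> odds \<Longrightarrow> c p r = d p r) \<Longrightarrow> quadratic c = quadratic d"
  unfolding quadratic_def by (intro finsum_cong') auto

lemma quadratic_add: "quadratic (\<lambda>p r. c p r + d p r) = quadratic c \<oplus> quadratic d"
proof -
  have "quadratic c \<oplus> quadratic d = (\<Oplus>x\<in>odds \<times> odds. (case x of (p, r) \<Rightarrow> add_pow R (c p r) (theta p r)) \<oplus>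
      (case x of (p, r) \<Rightarrow> add_pow R (d p r) (theta p r)))"
    unfolding quadratic_def by (intro finsum_addf[symmetric]) auto
  also have "\<dots> = quadratic (\<lambda>p r. c p r + d p r)" unfolding quadratic_def
    by (intro finsum_cong') (auto simp: add.int_pow_mult)
  finally show ?thesis ..
qed

lemma quadratic_swap: "quadratic (\<lambda>p r. c r p) = \<ominus> quadratic c"
proof -
  have "\<ominus> quadratic c = (\<Oplus>x\<in>odds \<times> odds. \<ominus> (case x of (p, r) \<Rightarrow> add_pow R (c p r) (theta p r)))"
    unfolding quadratic_def by (intro finsum_neg[symmetric]) auto
  also have "\<dots> = (\<Oplus>x\<in>prod.swap ` (odds \<times> odds). \<ominus> (case x of (p, r) \<Rightarrow> add_pow R (c p r) (theta p r)))"
    by (simp add: product_swap)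
  also have "\<dots> = (\<Oplus>x\<in>odds \<times> odds. \<ominus> (case prod.swap x of (p, r) \<Rightarrow> add_pow R (c p r) (theta p r)))"
    by (intro finsum_reindex) (auto simp: inj_on_def)
  also have "\<dots> = quadratic (\<lambda>p r. c r p)" unfolding quadratic_def
  proof (intro finsum_cong' refl)
    fix x assume "x \<in> odds \<times> odds"
    then obtain p r where x: "x = (p, r)" and pr: "p \<in> odds" "r \<in> odds" by auto
    show "\<ominus> (case prod.swap x of (p, r) \<Rightarrow> add_pow R (c p r) (theta p r)) =
        (case x of (p, r) \<Rightarrow> add_pow R (c r p) (theta p r))"
      using pr by (simp add: x theta_swap[OF pr] add.int_pow_inv)
  qed auto
  finally show ?thesis ..
qed

text \<open>
  Only the antisymmetric part of the coefficients matters, since \<open>theta\<close> is antisymmetric and there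
  is no 2-torsion. In particular a pair of opposite 2-paths contributes nothing.
\<close>

lemma quadratic_antisymmetrize:
  assumes "\<And>p r. p \<in> odds \<Longrightarrow> r \<in> odds \<Longrightarrow> c p r - c r p = d p r - d r p"
  shows "quadratic c = quadratic d"
proof -
  let ?e = "\<lambda>p r. c p r - d p r"
  have "quadratic ?e = quadratic (\<lambda>p r. ?e r p)" using assms by (intro quadratic_cong) (simp add: algebra_simps)
  also have "\<dots> = \<ominus> quadratic ?e" by (rule quadratic_swap)
  finally have "quadratic ?e = \<zero>" by (intro antisymmetric_zero) auto
  then show ?thesis using quadratic_add[of d ?e] by simp
qed

lemma quadratic_scale: "quadratic (\<lambda>p r. z * c p r) = add_pow R (z :: int) (quadratic c)"
proof -
  have "quadratic (\<lambda>p r. int k * c p r) = add_pow R k (quadratic c)" for k :: nat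
  proof (induction k)
    case 0
    have "quadratic (\<lambda>p r. 0) = \<zero>" unfolding quadratic_def by (intro add.finprod_one_eqI) auto
    then show ?case by simp
  next
    case (Suc k)
    have "quadratic (\<lambda>p r. int (Suc k) * c p r) = quadratic (\<lambda>p r. int k * c p r + c p r)"
      by (intro quadratic_cong) (simp add: algebra_simps)
    then show ?case using Suc quadratic_add by simp
  qed
  note nat = this
  show ?thesis
  proof (cases "z \<ge> 0")
    case True then show ?thesis using nat[of "nat z"] by (simp add: add_pow_int_ge)
  next
    case False
    have "quadratic (\<lambda>p r. z * c p r) \<oplus> quadratic (\<lambda>p r. int (nat (- z)) * c p r) = quadratic (\<lambda>p r. 0)"
      using False by (subst quadratic_add[symmetric], intro quadratic_cong) (simp add: algebra_simps)
    also have "quadratic (\<lambda>p r. 0) = \<zero>" unfolding quadratic_def by (intro add.finprod_one_eqI) auto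
    finally show ?thesis using False nat[of "nat (- z)"]
      by (simp add: add_pow_int_lt) (metis add.nat_pow_closed minus_equality quadratic_closed)
  qed
qed

lemma quadratic_subring:
  assumes A: "subring A R"
    and t: "\<And>p r. p \<in> odds \<Longrightarrow> r \<in> odds \<Longrightarrow> c p r \<noteq> 0 \<Longrightarrow> theta p r \<in> A"
  shows "quadratic c \<in> A"
  unfolding quadratic_def
proof (rule subring_finsum[OF A])
  fix x assume "x \<in> odds \<times> odds"
  then obtain p r where x: "x = (p, r)" and pr: "p \<in> odds" "r \<in> odds" by auto
  show "(case x of (p, r) \<Rightarrow> add_pow R (c p r) (theta p r)) \<in> A"
    using pr t[OF pr] subring_add_pow[OF A] subringE(2)[OF A] by (cases "c p r = 0") (auto simp: x)
qed

lemma quadratic_commute_M: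
  assumes b: "\<And>p r. p \<in> odds \<Longrightarrow> r \<in> odds \<Longrightarrow> c p r \<noteq> 0 \<Longrightarrow> balanced p r"
    and e: "e \<in> exponents n m"
  shows "M e \<otimes> quadratic c = quadratic c \<otimes> M e"
proof (rule commute_M[OF quadratic_closed _ e])
  fix i assume i: "i \<in> {1..n + m}"
  let ?A = "{y \<in> carrier R. y \<otimes> X i = X i \<otimes> y}"
  have A: "subring ?A R" using i by (intro centralizer_subring) auto
  have "quadratic c \<in> ?A"
  proof (rule quadratic_subring[OF A])
    fix p r assume pr: "p \<in> odds" "r \<in> odds" "c p r \<noteq> 0"
    show "theta p r \<in> ?A"
      using theta_commute_X[OF pr(1,2) b[OF pr] i] theta_closed[OF pr(1,2)] by simp
  qed
  then show "X i \<otimes> quadratic c = quadratic c \<otimes> X i" by simp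
qed

lemma quadratic_in_subring:
  assumes A: "subring A R" "\<And>a. qp a \<in> A" "\<And>p. p \<in> odds \<Longrightarrow> X p \<in> A"
  shows "quadratic c \<in> A"
  by (rule quadratic_subring[OF A(1)]) (simp add: theta_def A(2,3) subringE(6)[OF A(1)])

text \<open>
  If the four indices are not distinct, both products contain the square of an odd variable. If they are
  distinct, the four balance conditions force all values of the form on these indices to vanish, and
  the variables anticommute strictly.
\<close>

lemma theta_theta_swap:
  assumes p: "p \<in> odds" "p' \<in> odds" and r: "r \<in> odds" "r' \<in> odds"
    and d: "p \<noteq> r" "p \<noteq> r'" "p' \<noteq> r" "p' \<noteq> r'"
    and b: "balanced p r" "balanced p r'" "balanced p' r" "balanced p' r'"
  shows "theta p r \<otimes> theta p' r' = \<ominus> (theta p' r \<otimes> theta p r')"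
proof -
  have in1: "p \<in> {1..n + m}" "p' \<in> {1..n + m}" "r \<in> {1..n + m}" "r' \<in> {1..n + m}"
    using p r by (auto simp: odd_vertices_def)
  note [simp] = X_odd_closed[OF p(1)] X_odd_closed[OF p(2)] X_odd_closed[OF r(1)] X_odd_closed[OF r(2)]
  have tX: "theta p r \<otimes> X i = X i \<otimes> theta p r" "theta p' r \<otimes> X i = X i \<otimes> theta p' r"
     "theta p r' \<otimes> X i = X i \<otimes> theta p r'" "theta p' r' \<otimes> X i = X i \<otimes> theta p' r'"
    if "i \<in> {1..n + m}" for i using theta_commute_X p r b that by simp_all
  have tl: "X a \<otimes> theta a c = \<zero>" "theta a c \<otimes> X c = \<zero>"
    if "a \<in> odds" "c \<in> odds" for a c
  proof -
    note [simp] = X_odd_closed[OF that(1)] X_odd_closed[OF that(2)]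
    have "X a \<otimes> (X a \<otimes> X c) = \<zero>" using that by (simp add: odd_square flip: m_assoc)
    then show "X a \<otimes> theta a c = \<zero>" by (simp add: theta_def qp_swap[of "X a" "X a \<otimes> X c"])
    have "(X a \<otimes> X c) \<otimes> X c = \<zero>" using that by (simp add: odd_square m_assoc)
    then show "theta a c \<otimes> X c = \<zero>" by (simp add: theta_def m_assoc[of "qp (- \<Lambda> a c)"])
  qed
  consider "p = p'" | "r = r'" | "p \<noteq> p'" "r \<noteq> r'" by blast
  then show ?thesis
  proof cases
    case 1
    have "theta p r \<otimes> theta p r' = \<zero>"
    proof -
      have "theta p r \<otimes> theta p r' = qp (- \<Lambda> p r') \<otimes> ((theta p r \<otimes> X p) \<otimes> X r')"
        using p r unfolding theta_def[of p r'] by (simp add: qp_swap[of "theta p r"] m_assoc)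
      then show ?thesis using tX(1)[OF in1(1)] tl(1)[OF p(1) r(1)] by simp
    qed
    then show ?thesis using 1 by simp
  next
    case 2
    have z: "theta a r \<otimes> theta b r = \<zero>" if "a \<in> {p, p'}" "b \<in> {p, p'}" for a b
    proof -
      have ab: "a \<in> odds" "b \<in> odds" using that p by auto
      have "theta a r \<otimes> theta b r = qp (- \<Lambda> b r) \<otimes> ((theta a r \<otimes> X b) \<otimes> X r)"
        using ab r unfolding theta_def[of b r] by (simp add: qp_swap[of "theta a r"] m_assoc)
      also have "theta a r \<otimes> X b = X b \<otimes> theta a r" using that in1 tX(1,2) by auto
      finally show ?thesis using ab r tl(2)[of a r] by (simp add: m_assoc)
    qed
    then show ?thesis using 2 by simp
  next
    case 3
    have sk: "\<Lambda> b a = - \<Lambda> a b" if "a \<in> {1..n + m}" "b \<in> {1..n + m}" for a b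
      using skew that unfolding skew_symmetric_def by blast
    have bal: "\<Lambda> i a = - \<Lambda> i b"
      if "balanced a b" "i \<in> {1..n + m}" "i \<noteq> a" "i \<noteq> b" for i a b
      using that unfolding balanced_def by blast
    have e: "\<Lambda> p' p = - \<Lambda> p' r" "\<Lambda> p' p = - \<Lambda> p' r'" "\<Lambda> p p' = - \<Lambda> p r" "\<Lambda> p p' = - \<Lambda> p r'"
      "\<Lambda> r' p = - \<Lambda> r' r" "\<Lambda> r p = - \<Lambda> r r'" "\<Lambda> r' p' = - \<Lambda> r' r" "\<Lambda> r p' = - \<Lambda> r r'"
      using 3 d by (intro bal b in1; metis)+
    have z: "\<Lambda> p r = 0" "\<Lambda> p' r' = 0" "\<Lambda> p' r = 0" "\<Lambda> p r' = 0" "\<Lambda> p p' = 0"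
      using e sk[OF in1(1,2)] sk[OF in1(1,3)] sk[OF in1(1,4)] sk[OF in1(2,3)] sk[OF in1(2,4)]
        sk[OF in1(3,4)] by linarith+
    have "theta p r \<otimes> theta p' r' = (X p \<otimes> X r) \<otimes> (X p' \<otimes> X r')"
      by (simp add: theta_def z)
    also have "\<dots> = X p \<otimes> (X r \<otimes> X p') \<otimes> X r'" by (simp add: m_assoc)
    also have "X r \<otimes> X p' = \<ominus> (X p' \<otimes> X r)"
      using odd_anticommute[OF r(1) p(2)] skew_odd[OF p(2) r(1)] z by simp
    also have "X p \<otimes> (\<ominus> (X p' \<otimes> X r)) \<otimes> X r' = \<ominus> ((X p \<otimes> X p') \<otimes> X r \<otimes> X r')"
      by (simp add: r_minus l_minus m_assoc)
    also have "X p \<otimes> X p' = \<ominus> (X p' \<otimes> X p)"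
      using odd_anticommute[OF p(1) p(2)] z by simp
    also have "\<ominus> (\<ominus> (X p' \<otimes> X p) \<otimes> X r \<otimes> X r') = X p' \<otimes> (X p \<otimes> X r) \<otimes> X r'"
      by (simp add: r_minus l_minus m_assoc)
    also have "X p \<otimes> X r = \<ominus> (X r \<otimes> X p)"
      using odd_anticommute[OF p(1) r(1)] z by simp
    also have "X p' \<otimes> (\<ominus> (X r \<otimes> X p)) \<otimes> X r' = \<ominus> ((X p' \<otimes> X r) \<otimes> (X p \<otimes> X r'))"
      by (simp add: r_minus l_minus m_assoc)
    also have "\<dots> = \<ominus> (theta p' r \<otimes> theta p r')" by (simp add: theta_def z)
    finally show ?thesis .
  qed
qed

text \<open>
  For coefficients of rank one the summands of the square at \<open>((p, r), (p', r'))\<close> and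
  \<open>((p', r), (p, r'))\<close> have the same coefficient and opposite values, so that the square equals its own negative.
\<close>

lemma quadratic_square:
  assumes c: "\<And>p r. p \<in> odds \<Longrightarrow> r \<in> odds \<Longrightarrow> c p r = \<alpha> p * \<beta> r"
    and dis: "\<And>p. \<alpha> p \<noteq> 0 \<Longrightarrow> \<beta> p = 0"
    and b: "\<And>p r. p \<in> odds \<Longrightarrow> r \<in> odds \<Longrightarrow> \<alpha> p \<noteq> 0 \<Longrightarrow> \<beta> r \<noteq> 0 \<Longrightarrow> balanced p r"
  shows "quadratic c \<otimes> quadratic c = \<zero>"
proof -
  let ?S = "odds \<times> odds"
  define T where "T = (\<lambda>(p, r). add_pow R (c p r) (theta p r))"
  have T: "T x \<in> carrier R" if "x \<in> ?S" for x using that by (auto simp: T_def)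
  have N: "quadratic c = finsum R T ?S" by (simp add: quadratic_def T_def)
  let ?f = "\<lambda>(x, y). T x \<otimes> T y"
  \<comment> \<open>the involution that pairs summands of opposite sign\<close>
  let ?h = "\<lambda>((p, r), (p', r')). ((p', r), (p, r'))"
  have fc: "?f z \<in> carrier R" if "z \<in> ?S \<times> ?S" for z using that T by auto
  have "quadratic c \<otimes> quadratic c = (\<Oplus>x\<in>?S. \<Oplus>y\<in>?S. ?f (x, y))"
  proof -
    have "quadratic c \<otimes> quadratic c = (\<Oplus>x\<in>?S. T x \<otimes> finsum R T ?S)" unfolding N
      using T by (intro finsum_ldistr) auto
    also have "\<dots> = (\<Oplus>x\<in>?S. \<Oplus>y\<in>?S. ?f (x, y))"
      using T by (intro finsum_cong') (auto simp: finsum_rdistr Pi_def)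
    finally show ?thesis .
  qed
  also have "\<dots> = finsum R ?f (?S \<times> ?S)"
    using T by (intro finsum_Times[symmetric]) auto
  finally have NN: "quadratic c \<otimes> quadratic c = finsum R ?f (?S \<times> ?S)" .
  have im: "?h ` (?S \<times> ?S) = ?S \<times> ?S" by force
  have "finsum R ?f (?S \<times> ?S) = finsum R ?f (?h ` (?S \<times> ?S))" by (simp only: im)
  also have "\<dots> = (\<Oplus>z\<in>?S \<times> ?S. ?f (?h z))"
    by (intro finsum_reindex) (use fc im in \<open>auto simp: inj_on_def Pi_def\<close>)
  also have "\<dots> = (\<Oplus>z\<in>?S \<times> ?S. \<ominus> ?f z)"
  proof (intro finsum_cong' refl)
    fix z assume "z \<in> ?S \<times> ?S"
    then obtain p r p' r' where z: "z = ((p, r), (p', r'))" and o: "p \<in> odds" "p' \<in> odds"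
      "r \<in> odds" "r' \<in> odds" by auto
    have "?f z = add_pow R (c p r * c p' r') (theta p r \<otimes> theta p' r')"
      using o by (simp add: z T_def add_pow_mult)
    moreover have "?f (?h z) = add_pow R (c p' r * c p r') (theta p' r \<otimes> theta p r')"
      using o by (simp add: z T_def add_pow_mult)
    moreover have "c p' r * c p r' = c p r * c p' r'" using o by (simp add: c)
    moreover have "theta p r \<otimes> theta p' r' = \<ominus> (theta p' r \<otimes> theta p r')" if "c p r * c p' r' \<noteq> 0"
    proof -
      have nz: "\<alpha> p \<noteq> 0" "\<alpha> p' \<noteq> 0" "\<beta> r \<noteq> 0" "\<beta> r' \<noteq> 0" using that o by (auto simp: c)
      then show ?thesis using dis by (intro theta_theta_swap o b) auto
    qed
    ultimately show "?f (?h z) = \<ominus> ?f z" using o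
      by (cases "c p r * c p' r' = 0") (auto simp only: add_pow_int_zero minus_zero, simp_all add: add.int_pow_inv)
  qed (use fc in auto)
  also have "\<dots> = \<ominus> finsum R ?f (?S \<times> ?S)"
    using fc by (intro finsum_neg) auto
  finally show ?thesis unfolding NN using fc by (intro antisymmetric_zero finsum_closed) auto
qed

end

lemma (in two_frames) quadratic_agree:
  assumes "\<And>p. p \<in> odd_vertices n m \<Longrightarrow> M' (unit_vec p) = M (unit_vec p)"
  shows "F2.quadratic c = F1.quadratic c"
proof -
  have "F2.theta p r = F1.theta p r" if "p \<in> odd_vertices n m" "r \<in> odd_vertices n m" for p r
  proof (cases "p = r")
    case False
    have "\<Lambda>' p r = \<Lambda> p r" using that False assms
      by (intro forms_agree) (auto simp: odd_vertices_def)
    then show ?thesis using that assms by (simp add: F1.theta_def F2.theta_def)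
  qed (use that in \<open>simp add: F1.theta_self F2.theta_self\<close>)
  then show ?thesis unfolding F1.quadratic_def F2.quadratic_def by (intro F1.finsum_cong') auto
qed

section \<open>Seeds and exchange relations\<close>

text \<open>
  The flag selects the incoming or outgoing exponent. It allows the two possible orientations between
  adjacent vertices to be treated by one argument.
\<close>

definition exchange_vec :: "bool \<Rightarrow> nat \<Rightarrow> ext_quiver \<Rightarrow> nat \<Rightarrow> zvec"
  where "exchange_vec \<sigma> n Q k = (if \<sigma> then exchange_in n Q k else exchange_out n Q k)"

lemma lookup_exchange_vec:
  "lookup (exchange_vec \<sigma> n Q k) i =
    (if i \<in> {1..n} then max 0 (if \<sigma> then exchange_entry Q i k else - exchange_entry Q i k) else 0)
    - (if i = k then 1 else 0)"
proof -
  have 1: "(\<Sum>x\<in>{i \<in> {1..n}. 0 < exchange_entry Q i k}.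
      lookup (Poly_Mapping.single x (exchange_entry Q x k)) i) =
      (if i \<in> {1..n} then max 0 (exchange_entry Q i k) else 0)"
    unfolding lookup_single when_def by (subst sum.delta) auto
  have 2: "(\<Sum>x\<in>{i \<in> {1..n}. exchange_entry Q i k < 0}.
      lookup (Poly_Mapping.single x (exchange_entry Q x k)) i) =
      (if i \<in> {1..n} then min 0 (exchange_entry Q i k) else 0)"
    unfolding lookup_single when_def by (subst sum.delta) auto
  have i: "lookup (exchange_in n Q k) i = (if i \<in> {1..n} then max 0 (exchange_entry Q i k) else 0)
      - (if i = k then 1 else 0)"
    unfolding exchange_in_def lookup_add lookup_sum 1 by (simp add: lookup_single when_def)
  have o: "lookup (exchange_out n Q k) i = - (if i \<in> {1..n} then min 0 (exchange_entry Q i k) else 0)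
      - (if i = k then 1 else 0)"
    unfolding exchange_out_def lookup_minus lookup_sum 2 by (simp add: lookup_single when_def)
  show ?thesis
  proof (cases \<sigma>)
    case True then show ?thesis by (simp only: exchange_vec_def if_True i)
  next
    case False then show ?thesis by (simp only: exchange_vec_def if_False o) (auto simp: max_def min_def)
  qed
qed

lemma exchange_vec_even [simp]: "k \<in> {1..n} \<Longrightarrow> exchange_vec \<sigma> n Q k \<in> even_sublattice n m"
  by (rule even_sublatticeI) (auto simp: lookup_exchange_vec)

lemma exchange_entry_skew: "exchange_entry Q j i = - exchange_entry Q i j"
  by (simp add: exchange_entry_def)

lemma (in ring) square_zero_power:
  assumes x: "x \<in> carrier R" and x2: "x \<otimes> x = \<zero>"
  shows "(\<one> \<oplus> x) [^] (b :: nat) = \<one> \<oplus> add_pow R b x"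
proof (induction b)
  case (Suc b)
  have z: "add_pow R b x \<otimes> x = \<zero>" using x x2 by (simp add: add_pow_ldistr)
  have "(\<one> \<oplus> x) [^] Suc b = (\<one> \<oplus> add_pow R b x) \<otimes> (\<one> \<oplus> x)" using Suc by simp
  also have "\<dots> = (\<one> \<oplus> add_pow R b x) \<oplus> (x \<oplus> add_pow R b x \<otimes> x)"
    using x by (simp add: r_distr l_distr)
  also have "\<dots> = \<one> \<oplus> add_pow R (Suc b) x" using x by (simp add: z a_assoc)
  finally show ?case .
qed (use x in simp)

locale super_seed = super_frame R qp n m \<Lambda> M
  for R :: "('a, 'b) ring_scheme" (structure) and qp n m \<Lambda> M +
  fixes l :: nat and Q :: ext_quiver
  assumes l_le_n: "l \<le> n" and extended: "extended_quiver n m Q"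
    and compatible: "compatible_pair n m l \<Lambda> Q"
begin

lemma mutable_even: "k \<in> {1..l} \<Longrightarrow> k \<in> {1..n}"
  using l_le_n by auto

abbreviation vec :: "bool \<Rightarrow> nat \<Rightarrow> zvec" where "vec \<sigma> k \<equiv> exchange_vec \<sigma> n Q k"

lemma vec_exponents [simp]: "k \<in> {1..n} \<Longrightarrow> vec \<sigma> k \<in> exponents n m"
  by (rule even_sublattice_exponents) simp

text \<open>
  Compatibility says that \<open>form (b\<^sup>j)\<close>, for the \<open>j\<close>-th column \<open>b\<^sup>j\<close> of the exchange matrix, is a positive
  multiple of the \<open>j\<close>-th coordinate; \<open>b\<^sup>j\<close> is the difference of the two exchange exponents.
\<close>

lemma form_exchange:
  "\<exists>d. \<forall>j\<in>{1..l}. d j > (0 :: int) \<and> (\<forall>c. form (vec True j - vec False j) c = d j * lookup c j)"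
proof -
  obtain d where d: "\<forall>j\<in>{1..l}. d j > (0 :: int)"
    "\<forall>j\<in>{1..l}. \<forall>i\<in>{1..n + m}. (\<Sum>s\<in>{1..n}. exchange_entry Q s j * \<Lambda> s i) = (if i = j then d j else 0)"
    using compatible unfolding compatible_pair_def by blast
  have "form (vec True j - vec False j) c = d j * lookup c j" if j: "j \<in> {1..l}" for j c
  proof -
    have v: "lookup (vec True j - vec False j) s = (if s \<in> {1..n} then exchange_entry Q s j else 0)" for s
      by (auto simp: lookup_minus lookup_exchange_vec)
    have "form (vec True j - vec False j) c = (\<Sum>s\<in>{1..n + m}. \<Sum>i\<in>{1..n + m}.
        (if s \<in> {1..n} then exchange_entry Q s j else 0) * \<Lambda> s i * lookup c i)"
      unfolding bilin_form_def v ..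
    also have "\<dots> = (\<Sum>s\<in>{1..n}. \<Sum>i\<in>{1..n + m}. exchange_entry Q s j * \<Lambda> s i * lookup c i)"
      by (intro sum.mono_neutral_cong_right) auto
    also have "\<dots> = (\<Sum>i\<in>{1..n + m}. (\<Sum>s\<in>{1..n}. exchange_entry Q s j * \<Lambda> s i) * lookup c i)"
      by (subst sum.swap) (simp add: sum_distrib_right)
    also have "\<dots> = (\<Sum>i\<in>{1..n + m}. if i = j then d j * lookup c j else 0)"
      using d(2) j by (intro sum.cong) auto
    also have "\<dots> = d j * lookup c j" using j l_le_n by (simp add: sum.delta')
    finally show ?thesis .
  qed
  then show ?thesis using d(1) by blast
qed

text \<open>
  Hence the two exchange exponents of \<open>x\<^sub>j\<close> commute in the same way with every monomial that does not
  involve \<open>X j\<close>.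
\<close>

lemma form_vec_eq:
  assumes "j \<in> {1..l}" "lookup c j = 0"
  shows "form (vec \<sigma> j) c = form (vec \<sigma>' j) c" "form c (vec \<sigma> j) = form c (vec \<sigma>' j)"
proof -
  have "form (vec True j - vec False j) c = 0" using form_exchange assms by fastforce
  then have "form (vec True j) c = form (vec False j) c" by (simp add: bilin_form_linear)
  then show 1: "form (vec \<sigma> j) c = form (vec \<sigma>' j) c" by (cases \<sigma>; cases \<sigma>') auto
  then show "form c (vec \<sigma> j) = form c (vec \<sigma>' j)"
    using form_skew[of c "vec \<sigma> j"] form_skew[of c "vec \<sigma>' j"] by simp
qed

definition N :: "nat \<Rightarrow> 'a" where "N k = quadratic (\<lambda>p r. int (two_paths Q k p r))"

lemma N_closed [simp]: "N k \<in> carrier R" by (simp add: N_def)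

lemma extended_at:
  assumes "k \<in> {1..n}"
  shows "odd_in Q k \<subseteq> odds \<and> odd_out Q k \<subseteq> odds \<and> odd_in Q k \<inter> odd_out Q k = {} \<and>
    (\<exists>\<alpha> \<beta>. (\<forall>p. \<alpha> p > (0 :: nat) \<longleftrightarrow> p \<in> odd_in Q k) \<and> (\<forall>r. \<beta> r > (0 :: nat) \<longleftrightarrow> r \<in> odd_out Q k) \<and>
      (\<forall>p r. two_paths Q k p r = \<alpha> p * \<beta> r))"
  by (rule bspec[OF extended[unfolded extended_quiver_def, THEN conjunct2, THEN conjunct2,
        THEN conjunct2] assms])

lemma two_paths_pos:
  assumes "k \<in> {1..n}"
  shows "two_paths Q k p r > 0 \<longleftrightarrow> p \<in> odd_in Q k \<and> r \<in> odd_out Q k"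
proof -
  obtain \<alpha> \<beta> where ab: "\<And>p. \<alpha> p > (0 :: nat) \<longleftrightarrow> p \<in> odd_in Q k" "\<And>r. \<beta> r > (0 :: nat) \<longleftrightarrow> r \<in> odd_out Q k"
    "\<And>p r. two_paths Q k p r = \<alpha> p * \<beta> r"
    using extended_at[OF assms] by blast
  show ?thesis unfolding ab(3) using ab(1)[of p] ab(2)[of r] by simp
qed

lemma odd_in_out:
  assumes "k \<in> {1..n}"
  shows "odd_in Q k \<subseteq> odds" "odd_out Q k \<subseteq> odds" "odd_in Q k \<inter> odd_out Q k = {}"
  using extended_at[OF assms] by simp_all

lemma two_paths_balanced:
  assumes k: "k \<in> {1..n}" and pos: "two_paths Q k p r > 0"
  shows "balanced p r"
proof -
  have "p \<in> odds" "r \<in> odds"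
    using two_paths_pos[OF k] pos odd_in_out[OF k] by blast+
  then show ?thesis unfolding balanced_def
    using compatible k pos unfolding compatible_pair_def by blast
qed

lemma N_commute_M: "k \<in> {1..n} \<Longrightarrow> e \<in> exponents n m \<Longrightarrow> M e \<otimes> N k = N k \<otimes> M e"
  unfolding N_def by (rule quadratic_commute_M) (auto intro: two_paths_balanced)

lemma N_square: assumes k: "k \<in> {1..n}" shows "N k \<otimes> N k = \<zero>"
proof -
  obtain \<alpha> \<beta> where ab: "\<And>p. \<alpha> p > (0 :: nat) \<longleftrightarrow> p \<in> odd_in Q k" "\<And>r. \<beta> r > (0 :: nat) \<longleftrightarrow> r \<in> odd_out Q k"
    "\<And>p r. two_paths Q k p r = \<alpha> p * \<beta> r"
    using extended_at[OF k] by blast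
  show ?thesis unfolding N_def
  proof (rule quadratic_square[where \<alpha> = "\<lambda>p. int (\<alpha> p)" and \<beta> = "\<lambda>p. int (\<beta> p)"])
    show "int (\<beta> p) = 0" if "int (\<alpha> p) \<noteq> 0" for p using that ab(1)[of p] ab(2)[of p] odd_in_out(3)[OF k] by auto
    show "balanced p r" if "int (\<alpha> p) \<noteq> 0" "int (\<beta> r) \<noteq> 0" for p r
      using that by (intro two_paths_balanced[OF k]) (simp add: ab(3))
  qed (simp add: ab(3))
qed

lemma N_sum:
  assumes k: "k \<in> {1..n}"
  shows "N k = finsum R (\<lambda>(p, r). add_pow R ((- 1) ^ tau n (unit_vec p) (unit_vec r) *
    int (two_paths Q k p r)) (M (unit_vec p + unit_vec r))) (odd_in Q k \<times> odd_out Q k)"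
proof -
  have sub: "odd_in Q k \<subseteq> odds" "odd_out Q k \<subseteq> odds" "odd_in Q k \<inter> odd_out Q k = {}"
    by (rule odd_in_out[OF k])+
  show ?thesis unfolding N_def quadratic_def
  proof (rule add.finprod_mono_neutral_cong_right)
    fix x assume "x \<in> odds \<times> odds - odd_in Q k \<times> odd_out Q k"
    then have "two_paths Q k (fst x) (snd x) = 0" using two_paths_pos[OF k, of "fst x" "snd x"] by auto
    then show "(case x of (p, r) \<Rightarrow> add_pow R (int (two_paths Q k p r)) (theta p r)) = \<zero>"
      by (simp add: case_prod_beta)
  next
    fix x assume "x \<in> odd_in Q k \<times> odd_out Q k"
    then obtain p r where x: "x = (p, r)" "p \<in> odds" "r \<in> odds" "p \<noteq> r" using sub by blast
    show "(case x of (p, r) \<Rightarrow> add_pow R (int (two_paths Q k p r)) (theta p r)) =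
      (case x of (p, r) \<Rightarrow> add_pow R ((- 1) ^ tau n (unit_vec p) (unit_vec r) *
        int (two_paths Q k p r)) (M (unit_vec p + unit_vec r)))"
      using theta_eq[OF x(2-4)] by (simp add: x(1))
  qed (use sub in auto)
qed

text \<open>
  The coefficients of the two exchange monomials; only the incoming one is affected by odd vertices.
\<close>

definition nu :: "bool \<Rightarrow> nat \<Rightarrow> 'a" where "nu \<sigma> k = (if \<sigma> then \<one> \<oplus> N k else \<one>)"
definition nu_inv :: "bool \<Rightarrow> nat \<Rightarrow> 'a" where "nu_inv \<sigma> k = (if \<sigma> then \<one> \<oplus> \<ominus> N k else \<one>)"

lemma nu_closed [simp]: "nu \<sigma> k \<in> carrier R" "nu_inv \<sigma> k \<in> carrier R"
  by (auto simp: nu_def nu_inv_def)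

lemma nu_inverse: "k \<in> {1..n} \<Longrightarrow> nu \<sigma> k \<otimes> nu_inv \<sigma> k = \<one>" "k \<in> {1..n} \<Longrightarrow> nu_inv \<sigma> k \<otimes> nu \<sigma> k = \<one>"
  by (auto simp: nu_def nu_inv_def r_distr l_distr r_minus l_minus N_square a_assoc r_neg l_neg)

lemma nu_commute_M:
  assumes "k \<in> {1..n}" "e \<in> exponents n m"
  shows "M e \<otimes> nu \<sigma> k = nu \<sigma> k \<otimes> M e" "M e \<otimes> nu_inv \<sigma> k = nu_inv \<sigma> k \<otimes> M e"
  using assms by (auto simp: nu_def nu_inv_def r_distr l_distr r_minus l_minus N_commute_M)

definition exchange_term :: "bool \<Rightarrow> nat \<Rightarrow> 'a" where "exchange_term \<sigma> k = M (vec \<sigma> k) \<otimes> nu \<sigma> k"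

lemma exchange_term_closed [simp]: "k \<in> {1..n} \<Longrightarrow> exchange_term \<sigma> k \<in> carrier R"
  by (simp add: exchange_term_def)

definition mutated :: "nat \<Rightarrow> 'a" where "mutated k = mutated_variable n R k M Q"

text \<open>
  The monomials with odd factors are \<open>M (exchange_in n Q k)\<close> times multiples of \<open>theta p r\<close>: no power of \<open>q\<close>
  appears because the ends of a 2-path are balanced.
\<close>

lemma mutated_eq: assumes k: "k \<in> {1..n}" shows "mutated k = exchange_term \<sigma> k \<oplus> exchange_term (\<not> \<sigma>) k"
proof -
  have sub: "odd_in Q k \<subseteq> odds" "odd_out Q k \<subseteq> odds" "odd_in Q k \<inter> odd_out Q k = {}"
    by (rule odd_in_out[OF k])+
  let ?w = "exchange_in n Q k"
  have w: "?w = vec True k" by (simp add: exchange_vec_def)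
  have wE: "?w \<in> evens" "?w \<in> exponents n m" using k by (simp_all add: w)
  let ?z = "\<lambda>p r. (- 1) ^ tau n (unit_vec p) (unit_vec r) * int (two_paths Q k p r)"
  let ?f = "\<lambda>(p, r). add_pow R (?z p r) (M (unit_vec p + unit_vec r))"
  have io: "i \<in> {1..n + m}" if "i \<in> odds" for i using that by (auto simp: odd_vertices_def)
  have pr: "unit_vec p + unit_vec r \<in> exponents n m" if "p \<in> odd_in Q k" "r \<in> odd_out Q k" for p r
    using that sub by (intro unit_vec_add_exponents io) auto
  have prw: "M (?w + unit_vec p + unit_vec r) = M ?w \<otimes> M (unit_vec p + unit_vec r)"
    if p: "p \<in> odd_in Q k" "r \<in> odd_out Q k" for p r
  proof -
    have b: "balanced p r" using p two_paths_pos[OF k] by (intro two_paths_balanced[OF k]) auto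
    have o: "p \<in> {1..n + m}" "r \<in> {1..n + m}" "p > n" "r > n"
      using p sub by (auto simp: odd_vertices_def)
    have "form ?w (unit_vec p + unit_vec r) = (\<Sum>s\<in>{1..n + m}. lookup ?w s * (\<Lambda> s p + \<Lambda> s r))"
      using o by (simp add: bilin_form_add_right bilin_form_single_right algebra_simps sum.distrib)
    also have "\<dots> = 0"
    proof (intro sum.neutral ballI)
      fix s assume s: "s \<in> {1..n + m}"
      show "lookup ?w s * (\<Lambda> s p + \<Lambda> s r) = 0"
      proof (cases "s \<le> n")
        case True
        then have "\<Lambda> s p = - \<Lambda> s r" using b s o unfolding balanced_def by auto
        then show ?thesis by simp
      qed (use even_sublattice_lookup[OF wE(1)] in auto)
    qed
    finally show ?thesis using M_mult_even_left[OF wE(1) pr[OF p]] 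
        even_add_exponents(1)[OF wE(1) pr[OF p]] by (simp add: add.assoc)
  qed
  have fc: "?f \<in> odd_in Q k \<times> odd_out Q k \<rightarrow> carrier R" using pr by auto
  have "finsum R (\<lambda>(p, r). add_pow R (?z p r) (M (?w + unit_vec p + unit_vec r)))
      (odd_in Q k \<times> odd_out Q k) = (\<Oplus>x\<in>odd_in Q k \<times> odd_out Q k. M ?w \<otimes> ?f x)"
    using wE(2) pr by (intro finsum_cong') (auto simp: prw add_pow_rdistr_int)
  also have "\<dots> = M ?w \<otimes> N k" unfolding N_sum[OF k]
    using finite_subset[OF sub(1)] finite_subset[OF sub(2)] wE(2) fc by (intro finsum_rdistr[symmetric]) auto
  finally have "mutated k = M ?w \<oplus> M (vec False k) \<oplus> M ?w \<otimes> N k"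
    by (simp add: mutated_def mutated_variable_def exchange_vec_def)
  also have "\<dots> = exchange_term True k \<oplus> exchange_term False k"
    using k wE(2) by (simp add: exchange_term_def nu_def w r_distr a_ac)
  finally show ?thesis using k by (cases \<sigma>) (auto simp: a_comm)
qed

lemma mutated_closed [simp]: "k \<in> {1..n} \<Longrightarrow> mutated k \<in> carrier R"
  using mutated_eq[of k True] by simp

lemma exchange_term_comm_deg:
  assumes k: "k \<in> {1..n}" and c: "c \<in> evens"
  shows "comm_deg (M c) (2 * form c (vec \<sigma> k)) (exchange_term \<sigma> k)"
proof -
  have ce: "c \<in> exponents n m" using c by (rule even_sublattice_exponents)
  have "comm_deg (M c) 0 (nu \<sigma> k)" using nu_commute_M[OF k ce] ce by (simp add: comm_deg_def)
  then show ?thesis unfolding exchange_term_def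
    using comm_deg_mult[OF _ M_comm_deg[OF c vec_exponents[OF k]]] ce by fastforce
qed

lemma mutated_comm_deg:
  assumes k: "k \<in> {1..l}" and c: "c \<in> evens" and "lookup c k = 0"
  shows "comm_deg (M c) (2 * form c (vec \<sigma> k)) (mutated k)"
proof -
  have k': "k \<in> {1..n}" using k by (rule mutable_even)
  have "comm_deg (M c) (2 * form c (vec \<sigma> k)) (exchange_term (\<not> \<sigma>) k)"
    using exchange_term_comm_deg[OF k' c, of "\<not> \<sigma>"] form_vec_eq(2)[OF k assms(3), of "\<not> \<sigma>" \<sigma>] by simp
  then show ?thesis unfolding mutated_eq[OF k', of \<sigma>]
    using exchange_term_comm_deg[OF k' c] even_sublattice_exponents[OF c] by (intro comm_deg_add) auto
qed

section \<open>Laurent rings and the rings of neighbouring seeds\<close>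

definition laurent :: "'a set"
  where "laurent = generate_ring R (range qp \<union> M ` exponents n m)"

text \<open>
  Generators of the ring in which \<open>mutated j\<close> takes the place of the inverse of \<open>X j\<close>.
\<close>

definition upper_gens :: "nat \<Rightarrow> 'a set"
  where "upper_gens j = range qp \<union> M ` {c \<in> exponents n m. lookup c j \<ge> 0} \<union> {mutated j}"

definition upper :: "nat \<Rightarrow> 'a set" where "upper j = generate_ring R (upper_gens j)"

lemma laurent_subring: "subring laurent R"
  unfolding laurent_def by (rule generate_ring_is_subring) auto

lemma upper_gens_carrier: "j \<in> {1..n} \<Longrightarrow> upper_gens j \<subseteq> carrier R"
  unfolding upper_gens_def by auto

lemma upper_subring: "j \<in> {1..n} \<Longrightarrow> subring (upper j) R"
  unfolding upper_def by (intro generate_ring_is_subring upper_gens_carrier)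

lemma qp_laurent [simp]: "qp a \<in> laurent"
  unfolding laurent_def by (rule generate_ring.incl) auto

lemma M_laurent [simp]: "c \<in> exponents n m \<Longrightarrow> M c \<in> laurent"
  unfolding laurent_def by (rule generate_ring.incl) auto

lemma qp_upper [simp]: "qp a \<in> upper j"
  unfolding upper_def upper_gens_def by (rule generate_ring.incl) auto

lemma M_upper: "c \<in> exponents n m \<Longrightarrow> lookup c j \<ge> 0 \<Longrightarrow> M c \<in> upper j"
  unfolding upper_def upper_gens_def by (rule generate_ring.incl) auto

lemma mutated_upper: "mutated j \<in> upper j"
  unfolding upper_def upper_gens_def by (rule generate_ring.incl) auto

lemma N_subring:
  assumes "subring A R" "\<And>a. qp a \<in> A" "\<And>p. p \<in> odds \<Longrightarrow> X p \<in> A"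
  shows "N k \<in> A" "nu \<sigma> k \<in> A" "nu_inv \<sigma> k \<in> A"
proof -
  show "N k \<in> A" unfolding N_def by (rule quadratic_in_subring[OF assms])
  then show "nu \<sigma> k \<in> A" "nu_inv \<sigma> k \<in> A" using assms(1)
    by (auto simp: nu_def nu_inv_def subringE)
qed

lemma nu_upper:
  assumes "j \<in> {1..n}" shows "nu \<sigma> k \<in> upper j" "nu_inv \<sigma> k \<in> upper j"
proof -
  have X: "X p \<in> upper j" if "p \<in> odds" for p
    using that by (intro M_upper) (auto simp: odd_vertices_def lookup_single when_def)
  show "nu \<sigma> k \<in> upper j" "nu_inv \<sigma> k \<in> upper j"
    using N_subring[OF upper_subring[OF assms] qp_upper X] by auto
qed

lemma nu_laurent: "nu \<sigma> k \<in> laurent" "nu_inv \<sigma> k \<in> laurent"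
proof -
  have X: "X p \<in> laurent" if "p \<in> odds" for p
    using that by (intro M_laurent) (auto simp: odd_vertices_def)
  show "nu \<sigma> k \<in> laurent" "nu_inv \<sigma> k \<in> laurent"
    using N_subring[OF laurent_subring qp_laurent X] by auto
qed

lemma exchange_term_laurent: "k \<in> {1..n} \<Longrightarrow> exchange_term \<sigma> k \<in> laurent"
  unfolding exchange_term_def using subringE(6)[OF laurent_subring] nu_laurent by simp

lemma mutated_laurent: "k \<in> {1..n} \<Longrightarrow> mutated k \<in> laurent"
  using mutated_eq[of k True] subringE(7)[OF laurent_subring] exchange_term_laurent by simp

lemma exchange_term_upper:
  assumes "k \<in> {1..n}" "j \<in> {1..n}" "j \<noteq> k" shows "exchange_term \<sigma> k \<in> upper j"
  unfolding exchange_term_def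
  using assms by (intro subringE(6)[OF upper_subring] M_upper nu_upper) (auto simp: lookup_exchange_vec)

lemma mutated_upper_other:
  assumes "k \<in> {1..n}" "j \<in> {1..n}" shows "mutated k \<in> upper j"
proof (cases "j = k")
  case False
  then show ?thesis unfolding mutated_eq[OF assms(1), of True]
    using exchange_term_upper assms by (intro subringE(7)[OF upper_subring]) auto
qed (use mutated_upper in auto)

lemma upper_le_laurent: assumes "j \<in> {1..n}" shows "upper j \<subseteq> laurent"
  unfolding upper_def using assms
  by (intro generate_ring_min_subring1 upper_gens_carrier laurent_subring)
    (auto simp: upper_gens_def mutated_laurent)

text \<open>
  One of the two terms of \<open>mutated k\<close> does not involve \<open>X j\<close>, namely the incoming one unless there are
  arrows \<open>x\<^sub>j \<rightarrow> x\<^sub>k\<close>. That term is a unit of \<open>upper j\<close>.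
\<close>

lemma vec_no_j:
  assumes "j \<in> {1..n}" "j \<noteq> k" "\<sigma> \<longleftrightarrow> arrows Q j k = 0"
  shows "lookup (vec \<sigma> k) j = 0"
proof -
  have "arrows Q j k = 0 \<or> arrows Q k j = 0"
    using extended[unfolded extended_quiver_def, THEN conjunct2, THEN conjunct2, THEN conjunct1] by simp
  then have "(if \<sigma> then exchange_entry Q j k else - exchange_entry Q j k) \<le> 0"
    using assms(3) by (auto simp: exchange_entry_def)
  then show ?thesis using assms(1,2) by (simp only: lookup_exchange_vec) simp
qed

lemma exchange_term_inverse:
  assumes k: "k \<in> {1..n}"
  shows "exchange_term \<sigma> k \<otimes> (nu_inv \<sigma> k \<otimes> M (- vec \<sigma> k)) = \<one>"
proof -
  have c: "M (- vec \<sigma> k) \<in> carrier R"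
    using k by (intro M_closed even_sublattice_exponents) simp
  have "exchange_term \<sigma> k \<otimes> (nu_inv \<sigma> k \<otimes> M (- vec \<sigma> k)) =
      M (vec \<sigma> k) \<otimes> (nu \<sigma> k \<otimes> nu_inv \<sigma> k) \<otimes> M (- vec \<sigma> k)"
    using k c by (simp add: exchange_term_def m_assoc)
  then show ?thesis using k c M_inverse[of "vec \<sigma> k"] by (simp add: nu_inverse)
qed

text \<open>
  Conjugation by \<open>X k\<close> grades \<open>laurent\<close>, and also \<open>upper j\<close>, because the two terms of \<open>mutated j\<close> have
  the same degree. Let \<open>A\<close> be the term of \<open>mutated k\<close> that is a unit of \<open>upper j\<close>, and \<open>B\<close> the other one. Then
  \<open>f (A + B)\<close> lies in \<open>upper j\<close> exactly if \<open>f (1 + B A\<^sup>-\<^sup>1)\<close> does, and \<open>B A\<^sup>-\<^sup>1\<close> has degree \<open>\<plusminus> 2 d\<^sub>k\<close> for the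
  diagonal entry \<open>d\<^sub>k\<close> of compatibility.
\<close>

lemma cancel_mutated:
  assumes k: "k \<in> {1..l}" and j: "j \<in> {1..l}" and jk: "j \<noteq> k"
    and f: "f \<in> laurent" and fm: "f \<otimes> mutated k \<in> upper j"
  shows "f \<in> upper j"
proof -
  have k_even: "k \<in> {1..n}" and jn: "j \<in> {1..n}" using k j mutable_even by auto
  define \<sigma> where "\<sigma> = (arrows Q j k = 0)"
  have v0: "lookup (vec \<sigma> k) j = 0" using vec_no_j[OF jn jk] \<sigma>_def by simp
  have x: "unit_vec k \<in> evens" using k_even by simp
  have xe: "unit_vec k \<in> exponents n m" using x by (rule even_sublattice_exponents)
  have xc: "X k \<in> carrier R" using xe by simp
  let ?A = "exchange_term \<sigma> k" and ?B = "exchange_term (\<not> \<sigma>) k" and ?I = "nu_inv \<sigma> k \<otimes> M (- vec \<sigma> k)"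
  have ve: "- vec \<sigma> k \<in> exponents n m" using k_even by (intro even_sublattice_exponents) simp
  have Ic: "?I \<in> carrier R" using ve by simp
  note sub = upper_subring[OF jn]
  have IU: "?I \<in> upper j" using v0 ve by (intro subringE(6)[OF sub] nu_upper jn M_upper) auto
  have BU: "?B \<in> upper j" by (rule exchange_term_upper[OF k_even jn jk])
  have fc: "f \<in> carrier R" using f subringE(1)[OF laurent_subring] by auto
  let ?e = "\<ominus> (?B \<otimes> ?I)"
  have eU: "?e \<in> upper j" using sub IU BU by (simp add: subringE)
  have "f \<otimes> mutated k \<otimes> ?I = f \<otimes> (?A \<otimes> ?I) \<oplus> f \<otimes> (?B \<otimes> ?I)"
    using fc Ic k_even unfolding mutated_eq[OF k_even, of \<sigma>] by (simp add: m_assoc l_distr r_distr)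
  also have "\<dots> = f \<ominus> f \<otimes> ?e"
    using fc Ic k_even exchange_term_inverse[OF k_even, of \<sigma>] by (simp add: minus_eq r_minus)
  finally have fe: "f \<ominus> f \<otimes> ?e \<in> upper j" using subringE(6)[OF sub fm IU] by simp
  obtain d where d: "\<And>j. j \<in> {1..l} \<Longrightarrow> d j > (0 :: int)"
    "\<And>j c. j \<in> {1..l} \<Longrightarrow> form (vec True j - vec False j) c = d j * lookup c j"
    using form_exchange by blast
  have "form (vec True k - vec False k) (unit_vec k) = d k" using d(2)[OF k] by simp
  then have dv: "form (unit_vec k) (vec True k) - form (unit_vec k) (vec False k) \<noteq> 0"
    using d(1)[OF k] form_skew[of "unit_vec k" "vec True k"] form_skew[of "unit_vec k" "vec False k"]
    by (simp add: bilin_form_diff_left)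
  let ?\<delta> = "2 * form (unit_vec k) (vec (\<not> \<sigma>) k) + (0 + 2 * form (unit_vec k) (- vec \<sigma> k))"
  have \<delta>0: "?\<delta> \<noteq> 0" using dv by (cases \<sigma>) (auto simp: bilin_form_minus_right)
  have "comm_deg (X k) 0 (nu_inv \<sigma> k)"
    using nu_commute_M[OF k_even xe] xc by (simp add: comm_deg_def)
  then have "comm_deg (X k) ?\<delta> (?B \<otimes> ?I)"
    by (intro comm_deg_mult xc exchange_term_comm_deg[OF k_even x] M_comm_deg[OF x ve])
  then have edeg: "comm_deg (X k) ?\<delta> ?e" by (rule comm_deg_neg[OF xc])
  have homM: "\<exists>d. comm_deg (X k) d (M c)" if "c \<in> exponents n m" for c
    using M_comm_deg[OF x that] by blast
  have homq: "\<exists>d. comm_deg (X k) d (qp a)" for a using comm_deg_qp[OF xc] by blast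
  show ?thesis
  proof (rule graded_cancel[OF sub M_Units[OF x] _ _ eU edeg \<delta>0 fe])
    fix a assume a: "a \<in> upper j"
    have "\<exists>d. comm_deg (X k) d (mutated j)"
      using mutated_comm_deg[OF j x, of True] jk by (auto simp: lookup_single when_def)
    then show "graded_in (X k) (upper j) a"
      using homM homq
      by (intro generate_ring_graded[OF xc upper_gens_carrier[OF jn] upper_def _ a])
        (auto simp: upper_gens_def)
  next
    have "graded_in (X k) laurent f"
      using homM homq by (intro generate_ring_graded[OF xc _ laurent_def _ f]) auto
    then show "graded_in (X k) (carrier R) f"
      using subringE(1)[OF laurent_subring] unfolding graded_in_def by (metis comm_deg_carrier)
  qed
qed

text \<open>
  The ring \<open>laurent\<close> is listed separately because without mutable vertices the intersection of the rings
  \<open>upper j\<close> would be everything.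
\<close>

definition upper_bound :: "'a set"
  where "upper_bound = laurent \<inter> (\<Inter>j\<in>{1..l}. upper j)"

lemma cluster_upper_bound: "i \<in> {1..n + m} \<Longrightarrow> X i \<in> upper_bound"
  unfolding upper_bound_def by (auto intro!: M_upper simp: lookup_single when_def)

lemma mutated_upper_bound: "k \<in> {1..l} \<Longrightarrow> mutated k \<in> upper_bound"
  unfolding upper_bound_def using mutated_laurent mutated_upper_other mutable_even by auto

end

section \<open>Invariance of the upper bound under mutation\<close>

lemma (in q_ring) comm_deg_pow_left:
  assumes x: "x \<in> carrier R" and f: "comm_deg x d f"
  shows "comm_deg (x [^] (b :: nat)) (int b * d) f"
proof (induction b)
  case 0 then show ?case using f by (simp add: comm_deg_def)
next
  case (Suc b)
  have fc: "f \<in> carrier R" using f by (rule comm_deg_carrier)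
  have "x [^] Suc b \<otimes> f = x [^] b \<otimes> (x \<otimes> f)" using x fc by (simp add: m_assoc)
  also have "\<dots> = qp d \<otimes> ((x [^] b \<otimes> f) \<otimes> x)"
    using f x fc by (simp add: comm_deg_def qp_swap[of "x [^] b" "f \<otimes> x"] m_assoc)
  also have "\<dots> = qp (d + int b * d) \<otimes> (f \<otimes> x [^] Suc b)"
    using Suc x fc by (simp add: comm_deg_def m_assoc qp_qp)
  finally show ?case using fc by (simp add: comm_deg_def algebra_simps)
qed

lemma mutate_arrows:
  "arrows (mutate_quiver k Q) i j = (if i = k \<or> j = k then arrows Q j i
    else (arrows Q i j + arrows Q i k * arrows Q k j) - (arrows Q j i + arrows Q j k * arrows Q k i))"
  by (simp add: mutate_quiver_def Let_def)

lemma mutate_two_paths: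
  "two_paths (mutate_quiver k Q) j s r = (if j = k then two_paths Q k r s
    else (two_paths Q j s r + arrows Q k j * two_paths Q k s r) -
      (two_paths Q j r s + arrows Q k j * two_paths Q k r s))"
  by (simp add: mutate_quiver_def Let_def)

lemma int_diff_diff: "int (a - b) - int (b - a) = int a - int b"
  by (cases "a \<le> b") auto

lemma mutate_exchange_entry:
  "exchange_entry (mutate_quiver k Q) i j = (if i = k \<or> j = k then - exchange_entry Q i j
    else exchange_entry Q i j + int (arrows Q i k * arrows Q k j) - int (arrows Q j k * arrows Q k i))"
  unfolding exchange_entry_def mutate_arrows by (auto simp: int_diff_diff)

text \<open>
  Reversing the arrows at \<open>x\<^sub>k\<close> exchanges incoming and outgoing exponent.
\<close>

lemma exchange_vec_mutated_self:
  "exchange_vec \<sigma> n (mutate_quiver k Q) k = exchange_vec (\<not> \<sigma>) n Q k"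
  by (rule poly_mapping_eqI) (simp add: lookup_exchange_vec mutate_exchange_entry)

text \<open>
  Both seeds are assumed to be compatible; that the second quiver satisfies the axioms of an extended
  quiver carries essential information about the first one, namely \<open>N j \<otimes> N k = 0\<close> for arrows
  \<open>x\<^sub>k \<rightarrow> x\<^sub>j\<close>.
\<close>

locale super_mutation = S1: super_seed R qp n m \<Lambda> M l Q + S2: super_seed R qp n m \<Lambda>' M' l Q'
  for R :: "('a, 'b) ring_scheme" (structure) and qp n m \<Lambda> M l Q \<Lambda>' M' Q' +
  fixes k :: nat
  assumes k: "k \<in> {1..l}" and Q': "Q' = mutate_quiver k Q"
    and M'_other: "i \<in> {1..n + m} \<Longrightarrow> i \<noteq> k \<Longrightarrow> M' (unit_vec i) = M (unit_vec i)"
    and M'_k: "M' (unit_vec k) = S1.mutated k"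

sublocale super_mutation \<subseteq> two_frames R qp n m \<Lambda> M \<Lambda>' M' ..

context super_mutation
begin

lemma k_even: "k \<in> {1..n}"
  by (rule S1.mutable_even[OF k])

lemma M'_eq_M:
  assumes c: "c \<in> exponents n m" and "lookup c k = 0" shows "M' c = M c"
proof (rule frames_agree[OF c])
  fix i assume "i \<in> keys c"
  then have "lookup c i \<noteq> 0" using in_keys_iff by fast
  then have "i \<in> {1..n + m}" "i \<noteq> k" using exponents_lookup_outside[OF c, of i] assms(2) by force+
  then show "M' (unit_vec i) = M (unit_vec i)" by (rule M'_other)
qed

lemma unit_k [simp]: "unit_vec k \<in> even_sublattice n m"
  using k_even by simp

lemma mutated_Units: "S1.mutated k \<in> Units R"
  using S2.M_Units[OF unit_k] by (simp add: M'_k)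

text \<open>
  The new form is found by commuting \<open>M c\<close> with the new variable, both of whose terms behave alike.
\<close>

lemma form'_k:
  assumes c: "c \<in> even_sublattice n m" and ck: "lookup c k = 0"
  shows "S2.form c (unit_vec k) = S1.form c (exchange_vec \<sigma> n Q k)"
proof -
  let ?z = "S1.mutated k \<otimes> M c"
  have ce: "c \<in> exponents n m" using c by (rule even_sublattice_exponents)
  have zU: "?z \<in> Units R" using mutated_Units S1.M_Units[OF c] by simp
  have "\<one> \<noteq> \<zero>" using S1.M_nonzero[of 0] by (simp add: S1.M_zero)
  then have z0: "?z \<noteq> \<zero>" using zU S1.Units_r_inv by (metis S1.Units_inv_closed S1.l_null)
  have 1: "M c \<otimes> S1.mutated k = qp (2 * S1.form c (exchange_vec \<sigma> n Q k)) \<otimes> ?z"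
    using S1.mutated_comm_deg[OF k c ck, of \<sigma>] by (simp add: S1.comm_deg_def)
  have 2: "M c \<otimes> S1.mutated k = qp (2 * S2.form c (unit_vec k)) \<otimes> ?z"
    using S2.M_comm_deg[OF c even_sublattice_exponents[OF unit_k]] M'_eq_M[OF ce ck]
    by (simp add: S1.comm_deg_def M'_k)
  show ?thesis using S1.qp_regular[of ?z] 1 2 z0 S1.Units_closed[OF zU] by fastforce
qed

lemma quadratic_eq: "S2.quadratic c = S1.quadratic c"
  by (rule quadratic_agree) (use k_even in \<open>auto simp: odd_vertices_def intro!: M'_other\<close>)

lemma N'_k: "S2.N k = \<ominus> S1.N k"
  unfolding S1.N_def S2.N_def quadratic_eq
  by (subst S1.quadratic_swap[symmetric]) (simp add: Q' mutate_two_paths)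

text \<open>
  The truncated subtractions in the mutation of 2-paths are absorbed by antisymmetry.
\<close>

lemma N'_other:
  assumes "j \<noteq> k"
  shows "S2.N j = S1.N j \<oplus> add_pow R (arrows Q k j) (S1.N k)"
proof -
  let ?c = "\<lambda>p r. int (two_paths Q j p r) + int (arrows Q k j) * int (two_paths Q k p r)"
  have "S2.N j = S1.quadratic (\<lambda>p r. int (two_paths Q' j p r))" by (simp add: S2.N_def quadratic_eq)
  also have "\<dots> = S1.quadratic ?c"
    by (rule S1.quadratic_antisymmetrize) (use assms in \<open>auto simp: Q' mutate_two_paths int_diff_diff\<close>)
  also have "\<dots> = S1.N j \<oplus> add_pow R (int (arrows Q k j)) (S1.N k)"
    unfolding S1.N_def by (simp only: S1.quadratic_add S1.quadratic_scale)
  finally show ?thesis by (simp add: add_pow_int_ge)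
qed

lemma N_commute: "i \<in> {1..n} \<Longrightarrow> S1.N i \<otimes> S1.N j = S1.N j \<otimes> S1.N i"
proof -
  assume i: "i \<in> {1..n}"
  have "S1.N j \<in> {y \<in> carrier R. y \<otimes> S1.N i = S1.N i \<otimes> y}"
    using S1.N_commute_M[OF i] S1.qp_central[of "S1.N i"]
    by (intro S1.N_subring(1)[OF S1.centralizer_subring[OF S1.N_closed]]) (auto simp: odd_vertices_def)
  then show ?thesis by simp
qed

text \<open>
  The square of \<open>N j + b N k\<close> is \<open>2 b N j N k\<close>, and it vanishes by \<open>N_square\<close> for the mutated seed.
\<close>

lemma N_N_zero:
  assumes j: "j \<in> {1..n}" "j \<noteq> k" and b: "arrows Q k j > 0"
  shows "S1.N j \<otimes> S1.N k = \<zero>"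
proof -
  let ?b = "arrows Q k j" and ?x = "S1.N j" and ?y = "S1.N k"
  have xy: "?x \<otimes> ?x = \<zero>" "?y \<otimes> ?y = \<zero>" "?y \<otimes> ?x = ?x \<otimes> ?y"
    using S1.N_square[OF j(1)] S1.N_square[OF k_even] N_commute[OF k_even, of j] by auto
  have "\<zero> = (?x \<oplus> add_pow R ?b ?y) \<otimes> (?x \<oplus> add_pow R ?b ?y)"
    using S2.N_square[OF j(1)] by (simp add: N'_other[OF j(2)])
  also have "\<dots> = add_pow R ?b (?x \<otimes> ?y) \<oplus> add_pow R ?b (?x \<otimes> ?y)"
  proof -
    let ?z = "add_pow R ?b ?y"
    have "?x \<otimes> ?z = add_pow R ?b (?x \<otimes> ?y)" "?z \<otimes> ?x = add_pow R ?b (?x \<otimes> ?y)"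
      by (simp_all add: S1.add_pow_ldistr S1.add_pow_rdistr xy(3))
    moreover have "?z \<otimes> ?z = \<zero>" by (simp add: S1.add_pow_ldistr S1.add_pow_rdistr xy(2))
    ultimately show ?thesis by (simp add: S1.l_distr S1.r_distr xy(1))
  qed
  also have "\<dots> = add_pow R (?b + ?b) (?x \<otimes> ?y)"
    by (rule S1.add.nat_pow_mult) simp
  finally have eq: "\<zero> = add_pow R (?b + ?b) (?x \<otimes> ?y)" .
  show ?thesis by (rule S1.torsion_free[OF _ _ eq[symmetric]]) (use b in simp_all)
qed

lemma nu'_k: "S2.nu \<sigma> k = S1.nu_inv \<sigma> k"
  by (simp add: S2.nu_def S1.nu_inv_def N'_k)

text \<open>
  Both sides become equal after multiplication by the unit \<open>mutated k\<close>. The exponents are interchanged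
  by the mutation, but the nilpotent coefficient now sits on the other monomial, with the opposite sign,
  which accounts for the factor \<open>1 - N k\<close>.
\<close>

lemma mutated_twice: "S2.mutated k = M (unit_vec k) \<otimes> S1.nu_inv True k"
proof -
  note uE = even_sublattice_exponents[OF unit_k]
  have Xc: "M (unit_vec k) \<in> carrier R" using uE by simp
  have ex: "S2.exchange_term \<sigma> k \<otimes> S1.mutated k = M (unit_vec k) \<otimes> M (exchange_vec (\<not> \<sigma>) n Q k) \<otimes> S1.nu_inv \<sigma> k"
    for \<sigma>
  proof -
    let ?V = "exchange_vec (\<not> \<sigma>) n Q k"
    define w where "w = ?V + unit_vec k"
    have VE: "?V \<in> even_sublattice n m" using k_even by simp
    have wE: "w \<in> even_sublattice n m" unfolding w_def using VE by simp
    have wk: "lookup w k = 0"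
      using k_even by (simp add: w_def lookup_add lookup_exchange_vec exchange_entry_def)
    have wV: "?V = w - unit_vec k" "w = ?V + unit_vec k" by (simp_all add: w_def)
    have Mw: "M' w = M w" by (rule M'_eq_M[OF even_sublattice_exponents[OF wE] wk])
    have Ve: "?V \<in> exponents n m" using VE by (rule even_sublattice_exponents)
    have cl: "M' ?V \<in> carrier R" "M w \<in> carrier R" "M ?V \<in> carrier R"
      using Ve even_sublattice_exponents[OF wE] by simp_all
    have veq: "exchange_vec \<sigma> n Q' k = ?V" by (simp add: Q' exchange_vec_mutated_self)
    have f: "S2.form ?V (unit_vec k) = S1.form (unit_vec k) ?V"
    proof -
      have "S2.form ?V (unit_vec k) = S2.form w (unit_vec k)"
        using S2.form_self by (simp add: wV(1) bilin_form_linear)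
      also have "\<dots> = S1.form w ?V" by (rule form'_k[OF wE wk])
      also have "\<dots> = S1.form (unit_vec k) ?V"
        using S1.form_self by (simp add: wV(2) bilin_form_linear)
      finally show ?thesis .
    qed
    have "S2.exchange_term \<sigma> k \<otimes> S1.mutated k = M' ?V \<otimes> (S2.nu \<sigma> k \<otimes> M' (unit_vec k))"
      using cl k_even veq by (simp add: S2.exchange_term_def M'_k S1.m_assoc)
    also have "\<dots> = (M' ?V \<otimes> M' (unit_vec k)) \<otimes> S2.nu \<sigma> k"
      using cl uE S2.nu_commute_M(1)[OF k_even uE] by (simp add: S1.m_assoc)
    also have "M' ?V \<otimes> M' (unit_vec k) = qp (S1.form (unit_vec k) ?V) \<otimes> M w"
      using S2.M_mult_even_left[OF VE uE] by (simp add: f Mw flip: w_def)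
    also have "\<dots> = M (unit_vec k) \<otimes> M ?V"
      using S1.M_mult_even_left[OF unit_k Ve] by (simp add: w_def add.commute)
    finally show ?thesis by (simp add: nu'_k)
  qed
  let ?I = "S1.nu_inv True k"
  have VF: "M (exchange_vec False n Q k) = S1.exchange_term False k"
    "M (exchange_vec True n Q k) = S1.exchange_term True k \<otimes> ?I"
    using k_even by (simp_all add: S1.exchange_term_def S1.nu_def[of False] S1.m_assoc S1.nu_inverse)
  have "S2.mutated k \<otimes> S1.mutated k =
      S2.exchange_term True k \<otimes> S1.mutated k \<oplus> S2.exchange_term False k \<otimes> S1.mutated k"
    using k_even by (simp add: S2.mutated_eq[OF k_even, of True] S1.l_distr)
  also have "\<dots> = M (unit_vec k) \<otimes> S1.exchange_term False k \<otimes> ?I \<oplus> M (unit_vec k) \<otimes> (S1.exchange_term True k \<otimes> ?I)"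
    using Xc k_even by (simp add: ex VF S1.nu_inv_def[of False])
  also have "\<dots> = M (unit_vec k) \<otimes> (S1.mutated k \<otimes> ?I)"
    using Xc k_even by (simp add: S1.mutated_eq[OF k_even, of True] S1.l_distr S1.r_distr S1.m_assoc S1.a_comm)
  also have "S1.mutated k \<otimes> ?I = ?I \<otimes> S1.mutated k"
    using S2.nu_commute_M(1)[OF k_even uE, of True] by (simp add: M'_k nu'_k)
  also have "M (unit_vec k) \<otimes> (?I \<otimes> S1.mutated k) = (M (unit_vec k) \<otimes> ?I) \<otimes> S1.mutated k"
    using Xc k_even by (intro S1.m_assoc[symmetric]) simp_all
  finally have eq: "S2.mutated k \<otimes> S1.mutated k = (M (unit_vec k) \<otimes> ?I) \<otimes> S1.mutated k" .
  show ?thesis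
    by (rule S1.Units_right_cancel[OF mutated_Units _ _ eq]) (use Xc k_even in simp_all)
qed

lemma unit_vec_upper: "i \<in> {1..n + m} \<Longrightarrow> M (unit_vec i) \<in> S1.upper j"
  by (intro S1.M_upper) (auto simp: lookup_single when_def)

lemma neg_unit_vec_upper: "i \<in> {1..n} \<Longrightarrow> i \<noteq> j \<Longrightarrow> M (- unit_vec i) \<in> S1.upper j"
  by (intro S1.M_upper even_sublattice_exponents) (auto simp: lookup_single when_def)

lemma M'_upper:
  assumes j: "j \<in> {1..n}" and c: "c \<in> exponents n m" and cj: "lookup c j \<ge> 0" and ck: "lookup c k \<ge> 0"
  shows "M' c \<in> S1.upper j"
proof (rule S2.M_generated[OF S1.upper_subring[OF j] S1.qp_upper c])
  fix i assume i: "i \<in> {1..n + m}"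
  show "M' (unit_vec i) \<in> S1.upper j"
    using S1.mutated_upper_other[OF k_even j] unit_vec_upper[OF i] M'_other[OF i] M'_k
    by (cases "i = k") auto
next
  fix i assume i: "i \<in> {1..n}" "lookup c i < 0"
  then have ne: "i \<noteq> k" "i \<noteq> j" using cj ck by auto
  have "M' (- unit_vec i) = M (- unit_vec i)"
    using i ne by (intro M'_eq_M even_sublattice_exponents) (auto simp: lookup_single when_def)
  then show "M' (- unit_vec i) \<in> S1.upper j" using neg_unit_vec_upper i ne by auto
qed

lemma upper_k: "S2.upper k \<subseteq> S1.upper k"
  unfolding S2.upper_def
proof (rule S1.generate_ring_min_subring1[OF S2.upper_gens_carrier[OF k_even] S1.upper_subring[OF k_even]])
  have "M (unit_vec k) \<otimes> S1.nu_inv True k \<in> S1.upper k"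
    using k_even by (intro subringE(6)[OF S1.upper_subring[OF k_even]] unit_vec_upper S1.nu_upper) auto
  then show "S2.upper_gens k \<subseteq> S1.upper k"
    using M'_upper[OF k_even] by (auto simp: S2.upper_gens_def mutated_twice)
qed

text \<open>
  The coefficients mutate as in a quantum cluster algebra with central coefficients: expand
  \<open>(1 + N k)\<^sup>b = 1 + b N k\<close> and use \<open>N_N_zero\<close>.
\<close>

lemma nu'_other:
  assumes j: "j \<in> {1..n}" "j \<noteq> k" and \<sigma>: "\<sigma> \<longleftrightarrow> arrows Q j k = 0"
  defines "b \<equiv> if \<sigma> then arrows Q k j else arrows Q j k"
  shows "S1.nu \<sigma> j \<otimes> S1.nu \<sigma> k [^] b = S2.nu \<sigma> j" "S1.nu (\<not> \<sigma>) j = S2.nu (\<not> \<sigma>) j"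
proof -
  show "S1.nu \<sigma> j \<otimes> S1.nu \<sigma> k [^] b = S2.nu \<sigma> j"
  proof (cases \<sigma>)
    case True
    have "S1.N j \<otimes> add_pow R b (S1.N k) = \<zero>"
    proof (cases "b = 0")
      case False
      then have "S1.N j \<otimes> S1.N k = \<zero>" using True by (intro N_N_zero j) (simp add: b_def)
      then show ?thesis by (simp add: S1.add_pow_rdistr)
    qed simp
    then show ?thesis using True S1.square_zero_power[OF S1.N_closed S1.N_square[OF k_even], of b]
      by (simp add: S1.nu_def S2.nu_def N'_other[OF j(2)] b_def S1.l_distr S1.r_distr S1.a_ac)
  qed (simp add: S1.nu_def S2.nu_def)
  show "S1.nu (\<not> \<sigma>) j = S2.nu (\<not> \<sigma>) j"
  proof (cases \<sigma>)
    case False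
    then have "arrows Q k j = 0"
      using \<sigma> S1.extended[unfolded extended_quiver_def, THEN conjunct2, THEN conjunct2, THEN conjunct1,
        THEN spec[of _ j], THEN spec[of _ k]] by simp
    then show ?thesis using False by (simp add: S1.nu_def S2.nu_def N'_other[OF j(2)])
  qed (simp add: S1.nu_def S2.nu_def)
qed

text \<open>
  Expand the power of a sum of two terms. Every summand except the power of the first term contains the
  other term, which is a multiple of \<open>X j\<close>; moving \<open>X j\<close> to the left only costs powers of \<open>q\<close>.
\<close>

lemma mutated_power:
  assumes j: "j \<in> {1..n}" "j \<noteq> k" and b: "b = 0 \<or> lookup (exchange_vec (\<not> \<sigma>) n Q k) j > 0"
  obtains r where "r \<in> S1.upper j"
    "S1.mutated k [^] (b :: nat) = S1.exchange_term \<sigma> k [^] b \<oplus> M (unit_vec j) \<otimes> r"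
proof -
  let ?A = "S1.exchange_term \<sigma> k" and ?B = "S1.exchange_term (\<not> \<sigma>) k" and ?X = "M (unit_vec j)"
  note sub = S1.upper_subring[OF j(1)]
  note carr = subringE(1)[OF sub]
  have jE: "unit_vec j \<in> even_sublattice n m" using j by simp
  note je = even_sublattice_exponents[OF jE]
  have Xc: "?X \<in> carrier R" using je by simp
  have AU: "?A \<in> S1.upper j" by (rule S1.exchange_term_upper[OF k_even j])
  have mU: "S1.mutated k \<in> S1.upper j" by (rule S1.mutated_upper_other[OF k_even j(1)])
  have "\<exists>r\<in>S1.upper j. S1.mutated k [^] b = ?A [^] b \<oplus> ?X \<otimes> r"
  proof (cases "b = 0")
    case True
    then show ?thesis using subringE(2)[OF sub] Xc by (intro bexI[of _ \<zero>]) auto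
  next
    case False
    let ?w = "exchange_vec (\<not> \<sigma>) n Q k"
    have wE: "?w - unit_vec j \<in> even_sublattice n m" using k_even jE by simp
    define rB where "rB = qp (- S1.form (unit_vec j) (?w - unit_vec j)) \<otimes> (M (?w - unit_vec j) \<otimes> S1.nu (\<not> \<sigma>) k)"
    have "lookup (?w - unit_vec j) j \<ge> 0" using False b by (simp add: lookup_minus)
    then have rBU: "rB \<in> S1.upper j" unfolding rB_def
      using even_sublattice_exponents[OF wE]
      by (intro subringE(6)[OF sub] S1.nu_upper[OF j(1)] S1.M_upper S1.qp_upper)
    have wc: "M (?w - unit_vec j) \<in> carrier R" using even_sublattice_exponents[OF wE] by simp
    have B: "?B = ?X \<otimes> rB"
      using S1.M_split_even[OF jE even_sublattice_exponents[OF wE]] Xc wc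
      by (simp add: S1.exchange_term_def rB_def S1.m_assoc S1.qp_swap[of ?X])
    let ?d = "- (2 * S1.form (unit_vec j) (exchange_vec \<sigma> n Q k))"
    have AX: "?A \<otimes> ?X = qp ?d \<otimes> (?X \<otimes> ?A)"
      using S1.exchange_term_comm_deg[OF k_even jE, of \<sigma>] k_even Xc
      by (simp add: S1.comm_deg_def S1.qp_qp)
    show ?thesis
    proof (induction b)
      case 0
      show ?case using subringE(2)[OF sub] Xc by (intro bexI[of _ \<zero>]) auto
    next
      case (Suc t)
      then obtain r where r: "r \<in> S1.upper j" "S1.mutated k [^] t = ?A [^] t \<oplus> ?X \<otimes> r" by blast
      let ?Y = "S1.mutated k"
      have pU: "?Y [^] t \<in> S1.upper j" using mU sub by (induction t) (auto simp: subringE)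
      have c: "r \<in> carrier R" "rB \<in> carrier R" "?A \<in> carrier R" "?Y \<in> carrier R" "?Y [^] t \<in> carrier R"
        using r(1) rBU AU mU pU carr by auto
      have "?Y [^] Suc t = ?Y \<otimes> ?Y [^] t" using c by (intro S1.nat_pow_Suc2)
      also have "\<dots> = ?A \<otimes> ?Y [^] t \<oplus> ?X \<otimes> (rB \<otimes> ?Y [^] t)"
        unfolding S1.mutated_eq[OF k_even, of \<sigma>] B using c Xc B
        by (subst S1.l_distr) (simp_all add: S1.m_assoc flip: S1.mutated_eq[OF k_even, of \<sigma>])
      also have "?A \<otimes> ?Y [^] t = ?A [^] Suc t \<oplus> ?X \<otimes> (qp ?d \<otimes> (?A \<otimes> r))"
      proof -
        have "?A \<otimes> (?X \<otimes> r) = ?X \<otimes> (qp ?d \<otimes> (?A \<otimes> r))"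
        proof -
          have "?A \<otimes> (?X \<otimes> r) = (?A \<otimes> ?X) \<otimes> r" using c Xc by (simp add: S1.m_assoc)
          also have "\<dots> = qp ?d \<otimes> (?X \<otimes> (?A \<otimes> r))" using c Xc by (simp add: AX S1.m_assoc)
          finally show ?thesis using c Xc by (simp add: S1.qp_swap[of ?X "?A \<otimes> r"])
        qed
        moreover have "?A [^] Suc t = ?A \<otimes> ?A [^] t" using c by (intro S1.nat_pow_Suc2)
        ultimately show ?thesis using c Xc by (simp add: r(2) S1.r_distr del: S1.nat_pow_Suc)
      qed
      finally have eq: "?Y [^] Suc t = ?A [^] Suc t \<oplus> ?X \<otimes> (qp ?d \<otimes> (?A \<otimes> r) \<oplus> rB \<otimes> ?Y [^] t)"
        using c Xc by (simp add: S1.r_distr S1.a_assoc)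
      have "qp ?d \<otimes> (?A \<otimes> r) \<oplus> rB \<otimes> ?Y [^] t \<in> S1.upper j"
        using sub r(1) rBU AU pU S1.qp_upper by (simp add: subringE)
      then show ?case using eq by blast
    qed
  qed
  then show ?thesis using that by blast
qed

end

text \<open>
  The choice of \<open>\<sigma>\<close> is such that \<open>exchange_vec \<sigma> n Q j\<close> involves \<open>x\<^sub>k\<close> with multiplicity \<open>b\<close>. Up to a
  common summand, which involves neither \<open>x\<^sub>j\<close> nor \<open>x\<^sub>k\<close>, the vectors \<open>g\<close> and \<open>h\<close> are the exchange
  exponents of the mutated quiver at \<open>x\<^sub>j\<close>; the summand is what the cancellation of opposite arrows removes.
\<close>

lemma exchange_vec_mutated_other:
  fixes Q :: ext_quiver
  assumes Q: "\<And>i j. arrows Q i j = 0 \<or> arrows Q j i = 0" "\<And>i. arrows Q i i = 0"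
    and j: "j \<in> {1..n}" "j \<noteq> k" and k: "k \<in> {1..n}" and \<sigma>: "\<sigma> \<longleftrightarrow> arrows Q j k = 0"
  defines "b \<equiv> if \<sigma> then arrows Q k j else arrows Q j k"
  defines "g \<equiv> exchange_vec \<sigma> n Q j + of_nat b * exchange_vec \<sigma> n Q k"
    and "h \<equiv> exchange_vec (\<not> \<sigma>) n Q j + of_nat b * unit_vec k"
    and "g' \<equiv> exchange_vec \<sigma> n (mutate_quiver k Q) j" and "h' \<equiv> exchange_vec (\<not> \<sigma>) n (mutate_quiver k Q) j"
  shows "g - g' = h - h'" "lookup (g - g') j = 0" "lookup (g - g') k = 0" "lookup g k = 0"
    "lookup (exchange_vec (\<not> \<sigma>) n Q j) k = 0" "lookup (exchange_vec (\<not> \<sigma>) n Q k) j = int b"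
proof -
  have ejk: "exchange_entry Q k j = (if \<sigma> then int b else - int b)"
    using Q(1)[of k j] \<sigma> by (auto simp: exchange_entry_def b_def)
  have ekj: "exchange_entry Q j k = (if \<sigma> then - int b else int b)"
    using ejk exchange_entry_skew[of Q j k] by auto
  have diag: "exchange_entry Q i i = 0" for i by (simp add: exchange_entry_def)
  have w: "lookup (exchange_vec \<sigma> n Q k) i = (if i = k then - 1 else if i \<in> {1..n} then
      int (if \<sigma> then arrows Q i k else arrows Q k i) else 0)" for i
    using Q(1)[of i k] k by (auto simp: lookup_exchange_vec exchange_entry_def)
  show "lookup (exchange_vec (\<not> \<sigma>) n Q j) k = 0" using k j
    by (simp add: lookup_exchange_vec ejk)
  show "lookup (exchange_vec (\<not> \<sigma>) n Q k) j = int b" using k j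
    by (simp add: lookup_exchange_vec ekj)
  have gk: "lookup g k = 0" "lookup g' k = 0" "lookup h k = int b" "lookup h' k = int b"
    using k j by (simp_all add: g_def g'_def h_def h'_def lookup_add lookup_of_nat_mult w
        lookup_exchange_vec ejk mutate_exchange_entry diag)
  then show "lookup g k = 0" "lookup (g - g') k = 0" by (simp_all add: lookup_minus)
  have "lookup (exchange_vec \<sigma> n Q k) j = 0"
    unfolding w using k j Q(1)[of j k] \<sigma> by auto
  then show "lookup (g - g') j = 0"
    using j by (simp add: lookup_minus g_def g'_def lookup_add lookup_of_nat_mult lookup_exchange_vec
        diag mutate_exchange_entry)
  show "g - g' = h - h'"
  proof (rule poly_mapping_eqI)
    fix i
    consider "i = k" | "i \<notin> {1..n}" | "i \<in> {1..n}" "i \<noteq> k" by blast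
    then show "lookup (g - g') i = lookup (h - h') i"
    proof cases
      case 1 then show ?thesis using gk by (simp add: lookup_minus)
    next
      case 2
      then have "i \<noteq> j" "i \<noteq> k" using j k by auto
      then show ?thesis using 2
        by (simp only: lookup_minus lookup_add g_def g'_def h_def h'_def lookup_of_nat_mult
            lookup_exchange_vec lookup_single_not_eq[OF \<open>i \<noteq> k\<close>[symmetric]]) simp
    next
      case 3
      define e where "e = (if \<sigma> then exchange_entry Q i j else - exchange_entry Q i j)"
      define e' where "e' = (if \<sigma> then exchange_entry (mutate_quiver k Q) i j
        else - exchange_entry (mutate_quiver k Q) i j)"
      have ee: "e' = e + int b * lookup (exchange_vec \<sigma> n Q k) i"
        using 3 j Q(1)[of j k] \<sigma> unfolding w e_def e'_def mutate_exchange_entry b_def by auto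
      have "lookup (g - g') i = max 0 e + int b * lookup (exchange_vec \<sigma> n Q k) i - max 0 e'"
        using 3 unfolding g_def g'_def lookup_minus lookup_add lookup_of_nat_mult
          lookup_exchange_vec[of \<sigma> n Q j] lookup_exchange_vec[of \<sigma> n "mutate_quiver k Q" j]
        by (simp add: e_def e'_def)
      moreover have "lookup (h - h') i = max 0 (- e) - max 0 (- e')"
        using 3 unfolding h_def h'_def lookup_minus lookup_add lookup_of_nat_mult lookup_exchange_vec
        by (simp add: e_def e'_def lookup_single_not_eq)
      ultimately show ?thesis using ee by linarith
    qed
  qed
qed

context super_mutation
begin

text \<open>
  Multiply \<open>mutated j = M U \<nu> + M V \<nu>'\<close>, where \<open>U\<close> contains \<open>b e\<^sub>k\<close>, by the \<open>b\<close>-th power of the new variable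
  \<open>Y\<close>. In the first term only the leading part of that power matters, the rest being divisible by \<open>X j\<close>;
  it turns \<open>U\<close> into \<open>g\<close>. In the second term \<open>Y\<^sup>b\<close> is kept as a monomial of the new frame, which gives \<open>h\<close>.
  Both parts acquire the same power of \<open>q\<close>, as \<open>form_vec_eq\<close> shows. So the product is, modulo
  \<open>upper j\<close>, a power of \<open>q\<close> times \<open>P\<close>, which up to a power of \<open>q\<close> is \<open>S2.mutated j\<close> times a monomial \<open>M' z\<close> that is a
  unit of \<open>upper j\<close>.
\<close>

lemma mutated'_upper:
  assumes j: "j \<in> {1..l}" "j \<noteq> k"
  shows "S2.mutated j \<in> S1.upper j"
proof -
  have jn: "j \<in> {1..n}" using S1.mutable_even[OF j(1)] .
  note sub = S1.upper_subring[OF jn]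
  define \<sigma> where "\<sigma> = (arrows Q j k = 0)"
  define b where "b = (if \<sigma> then arrows Q k j else arrows Q j k)"
  define U where "U = exchange_vec \<sigma> n Q j"
  define V where "V = exchange_vec (\<not> \<sigma>) n Q j"
  define W where "W = exchange_vec \<sigma> n Q k"
  define g where "g = U + of_nat b * W"
  define h where "h = V + of_nat b * unit_vec k"
  define g' where "g' = exchange_vec \<sigma> n Q' j"
  define h' where "h' = exchange_vec (\<not> \<sigma>) n Q' j"
  define z where "z = g - g'"
  have ev: "U \<in> even_sublattice n m" "V \<in> even_sublattice n m" "W \<in> even_sublattice n m"
    "g \<in> even_sublattice n m" "h \<in> even_sublattice n m" "g' \<in> even_sublattice n m"
    "h' \<in> even_sublattice n m" "z \<in> even_sublattice n m"
    using jn k_even by (simp_all add: U_def V_def W_def g_def h_def g'_def h'_def z_def)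
  note ex = ev[THEN even_sublattice_exponents]
  have bE: "of_nat b * W \<in> even_sublattice n m" "of_nat b * unit_vec k \<in> even_sublattice n m"
    "- z \<in> even_sublattice n m" using ev by simp_all
  note be = bE[THEN even_sublattice_exponents]
  have ext: "arrows Q a c = 0 \<or> arrows Q c a = 0" "arrows Q a a = 0" for a c
    using S1.extended[unfolded extended_quiver_def, THEN conjunct2, THEN conjunct2, THEN conjunct1,
        THEN spec[of _ a], THEN spec[of _ c]]
      S1.extended[unfolded extended_quiver_def, THEN conjunct2, THEN conjunct1, THEN spec[of _ a]]
    by simp_all
  note comb = exchange_vec_mutated_other[OF ext jn j(2) k_even \<sigma>_def,
      folded b_def, folded U_def V_def W_def, folded g_def h_def, folded Q', folded g'_def h'_def,
      folded z_def]
  have zh: "z = h - h'" and zj: "lookup z j = 0" and zk: "lookup z k = 0" and gk: "lookup g k = 0"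
    and Vk: "lookup V k = 0" and Wj: "lookup (exchange_vec (\<not> \<sigma>) n Q k) j = int b"
    using comb by auto
  have W0: "lookup W j = 0" unfolding W_def using S1.vec_no_j[OF jn j(2)] \<sigma>_def by simp
  note nu' = nu'_other[OF jn j(2), of \<sigma>, folded b_def]
  have nu'1: "S1.nu \<sigma> j \<otimes> S1.nu \<sigma> k [^] b = S2.nu \<sigma> j" and nu'2: "S1.nu (\<not> \<sigma>) j = S2.nu (\<not> \<sigma>) j"
    using nu' \<sigma>_def by simp_all
  let ?Y = "S1.mutated k"
  have Yc: "?Y \<in> carrier R" using k_even by simp
  have YU: "?Y \<in> S1.upper j" by (rule S1.mutated_upper_other[OF k_even jn])
  obtain r where r: "r \<in> S1.upper j"
    "?Y [^] b = S1.exchange_term \<sigma> k [^] b \<oplus> M (unit_vec j) \<otimes> r"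
    by (rule mutated_power[OF jn j(2), of b \<sigma>]) (use Wj in auto)
  have rc: "r \<in> carrier R" using r(1) subringE(1)[OF sub] by blast
  have jE: "unit_vec j \<in> even_sublattice n m" using jn by simp
  note je = even_sublattice_exponents[OF jE]
  let ?s = "S1.form U (of_nat b * W)"
  define P where "P = M' g \<otimes> S2.nu \<sigma> j \<oplus> M' h \<otimes> S2.nu (\<not> \<sigma>) j"
  define rem where "rem = M U \<otimes> S1.nu \<sigma> j \<otimes> (M (unit_vec j) \<otimes> r)"
  note cl = ex[THEN S1.M_closed] ex[THEN S2.M_closed] be[THEN S1.M_closed] be[THEN S2.M_closed]
    je[THEN S1.M_closed]
  \<comment> \<open>the factor \<open>A [^] b\<close> of the leading part merges with \<open>M U\<close> into the monomial \<open>M' g\<close> and the coefficient \<open>S2.nu \<sigma> j\<close>\<close>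
  have first: "M U \<otimes> S1.nu \<sigma> j \<otimes> S1.exchange_term \<sigma> k [^] b = qp ?s \<otimes> (M' g \<otimes> S2.nu \<sigma> j)"
  proof -
    have "S1.exchange_term \<sigma> k [^] b = M W [^] b \<otimes> S1.nu \<sigma> k [^] b"
      unfolding S1.exchange_term_def W_def[symmetric] using cl S1.nu_commute_M(1)[OF k_even ex(3)]
      by (intro S1.pow_mult_distrib) simp_all
    also have "M W [^] b = M (of_nat b * W)" by (rule S1.M_pow[OF ev(3)])
    finally have A: "S1.exchange_term \<sigma> k [^] b = M (of_nat b * W) \<otimes> S1.nu \<sigma> k [^] b" .
    have "M U \<otimes> S1.nu \<sigma> j \<otimes> S1.exchange_term \<sigma> k [^] b =
        M U \<otimes> ((S1.nu \<sigma> j \<otimes> M (of_nat b * W)) \<otimes> S1.nu \<sigma> k [^] b)"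
      using cl by (simp add: A S1.m_assoc)
    also have "S1.nu \<sigma> j \<otimes> M (of_nat b * W) = M (of_nat b * W) \<otimes> S1.nu \<sigma> j"
      using S1.nu_commute_M(1)[OF jn be(1)] by simp
    also have "M U \<otimes> ((M (of_nat b * W) \<otimes> S1.nu \<sigma> j) \<otimes> S1.nu \<sigma> k [^] b) =
        (M U \<otimes> M (of_nat b * W)) \<otimes> (S1.nu \<sigma> j \<otimes> S1.nu \<sigma> k [^] b)"
      using cl by (simp add: S1.m_assoc)
    also have "\<dots> = qp ?s \<otimes> M g \<otimes> S2.nu \<sigma> j"
      using S1.M_mult_even_left[OF ev(1) be(1)] by (simp add: nu'1 g_def)
    also have "M g = M' g" using M'_eq_M[OF ex(4) gk] by simp
    finally show ?thesis using cl by (simp add: S1.m_assoc)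
  qed
  \<comment> \<open>here the power of \<open>q\<close> is \<open>b\<close> times \<open>S1.form V W = S1.form U W\<close>, the same as above\<close>
  have third: "M V \<otimes> S1.nu (\<not> \<sigma>) j \<otimes> ?Y [^] b = qp ?s \<otimes> (M' h \<otimes> S2.nu (\<not> \<sigma>) j)"
  proof -
    have Yb: "?Y [^] b = M' (of_nat b * unit_vec k)"
      using S2.M_pow[OF unit_k] by (simp add: M'_k)
    have f: "S2.form V (of_nat b * unit_vec k) = ?s"
    proof -
      have "S2.form V (unit_vec k) = S1.form V W" unfolding W_def by (rule form'_k[OF ev(2) Vk])
      also have "\<dots> = S1.form U W" unfolding U_def V_def by (rule S1.form_vec_eq(1)[OF j(1) W0])
      finally show ?thesis by (simp add: bilin_form_of_nat_right)
    qed
    have "M V \<otimes> S1.nu (\<not> \<sigma>) j \<otimes> ?Y [^] b = M' V \<otimes> (S2.nu (\<not> \<sigma>) j \<otimes> M' (of_nat b * unit_vec k))"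
      using cl M'_eq_M[OF ex(2) Vk] by (simp add: Yb nu'2 S1.m_assoc)
    also have "S2.nu (\<not> \<sigma>) j \<otimes> M' (of_nat b * unit_vec k) = M' (of_nat b * unit_vec k) \<otimes> S2.nu (\<not> \<sigma>) j"
      using S2.nu_commute_M(1)[OF jn be(2)] by simp
    also have "M' V \<otimes> (M' (of_nat b * unit_vec k) \<otimes> S2.nu (\<not> \<sigma>) j) =
        (M' V \<otimes> M' (of_nat b * unit_vec k)) \<otimes> S2.nu (\<not> \<sigma>) j"
      using cl by (simp add: S1.m_assoc)
    also have "M' V \<otimes> M' (of_nat b * unit_vec k) = qp ?s \<otimes> M' h"
      using S2.M_mult_even_left[OF ev(2) be(2)] by (simp add: f h_def)
    finally show ?thesis using cl by (simp add: S1.m_assoc)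
  qed
  have remU: "rem \<in> S1.upper j"
  proof -
    have "rem = (M U \<otimes> M (unit_vec j)) \<otimes> (S1.nu \<sigma> j \<otimes> r)"
    proof -
      have "S1.nu \<sigma> j \<otimes> (M (unit_vec j) \<otimes> r) = (M (unit_vec j) \<otimes> S1.nu \<sigma> j) \<otimes> r"
        using cl rc S1.nu_commute_M(1)[OF jn je] by (simp add: S1.m_assoc)
      then show ?thesis unfolding rem_def using cl rc by (simp add: S1.m_assoc)
    qed
    also have "M U \<otimes> M (unit_vec j) = qp (S1.form U (unit_vec j)) \<otimes> M (U + unit_vec j)"
      by (rule S1.M_mult_even_left[OF ev(1) je])
    finally have eq: "rem = qp (S1.form U (unit_vec j)) \<otimes> M (U + unit_vec j) \<otimes> (S1.nu \<sigma> j \<otimes> r)" .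
    have "U + unit_vec j \<in> exponents n m"
      using ev(1) jE by (intro even_sublattice_exponents[of _ n m]) simp
    moreover have "lookup (U + unit_vec j) j \<ge> 0"
      unfolding U_def lookup_add lookup_exchange_vec by simp
    ultimately show ?thesis unfolding eq
      by (intro subringE(6)[OF sub] S1.qp_upper S1.M_upper S1.nu_upper[OF jn] r(1))
  qed
  have Pc: "P \<in> carrier R" using cl by (simp add: P_def)
  have "S1.mutated j \<otimes> ?Y [^] b = M U \<otimes> S1.nu \<sigma> j \<otimes> ?Y [^] b \<oplus> M V \<otimes> S1.nu (\<not> \<sigma>) j \<otimes> ?Y [^] b"
    unfolding S1.mutated_eq[OF jn, of \<sigma>] S1.exchange_term_def U_def[symmetric] V_def[symmetric]
    using cl Yc by (intro S1.l_distr) simp_all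
  also have "M U \<otimes> S1.nu \<sigma> j \<otimes> ?Y [^] b = qp ?s \<otimes> (M' g \<otimes> S2.nu \<sigma> j) \<oplus> rem"
    unfolding r(2) rem_def first[symmetric] using cl rc k_even by (intro S1.r_distr) simp_all
  also have "qp ?s \<otimes> (M' g \<otimes> S2.nu \<sigma> j) \<oplus> rem \<oplus> M V \<otimes> S1.nu (\<not> \<sigma>) j \<otimes> ?Y [^] b = qp ?s \<otimes> P \<oplus> rem"
    unfolding third P_def using cl remU subringE(1)[OF sub] by (simp add: S1.r_distr S1.a_ac subset_iff)
  finally have main: "S1.mutated j \<otimes> ?Y [^] b = qp ?s \<otimes> P \<oplus> rem" .
  have "?Y [^] b \<in> S1.upper j" using YU sub by (induction b) (auto simp: subringE)
  then have lhs: "S1.mutated j \<otimes> ?Y [^] b \<in> S1.upper j"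
    by (intro subringE(6)[OF sub] S1.mutated_upper)
  have remc: "rem \<in> carrier R" using remU subringE(1)[OF sub] by blast
  have "qp ?s \<otimes> P = (S1.mutated j \<otimes> ?Y [^] b) \<oplus> \<ominus> rem"
    unfolding main using Pc remc by (simp add: S1.a_assoc S1.r_neg)
  then have "qp ?s \<otimes> P \<in> S1.upper j" using lhs remU by (simp add: subringE(5,7)[OF sub])
  then have mem: "qp (- ?s) \<otimes> (qp ?s \<otimes> P) \<in> S1.upper j"
    by (rule subringE(6)[OF sub S1.qp_upper])
  have "qp (- ?s) \<otimes> (qp ?s \<otimes> P) = P" using Pc by (simp add: S1.qp_qp)
  then have PU: "P \<in> S1.upper j" using mem by (simp only:)
  let ?t = "S2.form g' z"
  have t': "S2.form h' z = ?t" unfolding g'_def h'_def by (rule S2.form_vec_eq(1)[OF j(1) zj])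
  have mz: "M' v \<otimes> S2.nu \<tau> j \<otimes> M' z = qp (S2.form v z) \<otimes> (M' (v + z) \<otimes> S2.nu \<tau> j)"
    if "v \<in> even_sublattice n m" for v \<tau>
  proof -
    have vc: "M' v \<in> carrier R" "M' (v + z) \<in> carrier R"
      using that ev(8) by (auto intro!: S2.M_closed even_sublattice_exponents)
    have "M' v \<otimes> S2.nu \<tau> j \<otimes> M' z = (M' v \<otimes> M' z) \<otimes> S2.nu \<tau> j"
      using vc cl S2.nu_commute_M(1)[OF jn ex(8)] by (simp add: S1.m_assoc)
    then show ?thesis using S2.M_mult_even_left[OF that ex(8)] vc by (simp add: S1.m_assoc)
  qed
  \<comment> \<open>dividing both terms by \<open>M' z\<close> costs the same power of \<open>q\<close>, since \<open>z\<close> does not involve \<open>X j\<close>\<close>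
  have gz: "g' + z = g" "h' + z = h" by (simp add: z_def) (simp add: zh)
  have "S2.mutated j \<otimes> M' z = qp ?t \<otimes> P"
    unfolding S2.mutated_eq[OF jn, of \<sigma>] S2.exchange_term_def g'_def[symmetric] h'_def[symmetric] P_def
    using cl mz[OF ev(6)] mz[OF ev(7)] by (simp add: S1.l_distr S1.r_distr gz t')
  then have "S2.mutated j \<otimes> M' z \<otimes> M' (- z) = qp ?t \<otimes> P \<otimes> M' (- z)" by simp
  moreover have "S2.mutated j \<otimes> M' z \<otimes> M' (- z) = S2.mutated j"
    using cl jn S2.M_inverse[OF ev(8)] by (simp add: S1.m_assoc)
  ultimately have "S2.mutated j = qp ?t \<otimes> P \<otimes> M' (- z)" by simp
  moreover have "M' (- z) \<in> S1.upper j"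
    by (rule M'_upper[OF jn be(3)]) (use zj zk in simp_all)
  ultimately show ?thesis using PU by (simp add: subringE(6)[OF sub])
qed

text \<open>
  The elements \<open>h\<close> that commute with \<open>Y = mutated k\<close> up to a power of \<open>q\<close> and satisfy
  \<open>h \<otimes> Y [^] N \<in> upper j\<close> for some \<open>N\<close> are closed under multiplication, because powers of \<open>Y\<close> can be moved past
  them. The generators of \<open>S2.upper j\<close> are of this kind: a negative power of \<open>Y\<close> is cleared by a positive one.
\<close>

lemma upper'_power:
  assumes j: "j \<in> {1..l}" "j \<noteq> k" and f: "f \<in> S2.upper j"
  shows "\<exists>N :: nat. f \<otimes> S1.mutated k [^] N \<in> S1.upper j"
proof -
  have jn: "j \<in> {1..n}" using S1.mutable_even[OF j(1)] .
  note sub = S1.upper_subring[OF jn]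
  let ?Y = "S1.mutated k"
  have Yc [simp]: "?Y \<in> carrier R" using k_even by simp
  have YU: "?Y [^] N \<in> S1.upper j" for N :: nat
    using S1.mutated_upper_other[OF k_even jn] sub by (induction N) (auto simp: subringE)
  define H where "H = {h \<in> carrier R. (\<exists>d. S1.comm_deg ?Y d h) \<and> (\<exists>N :: nat. h \<otimes> ?Y [^] N \<in> S1.upper j)}"
  have Hc: "H \<subseteq> carrier R" by (auto simp: H_def)
  have Hm: "a \<otimes> c \<in> H" if ac: "a \<in> H" "c \<in> H" for a c
  proof -
    obtain d e N1 N2 where d: "S1.comm_deg ?Y d a" "S1.comm_deg ?Y e c"
      and N: "a \<otimes> ?Y [^] (N1 :: nat) \<in> S1.upper j" "c \<otimes> ?Y [^] (N2 :: nat) \<in> S1.upper j"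
      using ac by (auto simp: H_def)
    have cc: "a \<in> carrier R" "c \<in> carrier R" using ac Hc by auto
    let ?e = "int N1 * e"
    have "?Y [^] N1 \<otimes> c = qp ?e \<otimes> (c \<otimes> ?Y [^] N1)"
      using S1.comm_deg_pow_left[OF Yc d(2), of N1] by (simp add: S1.comm_deg_def)
    then have cY: "c \<otimes> ?Y [^] N1 = qp (- ?e) \<otimes> (?Y [^] N1 \<otimes> c)"
      using cc by (intro S1.qp_move) simp_all
    have "a \<otimes> c \<otimes> ?Y [^] (N1 + N2) = a \<otimes> ((c \<otimes> ?Y [^] N1) \<otimes> ?Y [^] N2)"
      using cc by (simp add: S1.m_assoc flip: S1.nat_pow_mult)
    also have "\<dots> = qp (- ?e) \<otimes> ((a \<otimes> ?Y [^] N1) \<otimes> (c \<otimes> ?Y [^] N2))"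
      unfolding cY using cc S1.qp_swap[of a "?Y [^] N1 \<otimes> (c \<otimes> ?Y [^] N2)" "- ?e"]
      by (simp add: S1.m_assoc)
    also have "\<dots> \<in> S1.upper j" 
      by (rule subringE(6)[OF sub S1.qp_upper subringE(6)[OF sub N]])
    finally show ?thesis using S1.comm_deg_mult[OF Yc d] cc unfolding H_def by auto
  qed
  have H1: "h \<in> H" if "h \<in> carrier R" "S1.comm_deg ?Y d h" "h \<in> S1.upper j" for h d
  proof -
    have "h \<otimes> ?Y [^] (0 :: nat) \<in> S1.upper j" using that by simp
    then show ?thesis unfolding H_def using that by blast
  qed
  have G: "S2.upper_gens j \<subseteq> H"
  proof
    fix x assume "x \<in> S2.upper_gens j"
    then consider a where "x = qp a" | c where "x = M' c" "c \<in> exponents n m" "lookup c j \<ge> 0"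
      | "x = S2.mutated j" unfolding S2.upper_gens_def by auto
    then show "x \<in> H"
    proof cases
      case (1 a) then show ?thesis using H1[OF S1.qp_closed S1.comm_deg_qp[OF Yc] S1.qp_upper] by simp
    next
      case (2 c)
      \<comment> \<open>just enough to make the exponent of the new variable nonnegative\<close>
      define N where "N = nat (- lookup c k)"
      let ?u = "of_nat N * unit_vec k"
      have uE: "?u \<in> even_sublattice n m" by simp
      have cu: "c + ?u \<in> exponents n m" by (rule even_add_exponents(2)[OF uE 2(2)])
      have lk: "lookup ?u i = (if i = k then int N else 0)" for i
        by (simp add: lookup_of_nat_mult lookup_single when_def)
      have nonneg: "lookup (c + ?u) j \<ge> 0" "lookup (c + ?u) k \<ge> 0"
        unfolding lookup_add lk using 2(3) j(2) by (simp_all add: N_def)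
      have "M' c \<otimes> ?Y [^] N = M' c \<otimes> M' ?u" using S2.M_pow[OF unit_k] by (simp add: M'_k)
      also have "\<dots> = qp (S2.form c ?u) \<otimes> M' (c + ?u)" by (rule S2.M_mult_even_right[OF 2(2) uE])
      also have "\<dots> \<in> S1.upper j"
        by (intro subringE(6)[OF sub] S1.qp_upper M'_upper[OF jn cu] nonneg)
      finally have "M' c \<otimes> ?Y [^] N \<in> S1.upper j" .
      moreover have "S1.comm_deg ?Y (2 * S2.form (unit_vec k) c) (M' c)"
        using S2.M_comm_deg[OF unit_k 2(2)] by (simp add: M'_k)
      ultimately show ?thesis unfolding H_def using 2 by auto
    next
      case 3
      have "S1.comm_deg ?Y (2 * S2.form (unit_vec k) (exchange_vec True n Q' j)) (S2.mutated j)"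
        using S2.mutated_comm_deg[OF j(1) unit_k] j(2) by (simp add: M'_k lookup_single when_def)
      then show ?thesis using mutated'_upper[OF j] jn 3 by (auto intro: H1)
    qed
  qed
  have "\<one> \<in> H" using S1.comm_deg_one[OF Yc] subringE(3)[OF sub] by (auto intro: H1)
  then have "f \<in> add_span R H"
    using f unfolding S2.upper_def by (intro S1.generate_ring_add_span[OF Hc Hm _ G]) auto
  then show ?thesis
  proof induction
    case zero
    then show ?case using subringE(2)[OF sub] by (intro exI[of _ 0]) simp
  next
    case (incl h) then show ?case by (auto simp: H_def)
  next
    case (neg h)
    then obtain N :: nat where "h \<otimes> ?Y [^] N \<in> S1.upper j" by blast
    then have "\<ominus> h \<otimes> ?Y [^] N \<in> S1.upper j"
      using S1.add_span_carrier[OF Hc neg.hyps] by (simp add: S1.l_minus subringE(5)[OF sub])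
    then show ?case by blast
  next
    case (plus h1 h2)
    then obtain N1 N2 :: nat where N: "h1 \<otimes> ?Y [^] N1 \<in> S1.upper j" "h2 \<otimes> ?Y [^] N2 \<in> S1.upper j"
      by blast
    have c: "h1 \<in> carrier R" "h2 \<in> carrier R"
      using S1.add_span_carrier[OF Hc] plus.hyps by auto
    have "(h1 \<oplus> h2) \<otimes> ?Y [^] (N1 + N2) =
        (h1 \<otimes> ?Y [^] N1) \<otimes> ?Y [^] N2 \<oplus> (h2 \<otimes> ?Y [^] N2) \<otimes> ?Y [^] N1"
    proof -
      have "h1 \<otimes> ?Y [^] (N1 + N2) = (h1 \<otimes> ?Y [^] N1) \<otimes> ?Y [^] N2"
        using c by (simp add: S1.m_assoc S1.nat_pow_mult)
      moreover have "h2 \<otimes> ?Y [^] (N1 + N2) = (h2 \<otimes> ?Y [^] N2) \<otimes> ?Y [^] N1"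
        using c by (simp add: S1.m_assoc S1.nat_pow_mult add.commute)
      ultimately show ?thesis using c by (simp add: S1.l_distr)
    qed
    also have "\<dots> \<in> S1.upper j"
      by (rule subringE(7)[OF sub subringE(6)[OF sub N(1) YU] subringE(6)[OF sub N(2) YU]])
    finally show ?case by blast
  qed
qed

text \<open>
  Membership in \<open>S1.laurent\<close> comes from the direction \<open>k\<close>. In another direction the powers of the new
  variable are cancelled one at a time.
\<close>

lemma upper_bound_mutation: "S2.upper_bound \<subseteq> S1.upper_bound"
proof
  fix f assume f: "f \<in> S2.upper_bound"
  have fk: "f \<in> S1.upper k" using f k upper_k unfolding S2.upper_bound_def by blast
  then have fL: "f \<in> S1.laurent" using S1.upper_le_laurent[OF k_even] by blast
  have "f \<in> S1.upper j" if j: "j \<in> {1..l}" for j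
  proof (cases "j = k")
    case False
    have "f \<in> S2.upper j" using f j unfolding S2.upper_bound_def by blast
    then obtain N :: nat where "f \<otimes> S1.mutated k [^] N \<in> S1.upper j"
      using upper'_power[OF j False] by blast
    then show ?thesis
    proof (induction N)
      case 0
      then show ?case using fL subringE(1)[OF S1.laurent_subring] by auto
    next
      case (Suc N)
      have pL: "S1.mutated k [^] N \<in> S1.laurent"
        using S1.mutated_laurent[OF k_even] S1.laurent_subring by (induction N) (auto simp: subringE)
      have fc: "f \<in> carrier R" using fL subringE(1)[OF S1.laurent_subring] by auto
      have "f \<otimes> S1.mutated k [^] N \<in> S1.upper j"
      proof (rule S1.cancel_mutated[OF k j False])
        show "f \<otimes> S1.mutated k [^] N \<in> S1.laurent"
          using fL pL by (rule subringE(6)[OF S1.laurent_subring])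
        show "f \<otimes> S1.mutated k [^] N \<otimes> S1.mutated k \<in> S1.upper j"
          using Suc.prems fc k_even by (simp add: S1.m_assoc)
      qed
      then show ?case by (rule Suc.IH)
    qed
  qed (use fk in simp)
  then show "f \<in> S1.upper_bound" unfolding S1.upper_bound_def using fL by blast
qed

end

section \<open>The Laurent phenomenon\<close>

lemma (in super_seed) laurent_subset:
  assumes A: "subring A R" and "\<And>a. qp a \<in> A" and "\<And>i. i \<in> {1..n + m} \<Longrightarrow> X i \<in> A"
    and "\<And>i. i \<in> {1..n} \<Longrightarrow> M (- unit_vec i) \<in> A"
  shows "laurent \<subseteq> A"
  unfolding laurent_def
proof (rule generate_ring_min_subring1[OF _ A])
  have "M c \<in> A" if "c \<in> exponents n m" for c
    by (rule M_generated[OF A assms(2) that assms(3,4)])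
  then show "range qp \<union> M ` exponents n m \<subseteq> A" using assms(2) by blast
qed auto

context fraction_superring
begin

lemma super_seed:
  assumes "l \<le> n" and Q: "quantum_super_seed n m l \<Lambda> F \<iota> M Q"
  obtains \<Lambda>' where "super_seed F qpow n m \<Lambda>' M l Q"
proof -
  obtain \<phi> \<eta> where ext: "extended_quiver n m Q" and via: "supertoric_frame_via n m \<Lambda> F \<iota> \<phi> \<eta> M"
    and com: "compatible_pair n m l (transferred_form n m \<Lambda> \<eta>) Q"
    using Q unfolding quantum_super_seed_def by blast
  have "skew_symmetric (n + m) (transferred_form n m \<Lambda> \<eta>)"
    using com unfolding compatible_pair_def by blast
  then have "super_frame F qpow n m (transferred_form n m \<Lambda> \<eta>) M" by (rule super_frame[OF via])
  then show ?thesis using assms(1) ext com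
    by (intro that[of "transferred_form n m \<Lambda> \<eta>"]) (simp add: super_seed_def super_seed_axioms_def)
qed

lemma laurent_le_laurent_ring:
  assumes "super_seed F qpow n m \<Lambda>' M l Q"
  shows "super_seed.laurent F qpow n m M \<subseteq> laurent_ring n m l F \<iota> M"
proof -
  interpret S: super_seed F qpow n m \<Lambda>' M l Q by fact
  note l = S.l_le_n
  have inv: "inv (M (unit_vec i)) = M (- unit_vec i)" "M (- unit_vec i) \<in> carrier F"
    if "i \<in> {1..n}" for i
  proof -
    have e: "unit_vec i \<in> even_sublattice n m" using that by simp
    show "inv (M (unit_vec i)) = M (- unit_vec i)" by (rule S.M_inv[OF e])
    show "M (- unit_vec i) \<in> carrier F"
      using e by (intro S.M_closed even_sublattice_exponents) simp
  qed
  let ?G = "{\<iota> (scalar (Poly_Mapping.single a 1)) | a. a \<in> {1, - 1}} \<union>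
     {M (unit_vec i) | i. i \<in> {l + 1..n + m}} \<union> {inv (M (unit_vec i)) | i. i \<in> {l + 1..n}}"
  have G: "?G \<subseteq> carrier F" using inv by auto
  let ?H = "ground_ring n m l F \<iota> M \<union> cluster l M \<union> {inv x | x. x \<in> cluster l M}"
  have ground: "?G \<subseteq> ground_ring n m l F \<iota> M" "ground_ring n m l F \<iota> M \<subseteq> carrier F"
    unfolding ground_ring_def using generate_ring_incl[OF G] by (auto intro: generate_ring.incl)
  have H: "?H \<subseteq> carrier F" using ground(2) l inv by (auto simp: cluster_def)
  let ?A = "laurent_ring n m l F \<iota> M"
  have HA: "x \<in> ?A" if "x \<in> ?H" for x
    unfolding laurent_ring_def using that by (rule generate_ring.incl)
  have GA: "x \<in> ?A" if "x \<in> ?G" for x using that ground(1) by (intro HA) blast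
  have A: "subring ?A F" unfolding laurent_ring_def by (rule generate_ring_is_subring[OF H])
  have q1: "qpow 1 \<in> ?A" "qpow (- 1) \<in> ?A" unfolding qpow_def by (rule GA; blast)+
  have qn: "qpow (int t) \<in> ?A \<and> qpow (- int t) \<in> ?A" for t
  proof (induction t)
    case (Suc t)
    have "qpow (int (Suc t)) = qpow (int t) \<otimes> qpow 1" "qpow (- int (Suc t)) = qpow (- int t) \<otimes> qpow (- 1)"
      by (simp_all flip: qp_add add: add.commute)
    then show ?case using Suc q1 by (simp add: subringE(6)[OF A])
  qed (use A in \<open>simp add: subringE\<close>)
  show ?thesis
  proof (rule S.laurent_subset[OF A])
    show "qpow a \<in> ?A" for a using qn[of "nat \<bar>a\<bar>"] by (cases "a \<ge> 0") auto
    show "M (unit_vec i) \<in> ?A" if "i \<in> {1..n + m}" for i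
    proof (cases "i \<le> l")
      case True then show ?thesis using that by (intro HA) (auto simp: cluster_def)
    next
      case False then show ?thesis using that by (intro GA) auto
    qed
    show "M (- unit_vec i) \<in> ?A" if "i \<in> {1..n}" for i
    proof (cases "i \<le> l")
      case True
      then have "inv (M (unit_vec i)) \<in> ?A" using that by (intro HA) (auto simp: cluster_def)
      then show ?thesis using inv that by simp
    next
      case False
      then have "inv (M (unit_vec i)) \<in> ?A" using that by (intro GA) auto
      then show ?thesis using inv that by simp
    qed
  qed
qed

text \<open>
  Induction along the sequence of mutations, from its end. Only seeds that are mutated again are known to be
  compatible; the last mutation is therefore handled by the fact that the upper bound contains the
  neighbouring clusters.
\<close>

lemma cluster_variable_upper_bound:
  assumes l: "l \<le> n" and seq: "(\<lambda>s s'. \<exists>k\<in>{1..l}. seed_mutation n m l \<Lambda> F \<iota> k s s')\<^sup>*\<^sup>* (M, Q) (M', Q')"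
    and Y: "Y \<in> cluster l M'" and S: "super_seed F qpow n m \<Lambda>1 M l Q"
  shows "Y \<in> super_seed.upper_bound F qpow n m M l Q"
  using seq S
proof (induction "(M, Q)" arbitrary: M Q \<Lambda>1 rule: converse_rtranclp_induct)
  case base
  then interpret S: super_seed F qpow n m \<Lambda>1 M' l Q' by simp
  show ?case using Y l S.cluster_upper_bound base(1) by (auto simp: cluster_def)
next
  case (step s)
  obtain M2 Q2 where s: "s = (M2, Q2)" by fastforce
  obtain k where k: "k \<in> {1..l}" and mut: "seed_mutation n m l \<Lambda> F \<iota> k (M, Q) (M2, Q2)"
    using step.hyps(1) s by blast
  interpret S: super_seed F qpow n m \<Lambda>1 M l Q by fact
  have Q2: "Q2 = mutate_quiver k Q" and other: "\<And>i. i \<in> {1..n + m} - {k} \<Longrightarrow> M2 (unit_vec i) = M (unit_vec i)"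
    and new: "M2 (unit_vec k) = S.mutated k"
    using mut unfolding seed_mutation_def S.mutated_def by auto
  show ?case
  proof (cases "quantum_super_seed n m l \<Lambda> F \<iota> M2 Q2")
    case True
    then obtain \<Lambda>2 where S2: "super_seed F qpow n m \<Lambda>2 M2 l Q2" using super_seed[OF l] by blast
    then interpret S2: super_seed F qpow n m \<Lambda>2 M2 l Q2 .
    interpret super_mutation F qpow n m \<Lambda>1 M l Q \<Lambda>2 M2 Q2 k
      by unfold_locales (use k Q2 other new in auto)
    have "Y \<in> S2.upper_bound" by (rule step.hyps(3)[OF s S2])
    then show ?thesis using upper_bound_mutation by blast
  next
    case False
    have "(M', Q') = s"
      using step.hyps(2)
    proof (cases rule: converse_rtranclpE)
      case (step s')
      then show ?thesis using False s by (auto simp: seed_mutation_def)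
    qed simp
    then obtain i where i: "i \<in> {1..l}" "Y = M2 (unit_vec i)" using Y s by (auto simp: cluster_def)
    show ?thesis
    proof (cases "i = k")
      case True then show ?thesis using i new S.mutated_upper_bound[OF k] by simp
    next
      case False
      then show ?thesis using i l other[of i] S.cluster_upper_bound[of i] by auto
    qed
  qed
qed

end

theorem theorem5p0p4:
  fixes n m l :: nat
    and \<Lambda> :: "nat \<Rightarrow> nat \<Rightarrow> int"
    and F :: "('a, 'b) ring_scheme"
    and \<iota> :: "torus_elem \<Rightarrow> 'a"
    and M :: "zvec \<Rightarrow> 'a"
    and Q :: ext_quiver
    and Y :: 'a
  assumes "l \<le> n"
    and "skew_symmetric (n + m) \<Lambda>"
    and "left_fraction_ring (supertorus n m \<Lambda>) (denominators n m) F \<iota>"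
    and "quantum_super_seed n m l \<Lambda> F \<iota> M Q"
    and "Y \<in> cluster_variables n m l \<Lambda> F \<iota> M Q"
  shows "Y \<in> laurent_ring n m l F \<iota> M"
proof -
  interpret fraction_superring n m \<Lambda> F \<iota> by unfold_locales fact
  obtain \<Lambda>' where S: "super_seed F qpow n m \<Lambda>' M l Q" using super_seed[OF assms(1,4)] .
  interpret S: super_seed F qpow n m \<Lambda>' M l Q by (rule S)
  obtain M' Q' where "(\<lambda>s s'. \<exists>k\<in>{1..l}. seed_mutation n m l \<Lambda> F \<iota> k s s')\<^sup>*\<^sup>* (M, Q) (M', Q')"
    "Y \<in> cluster l M'" using assms(5) unfolding cluster_variables_def by blast
  then have "Y \<in> S.upper_bound" by (rule cluster_variable_upper_bound[OF assms(1) _ _ S])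
  then have "Y \<in> S.laurent" unfolding S.upper_bound_def by blast
  then show ?thesis using laurent_le_laurent_ring[OF S] by blast
qed

end
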